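(* Let $\mu>0$ and let $\varepsilon_1,K$ be the small-data well-posedness constants (depending only on $\mu$) described in the context. For any $\alpha\in(0,1)$ there exist $\varepsilon_0\in(0,\varepsilon_1]$ and $C>0$, depending only on $\alpha$ and $\mu$, such that for every $v_0\in X^{-1}$ with $\|v_0\|_{X^{-1}}<\varepsilon_0$, the unique mild solution $v\in\mathcal{Y}$ of the incompressible Navier-Stokes equations on $\mathbb{T}^3$ with viscosity $\mu$ and initial data $v_0$ satisfying $|||v|||\le K\|v_0\|_{X^{-1}}$ is such that, for every $t>0$, $v(t,\cdot)$ is analytic with radius of analyticity $$R_\alpha\ \ge\ \max\{\mu\sqrt{t},\ \alpha\mu t\}.$$ In fact it holds that $$|||e^{\mu\sqrt{t}|D|}v|||+|||e^{\alpha\mu t|D|}v|||\ \le\ C\,\|v_0\|_{X^{-1}},$$ where $|D|$ is the operator whose Fourier multiplier is $\sum_{i=1}^3|k_i|$, $k\in\mathbb{Z}^3$.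
   Context: $\mathbb{T}^3$ is the cube $[0,2\pi]^3$ with periodic boundary conditions; $\hat f(k)=\frac{1}{(2\pi)^3}\int_{\mathbb{T}^3}f(x)e^{-ik\cdot x}\,dx$, $k\in\mathbb{Z}^3$, are Fourier coefficients, so $f(x)=\sum_{k\in\mathbb{Z}^3}\hat f(k)e^{ik\cdot x}$ (extended to distributions as usual). For $f$ depending also on time, $\hat f(t,k)$ is the Fourier coefficient in $x$ at time $t$. $|k|$ is the Euclidean norm and $\mathbb{Z}^3_*=\mathbb{Z}^3\setminus\{(0,0,0)\}$. Function spaces (used for scalar fields and, componentwise, for vector fields with values in three dimensions): $X^{-1}=\{f\in\mathcal{D}'(\mathbb{T}^3): \hat f(0)=0,\ \|f\|_{X^{-1}}=\sum_{k\in\mathbb{Z}^3_*}\frac{|\hat f(k)|}{|k|}<\infty\}$. $\mathcal{X}^{-1}=\{f\in\mathcal{D}'(\mathbb{R}_+\times\mathbb{T}^3): \hat f(\cdot,0)=0 \text{ in } \mathcal{D}'(\mathbb{R}_+),\ \|f\|_{\mathcal{X}^{-1}}=\sum_{k\in\mathbb{Z}^3_*}\sup_{t\ge 0}\frac{|\hat f(t,k)|}{|k|}<\infty\}$. $\mathcal{X}^{1}=\{f\in\mathcal{D}'(\mathbb{R}_+\times\mathbb{T}^3): \|f\|_{\mathcal{X}^{1}}=\sum_{k\in\mathbb{Z}^3_*}\int_0^\infty |k||\hat f(t,k)|\,dt<\infty\}$. $\mathcal{Y}=\mathcal{X}^{-1}\cap\mathcal{X}^{1}$, a Banach space with norm $|||u|||=\|u\|_{\mathcal{X}^{-1}}+\|u\|_{\mathcal{X}^{1}}$.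 The incompressible Navier-Stokes equations are $\partial_t v+(v\cdot\nabla)v=-\nabla p+\mu\Delta v$ in $(0,\infty)\times\mathbb{T}^3$, $\mathrm{div}\,v=0$ in $[0,\infty)\times\mathbb{T}^3$, $v(0,\cdot)=v_0$. The Leray projector is $\mathbb{P}=\mathbb{I}-\nabla\Delta^{-1}\mathrm{div}$, and $e^{\mu t\Delta}$ is the heat semigroup, with Fourier multiplier $e^{-\mu t|k|^2}$; $\mathrm{div}(v\otimes v)$ is the vector field with $i$-th component $\sum_j\partial_j(v_iv_j)$. Mild solution: given $v_0\in X^{-1}$, $v\in\mathcal{Y}$ is a mild solution with initial data $v_0$ if $$v(t,\cdot)=e^{\mu t\Delta}[v_0]-\int_0^t e^{\mu(t-s)\Delta}\left[\mathbb{P}\,\mathrm{div}(v\otimes v)(s,\cdot)\right]ds .$$ Small-data well-posedness: there exist constants $\varepsilon_1>0$ and $K>0$ depending only on $\mu$ such that, for every $v_0\in X^{-1}$ with $\|v_0\|_{X^{-1}}<\varepsilon_1$, there is one and only one mild solution $v\in\mathcal{Y}$ with initial data $v_0$ satisfying $|||v|||\le K\|v_0\|_{X^{-1}}$. Such $\varepsilon_1,K$ are fixed. For a nonnegative function $\rho(t)$ (here $\rho(t)=\mu\sqrt t$ or $\rho(t)=\alpha\mu t$), $e^{\rho(t)|D|}v$ is the function of $(t,x)$ whose Fourier coefficients are $e^{\rho(t)\sum_i|k_i|}\hat v(t,k)$. The radius of analyticity of $v(t,\cdot)$ is the supremum of the $R>0$ such that $v(t,\cdot)$ (as a periodic function on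 $\mathbb{R}^3$) extends holomorphically to $\{x+iy: x,y\in\mathbb{R}^3,\ |y|<R\}$. *)

theory Defs
  imports "HOL-Analysis.Analysis"
begin

section \<open>Test functions and distributions on the torus\<close>

definition partial_deriv :: "3 \<Rightarrow> (real^3 \<Rightarrow> complex) \<Rightarrow> (real^3 \<Rightarrow> complex)" where
  "partial_deriv j \<phi> x = vector_derivative (\<lambda>s. \<phi> (x + s *\<^sub>R axis j 1)) (at 0)"

primrec C_k :: "nat \<Rightarrow> (real^3 \<Rightarrow> complex) \<Rightarrow> bool" where
  "C_k 0 \<phi> \<longleftrightarrow> continuous_on UNIV \<phi>"
| "C_k (Suc n) \<phi> \<longleftrightarrow> \<phi> differentiable_on UNIV \<and> (\<forall>j. C_k n (partial_deriv j \<phi>))"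

definition periodic :: "(real^3 \<Rightarrow> complex) \<Rightarrow> bool" where
  "periodic \<phi> \<longleftrightarrow> (\<forall>x j. \<phi> (x + (2 * pi) *\<^sub>R axis j 1) = \<phi> x)"

definition test_functions :: "(real^3 \<Rightarrow> complex) set" where
  "test_functions = {\<phi>. (\<forall>n. C_k n \<phi>) \<and> periodic \<phi>}"

type_synonym functional = "(real^3 \<Rightarrow> complex) \<Rightarrow> complex"

text \<open>
  Only the values of a functional on \<^const>\<open>test_functions\<close> are meaningful.  Continuity is with
  respect to the Frechet topology given by the suprema of all iterated partial derivatives.
\<close>

definition torus_distribution :: "functional \<Rightarrow> bool" where
  "torus_distribution T \<longleftrightarrow>
     (\<forall>\<phi>\<in>test_functions. \<forall>\<psi>\<in>test_functions. T (\<lambda>x. \<phi> x + \<psi> x) = T \<phi> + T \<psi>) \<and>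
     (\<forall>\<phi>\<in>test_functions. \<forall>c. T (\<lambda>x. c * \<phi> x) = c * T \<phi>) \<and>
     (\<exists>N C. \<forall>\<phi>\<in>test_functions. \<forall>B.
        (\<forall>js x. length js \<le> N \<longrightarrow> norm (foldr partial_deriv js \<phi> x) \<le> B) \<longrightarrow>
        norm (T \<phi>) \<le> C * B)"

definition torus_cell :: "(real^3) set" where
  "torus_cell = {x. \<forall>j. 0 \<le> x $ j \<and> x $ j \<le> 2 * pi}"

definition regular_distribution :: "(real^3 \<Rightarrow> complex) \<Rightarrow> functional" where
  "regular_distribution f \<phi> = set_lebesgue_integral lborel torus_cell (\<lambda>x. f x * \<phi> x)"

definition distr_partial :: "3 \<Rightarrow> functional \<Rightarrow> functional" where
  "distr_partial j T \<phi> = - T (partial_deriv j \<phi>)"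


section \<open>Fourier coefficients and Fourier multipliers\<close>

definition kvec :: "int^3 \<Rightarrow> real^3" where
  "kvec k = (\<chi> j. real_of_int (k $ j))"

definition torus_exp :: "int^3 \<Rightarrow> real^3 \<Rightarrow> complex" where
  "torus_exp k x = cis (kvec k \<bullet> x)"

definition fourier_coeff :: "functional \<Rightarrow> int^3 \<Rightarrow> complex" where
  "fourier_coeff T k = T (torus_exp (- k)) / of_real ((2 * pi) ^ 3)"

text \<open>The distribution \<open>\<Sum>k. c k * exp (i k \<cdot> x)\<close>, the sum being taken in the weak sense.\<close>

definition fourier_series :: "(int^3 \<Rightarrow> complex) \<Rightarrow> functional" where
  "fourier_series c \<phi> = (\<Sum>\<^sub>\<infinity>k. c k * regular_distribution (torus_exp k) \<phi>)"

definition fourier_multiplier :: "(int^3 \<Rightarrow> real) \<Rightarrow> functional \<Rightarrow> functional" where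
  "fourier_multiplier m T = fourier_series (\<lambda>k. of_real (m k) * fourier_coeff T k)"

text \<open>The value at \<open>x\<close> of a distribution with absolutely summable Fourier coefficients.\<close>

definition torus_value :: "functional \<Rightarrow> real^3 \<Rightarrow> complex" where
  "torus_value T x = (\<Sum>\<^sub>\<infinity>k. fourier_coeff T k * torus_exp k x)"

definition fourier_vec :: "functional^3 \<Rightarrow> int^3 \<Rightarrow> complex^3" where
  "fourier_vec u k = (\<chi> i. fourier_coeff (u $ i) k)"


section \<open>Function spaces\<close>

text \<open>
  Norms take values in the extended nonnegative reals; the norm on \<^typ>\<open>complex^3\<close> is Euclidean.
\<close>

definition norm_X_minus1 :: "functional^3 \<Rightarrow> ennreal" where
  "norm_X_minus1 f = (\<Sum>\<^sub>\<infinity>k\<in>UNIV - {0}. ennreal (norm (fourier_vec f k) / norm (kvec k)))"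

definition space_X_minus1 :: "(functional^3) set" where
  "space_X_minus1 = {f. (\<forall>i. torus_distribution (f $ i)) \<and> fourier_vec f 0 = 0 \<and>
                        norm_X_minus1 f < \<infinity>}"

text \<open>
  Time-dependent distributions are curves \<open>t \<mapsto> f t\<close>, \<open>t \<ge> 0\<close> (values at negative times are
  meaningless).  Weak local integrability makes such a curve a distribution on \<open>(0,\<infinity>)\<close> times the
  torus, acting on products by \<open>\<psi> \<otimes> \<phi> \<mapsto> \<integral> \<psi> t * f t \<phi> dt\<close>.
\<close>

type_synonym curve = "real \<Rightarrow> functional^3"

definition time_distribution :: "curve \<Rightarrow> bool" where
  "time_distribution f \<longleftrightarrow>
     (\<forall>t\<ge>0. \<forall>i. torus_distribution (f t $ i)) \<and>
     (\<forall>i. \<forall>\<phi>\<in>test_functions. \<forall>a b. 0 < a \<and> a < b \<longrightarrow>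
        set_integrable lborel {a..b} (\<lambda>t. (f t $ i) \<phi>))"

definition norm_calX_minus1 :: "curve \<Rightarrow> ennreal" where
  "norm_calX_minus1 f =
     (\<Sum>\<^sub>\<infinity>k\<in>UNIV - {0}. SUP t\<in>{0..}. ennreal (norm (fourier_vec (f t) k) / norm (kvec k)))"

definition norm_calX_1 :: "curve \<Rightarrow> ennreal" where
  "norm_calX_1 f =
     (\<Sum>\<^sub>\<infinity>k\<in>UNIV - {0}.
        \<integral>\<^sup>+t\<in>{0..}. ennreal (norm (kvec k) * norm (fourier_vec (f t) k)) \<partial>lborel)"

text \<open>The mean vanishes as a distribution in time, i.e. for almost every time.\<close>

definition space_calX_minus1 :: "curve set" where
  "space_calX_minus1 = {f. time_distribution f \<and>
     (AE t in lborel. 0 < t \<longrightarrow> fourier_vec (f t) 0 = 0) \<and> norm_calX_minus1 f < \<infinity>}"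

definition space_calX_1 :: "curve set" where
  "space_calX_1 = {f. time_distribution f \<and> norm_calX_1 f < \<infinity>}"

definition space_Y :: "curve set" where
  "space_Y = space_calX_minus1 \<inter> space_calX_1"

definition norm_Y :: "curve \<Rightarrow> ennreal" where
  "norm_Y f = norm_calX_minus1 f + norm_calX_1 f"


section \<open>Mild solutions of the Navier-Stokes equations\<close>

definition heat :: "real \<Rightarrow> functional \<Rightarrow> functional" where
  "heat r = fourier_multiplier (\<lambda>k. exp (- r * (norm (kvec k))\<^sup>2))"

text \<open>At \<open>k = 0\<close> the multiplier is \<open>0\<close> (division by zero), i.e. the inverse has zero mean.\<close>

definition inverse_laplacian :: "functional \<Rightarrow> functional" where
  "inverse_laplacian = fourier_multiplier (\<lambda>k. - 1 / (norm (kvec k))\<^sup>2)"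

definition distr_div :: "functional^3 \<Rightarrow> functional" where
  "distr_div u \<phi> = (\<Sum>j\<in>UNIV. distr_partial j (u $ j) \<phi>)"

definition leray :: "functional^3 \<Rightarrow> functional^3" where
  "leray u = (\<chi> i. (\<lambda>\<phi>. (u $ i) \<phi> - distr_partial i (inverse_laplacian (distr_div u)) \<phi>))"

text \<open>
  Pointwise products.  For \<open>v\<close> in \<^const>\<open>space_Y\<close>, almost every \<open>v s\<close> has absolutely summable
  Fourier coefficients, so that it is a continuous function.
\<close>

definition tensor :: "functional^3 \<Rightarrow> 3 \<Rightarrow> 3 \<Rightarrow> functional" where
  "tensor u i j = regular_distribution (\<lambda>x. torus_value (u $ i) x * torus_value (u $ j) x)"

definition div_tensor :: "functional^3 \<Rightarrow> functional^3" where
  "div_tensor u = (\<chi> i. (\<lambda>\<phi>. \<Sum>j\<in>UNIV. distr_partial j (tensor u i j) \<phi>))"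

definition mild_solution :: "real \<Rightarrow> functional^3 \<Rightarrow> curve \<Rightarrow> bool" where
  "mild_solution \<mu> v0 v \<longleftrightarrow>
     v0 \<in> space_X_minus1 \<and> v \<in> space_Y \<and>
     (\<forall>t\<ge>0. \<forall>i. \<forall>\<phi>\<in>test_functions.
        (v t $ i) \<phi> = heat (\<mu> * t) (v0 $ i) \<phi> -
          set_lebesgue_integral lborel {0..t}
            (\<lambda>s. heat (\<mu> * (t - s)) (leray (div_tensor (v s)) $ i) \<phi>))"

definition bounded_mild_solution :: "real \<Rightarrow> real \<Rightarrow> functional^3 \<Rightarrow> curve \<Rightarrow> bool" where
  "bounded_mild_solution \<mu> K v0 v \<longleftrightarrow>
     mild_solution \<mu> v0 v \<and> norm_Y v \<le> ennreal K * norm_X_minus1 v0"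

definition same_curve :: "curve \<Rightarrow> curve \<Rightarrow> bool" where
  "same_curve v w \<longleftrightarrow> (\<forall>t\<ge>0. \<forall>i. \<forall>\<phi>\<in>test_functions. (v t $ i) \<phi> = (w t $ i) \<phi>)"

definition small_data_wellposed :: "real \<Rightarrow> real \<Rightarrow> real \<Rightarrow> bool" where
  "small_data_wellposed \<mu> \<epsilon>1 K \<longleftrightarrow>
     0 < \<epsilon>1 \<and> 0 < K \<and>
     (\<forall>v0\<in>space_X_minus1. norm_X_minus1 v0 < ennreal \<epsilon>1 \<longrightarrow>
        (\<exists>v. bounded_mild_solution \<mu> K v0 v \<and>
             (\<forall>w. bounded_mild_solution \<mu> K v0 w \<longrightarrow> same_curve w v)))"


section \<open>Analyticity\<close>

definition exp_absD :: "(real \<Rightarrow> real) \<Rightarrow> curve \<Rightarrow> curve" where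
  "exp_absD \<rho> v t =
     (\<chi> i. fourier_multiplier (\<lambda>k. exp (\<rho> t * (\<Sum>j\<in>UNIV. \<bar>real_of_int (k $ j)\<bar>))) (v t $ i))"

definition complex_strip :: "real \<Rightarrow> (complex^3) set" where
  "complex_strip R = {z. norm (\<chi> j. Im (z $ j)) < R}"

definition holomorphic3_on :: "(complex^3 \<Rightarrow> complex) \<Rightarrow> (complex^3) set \<Rightarrow> bool" where
  "holomorphic3_on F S \<longleftrightarrow>
     (\<forall>z\<in>S. \<exists>D. (F has_derivative D) (at z) \<and> (\<forall>c w. D (c *s w) = c * D w))"

definition of_real_vec :: "real^3 \<Rightarrow> complex^3" where
  "of_real_vec x = (\<chi> j. of_real (x $ j))"

definition extends_to_strip :: "functional \<Rightarrow> real \<Rightarrow> bool" where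
  "extends_to_strip T R \<longleftrightarrow>
     (\<exists>F. holomorphic3_on F (complex_strip R) \<and>
          periodic (\<lambda>x. F (of_real_vec x)) \<and>
          (\<forall>\<phi>\<in>test_functions. T \<phi> = regular_distribution (\<lambda>x. F (of_real_vec x)) \<phi>))"

text \<open>Possibly infinite; it is \<open>-\<infinity>\<close> if there is no extension to any strip.\<close>

definition analyticity_radius :: "functional^3 \<Rightarrow> ereal" where
  "analyticity_radius u = Sup {ereal R | R. 0 < R \<and> (\<forall>i. extends_to_strip (u $ i) R)}"

end

theory Submission
  imports Defs
begin

text \<open>
  In Fourier variables the mild formulation gives, with \<open>*\<close> the convolution over the frequencies,

    \<open>|v(t,k)| \<le> exp (-\<mu> t |k|\<^sup>2) |v\<^sub>0(k)| + C \<integral> exp (-\<mu> (t-s) |k|\<^sup>2) |k| (|v| * |v|)(s,k) ds\<close>,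

  where \<open>s\<close> runs through \<open>[0,t]\<close>.  The weight \<open>exp (\<rho>(t) |k|\<^sub>1)\<close> is compatible with this
  inequality.  Since the \<open>l\<^sup>1\<close> norm is subadditive, the weight at time \<open>s\<close> passes inside the
  convolution.  The factor \<open>exp ((\<rho>(t) - \<rho>(s)) |k|\<^sub>1)\<close> that remains is absorbed by a part of the
  heat kernel: for \<open>\<rho>(t) = \<mu> \<surd>t\<close> because \<open>\<surd>t - \<surd>s \<le> \<surd>(t-s)\<close> and
  \<open>x |k|\<^sub>1 \<le> 3/2 + x\<^sup>2 |k|\<^sup>2 / 2\<close>, and for \<open>\<rho>(t) = \<alpha> \<mu> t\<close> because \<open>|k|\<^sub>1 \<le> |k|\<^sup>2\<close> on integer
  vectors.  Both cases are instances of the locale \<open>gevrey_gain\<close>: the weighted solution satisfies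
  the same inequality with a smaller viscosity \<open>\<beta> > 0\<close> and an additional constant factor.
  Integrating the heat kernel in time and using \<open>1 \<le> |l|/|m| + |m|/|l|\<close> in the convolution
  (\<open>energy_le_of_duhamel\<close>, \<open>nn_integral_conv_le\<close>) turns the inequality into
  \<open>x \<le> D (e + 2 A x\<^sup>2)\<close> for the norm \<open>x\<close> of the weighted solution, where \<open>e\<close> is a multiple of
  the norm of the data.

  A quadratic inequality bounds \<open>x\<close> only if \<open>x\<close> is known to be finite and to lie below the larger
  root.  The bound is therefore proved for the given solution with the truncated weight
  \<open>exp (min \<rho>(t) M * min |k|\<^sub>1 N)\<close>, which is bounded and satisfies the same estimates with the
  same constants.  For \<open>M = 0\<close> the norm is controlled by the hypothesis on \<open>v\<close>; a small increase
  of \<open>M\<close> at most doubles it, so that for small data it can never jump over the gap between the two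
  roots (\<open>small_root_continuation\<close>).  The bound is uniform in \<open>M\<close> and \<open>N\<close>, and monotone
  convergence gives the weighted estimate (\<open>gevrey_energy_bound\<close>).

  The weighted bound makes \<open>\<Sum>k. v(t,k) exp (i k \<cdot> z)\<close> converge and be holomorphic for
  \<open>|Im z| < \<rho>(t)\<close>, as \<open>|k \<cdot> y| \<le> |k|\<^sub>1 |y|\<close> (\<open>holomorphic_fourier_series\<close>).  That the distribution
  \<open>v(t)\<close> is the sum of its Fourier series is read off from the mild formulation
  (\<open>mild_eq_fourier_series\<close>): there the heat semigroup already produces Fourier series, and Fubini's
  theorem exchanges the sum with the time integral.  The summability behind this exchange comes from
  the bound of \<open>|k|\<close> times the \<open>k\<close>-th Fourier coefficient of a test function by the supremum of its
  gradient, an integration by parts on the torus.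
\<close>

section \<open>Integer frequencies\<close>

lemma kvec_0 [simp]: "kvec 0 = 0"
  by (simp add: kvec_def vec_eq_iff)

lemma kvec_eq_0_iff [simp]: "kvec k = 0 \<longleftrightarrow> k = 0"
  by (simp add: kvec_def vec_eq_iff)

lemma kvec_add: "kvec (k + l) = kvec k + kvec l"
  by (simp add: kvec_def vec_eq_iff)

lemma one_le_norm_kvec: "k \<noteq> 0 \<Longrightarrow> 1 \<le> norm (kvec k)"
proof -
  assume "k \<noteq> 0"
  then obtain j where "k $ j \<noteq> 0" by (auto simp: vec_eq_iff)
  then have "1 \<le> \<bar>real_of_int (k $ j)\<bar>" by linarith
  also have "\<dots> \<le> norm (kvec k)"
    using component_le_norm_cart[of "kvec k" j] by (simp add: kvec_def)
  finally show ?thesis .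
qed

definition norm1 :: "int^3 \<Rightarrow> real" where
  "norm1 k = (\<Sum>j\<in>UNIV. \<bar>real_of_int (k $ j)\<bar>)"

lemma norm1_nonneg: "0 \<le> norm1 k"
  by (simp add: norm1_def sum_nonneg)

lemma norm1_triangle: "norm1 k \<le> norm1 l + norm1 (k - l)"
  unfolding norm1_def sum.distrib[symmetric] by (intro sum_mono) simp

lemma norm_kvec_le_norm1: "norm (kvec k) \<le> norm1 k"
  using norm_le_l1_cart[of "kvec k"] by (simp add: norm1_def kvec_def)

lemma norm_kvec_sq: "(norm (kvec k))\<^sup>2 = (\<Sum>j\<in>UNIV. (real_of_int (k $ j))\<^sup>2)"
  unfolding power2_norm_eq_inner by (simp add: inner_vec_def kvec_def power2_eq_square)

text \<open>
  This is where the frequencies being integers matters: \<open>\<bar>n\<bar> \<le> n\<^sup>2\<close>.  It allows the weight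
  \<open>exp (\<alpha> \<mu> t \<bar>k\<bar>\<^sub>1)\<close> for every \<open>\<alpha> < 1\<close>.
\<close>

lemma norm1_le_norm_kvec_sq: "norm1 k \<le> (norm (kvec k))\<^sup>2"
  unfolding norm1_def norm_kvec_sq
proof (rule sum_mono)
  fix j
  show "\<bar>real_of_int (k $ j)\<bar> \<le> (real_of_int (k $ j))\<^sup>2"
  proof (cases "k $ j = 0")
    case False
    then have "1 \<le> \<bar>real_of_int (k $ j)\<bar>" by linarith
    then have "\<bar>real_of_int (k $ j)\<bar> * 1 \<le> \<bar>real_of_int (k $ j)\<bar> * \<bar>real_of_int (k $ j)\<bar>"
      by (intro mult_left_mono) auto
    then show ?thesis by (simp add: power2_eq_square)
  qed simp
qed

lemma norm1_sq_le: "(norm1 k)\<^sup>2 \<le> 3 * (norm (kvec k))\<^sup>2"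
proof -
  have "(norm1 k)\<^sup>2 \<le> (\<Sum>j\<in>(UNIV::3 set). (1::real)\<^sup>2) * (\<Sum>j\<in>UNIV. \<bar>real_of_int (k $ j)\<bar>\<^sup>2)"
    unfolding norm1_def using Cauchy_Schwarz_ineq_sum[of "\<lambda>_. 1" "\<lambda>j. \<bar>real_of_int (k $ j)\<bar>" UNIV] by simp
  then show ?thesis by (simp add: norm_kvec_sq)
qed

section \<open>Sums over frequencies as integrals\<close>

text \<open>
  Writing all sums as integrals over a counting measure makes every exchange of a sum with an
  integral an instance of the theorems of Tonelli and Fubini.
\<close>

lemma infsum_ennreal_eq_nn_integral:
  fixes f :: "'a::countable \<Rightarrow> ennreal"
  shows "infsum f A = (\<integral>\<^sup>+x. f x \<partial>count_space A)"
proof (rule antisym)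
  have "sum f F \<le> (\<integral>\<^sup>+x. f x \<partial>count_space A)" if "finite F" "F \<subseteq> A" for F
  proof -
    have "sum f F = (\<integral>\<^sup>+x. f x * indicator F x \<partial>count_space A)"
      using that by (subst nn_integral_count_space'[where A=F]) (auto simp: indicator_def)
    also have "\<dots> \<le> (\<integral>\<^sup>+x. f x \<partial>count_space A)"
      by (intro nn_integral_mono) (auto simp: indicator_def)
    finally show ?thesis .
  qed
  then show "infsum f A \<le> (\<integral>\<^sup>+x. f x \<partial>count_space A)"
    by (subst nonneg_infsum_complete) (auto intro!: SUP_least)
next
  let ?F = "\<lambda>n. {x\<in>A. to_nat x < n}"
  have fin: "finite (?F n)" for n
    by (rule finite_imageD[where f=to_nat]) (auto intro: finite_subset[of _ "{..<n}"])
  have "(\<integral>\<^sup>+x. f x \<partial>count_space A) = (\<integral>\<^sup>+x. (SUP n. f x * indicator (?F n) x) \<partial>count_space A)"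
  proof (rule nn_integral_cong)
    fix x assume "x \<in> space (count_space A)"
    then have "f x * indicator (?F (Suc (to_nat x))) x = f x" by simp
    then have "f x \<le> (SUP n. f x * indicator (?F n) x)"
      using SUP_upper[of "Suc (to_nat x)" UNIV "\<lambda>n. f x * indicator (?F n) x"] by simp
    moreover have "(SUP n. f x * indicator (?F n) x) \<le> f x"
      by (rule SUP_least) (auto simp: indicator_def)
    ultimately show "f x = (SUP n. f x * indicator (?F n) x)" by simp
  qed
  also have "\<dots> = (SUP n. \<integral>\<^sup>+x. f x * indicator (?F n) x \<partial>count_space A)"
    by (intro nn_integral_monotone_convergence_SUP) (auto simp: incseq_def le_fun_def indicator_def)
  also have "\<dots> = (SUP n. sum f (?F n))"
    using fin by (intro SUP_cong refl, subst nn_integral_count_space'[where A="?F _"])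
      (auto simp: indicator_def)
  also have "\<dots> \<le> infsum f A"
    using fin by (subst nonneg_infsum_complete) (auto intro!: SUP_least SUP_upper)
  finally show "(\<integral>\<^sup>+x. f x \<partial>count_space A) \<le> infsum f A" .
qed

lemma measurable_countable_param:
  fixes h :: "'a \<Rightarrow> 'c::countable \<Rightarrow> 'b"
  assumes "\<And>k. (\<lambda>t. h t k) \<in> measurable M N"
  shows "(\<lambda>(t, k). h t k) \<in> measurable (M \<Otimes>\<^sub>M count_space UNIV) N"
  unfolding case_prod_beta' using assms
  by (intro measurable_compose_countable[where f="\<lambda>k p. h (fst p) k" and g=snd]) auto

lemma nn_integral_count_space_zero_mode:
  assumes "f 0 = 0"
  shows "(\<integral>\<^sup>+k. f k \<partial>count_space (UNIV - {0::int^3})) = (\<integral>\<^sup>+k. f k \<partial>count_space UNIV)"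
  using assms by (subst nn_integral_count_space_indicator)
    (auto intro!: nn_integral_cong simp: indicator_def)

text \<open>
  Both sides are \<open>0\<close> if the family is not summable, as summability of complex numbers is absolute.
  Hence such sums depend measurably on parameters, also where they diverge.
\<close>

lemma infsum_eq_lebesgue_integral:
  fixes f :: "'a \<Rightarrow> complex"
  shows "infsum f A = (\<integral>x. f x \<partial>count_space A)"
proof (cases "Infinite_Set_Sum.abs_summable_on f A")
  case True
  then have "infsetsum f A = infsum f A" by (rule infsetsum_infsum)
  then show ?thesis by (simp add: infsetsum_def)
next
  case False
  then have "\<not> f summable_on A"
    using abs_summable_equivalent summable_on_iff_abs_summable_on_complex by blast
  then show ?thesis
    using False by (simp add: infsum_not_exists not_integrable_integral_eq abs_summable_on_def)
qed

lemma summable_on_iff_nn_integral_finite: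
  fixes f :: "'a \<Rightarrow> complex"
  shows "f summable_on A \<longleftrightarrow> (\<integral>\<^sup>+x. ennreal (norm (f x)) \<partial>count_space A) < \<infinity>"
proof -
  have "f summable_on A \<longleftrightarrow> Infinite_Set_Sum.abs_summable_on f A"
    using abs_summable_equivalent summable_on_iff_abs_summable_on_complex by blast
  then show ?thesis by (simp add: abs_summable_on_def integrable_iff_bounded)
qed

lemma norm_infsum_le_nn_integral:
  fixes f :: "'a \<Rightarrow> complex"
  shows "ennreal (norm (infsum f A)) \<le> (\<integral>\<^sup>+x. ennreal (norm (f x)) \<partial>count_space A)"
  unfolding infsum_eq_lebesgue_integral
  by (cases "integrable (count_space A) f")
     (simp_all add: integral_norm_bound_ennreal not_integrable_integral_eq)

lemma measurable_infsum:
  fixes f :: "'k::countable \<Rightarrow> 'b \<Rightarrow> complex"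
  assumes "\<And>k. f k \<in> borel_measurable M"
  shows "(\<lambda>x. \<Sum>\<^sub>\<infinity>k. f k x) \<in> borel_measurable M"
proof -
  interpret sigma_finite_measure "count_space (UNIV :: 'k set)"
    by (rule sigma_finite_measure_count_space)
  have [measurable]: "(\<lambda>(x, k). f k x) \<in> borel_measurable (M \<Otimes>\<^sub>M count_space UNIV)"
    by (rule measurable_countable_param) (use assms in auto)
  show ?thesis unfolding infsum_eq_lebesgue_integral by measurable
qed

text \<open>
  Fubini's theorem for the product with the counting measure.
\<close>

lemma
  fixes f :: "'k::countable \<Rightarrow> 'b \<Rightarrow> complex"
  assumes "sigma_finite_measure M"
    and meas: "\<And>k. f k \<in> borel_measurable M"
    and fin: "(\<integral>\<^sup>+k. (\<integral>\<^sup>+x. ennreal (norm (f k x)) \<partial>M) \<partial>count_space UNIV) < \<infinity>"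
  shows integral_infsum: "(\<integral>x. (\<Sum>\<^sub>\<infinity>k. f k x) \<partial>M) = (\<Sum>\<^sub>\<infinity>k. \<integral>x. f k x \<partial>M)"
    and integrable_infsum: "integrable M (\<lambda>x. \<Sum>\<^sub>\<infinity>k. f k x)"
    and summable_integral: "(\<lambda>k. \<integral>x. f k x \<partial>M) summable_on UNIV"
proof -
  interpret M: sigma_finite_measure M by fact
  interpret C: sigma_finite_measure "count_space (UNIV :: 'k set)"
    by (rule sigma_finite_measure_count_space)
  interpret P: pair_sigma_finite M "count_space (UNIV :: 'k set)" ..
  have m [measurable]: "(\<lambda>(x, k). f k x) \<in> borel_measurable (M \<Otimes>\<^sub>M count_space UNIV)"
    by (rule measurable_countable_param) (use meas in auto)
  have int: "integrable (M \<Otimes>\<^sub>M count_space UNIV) (\<lambda>(x, k). f k x)"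
  proof (rule integrableI_bounded[OF m])
    have "(\<integral>\<^sup>+p. ennreal (norm (case p of (x, k) \<Rightarrow> f k x)) \<partial>(M \<Otimes>\<^sub>M count_space UNIV))
        = (\<integral>\<^sup>+x. (\<integral>\<^sup>+k. ennreal (norm (f k x)) \<partial>count_space UNIV) \<partial>M)"
      by (subst C.nn_integral_fst[symmetric]) auto
    also have "\<dots> = (\<integral>\<^sup>+k. (\<integral>\<^sup>+x. ennreal (norm (f k x)) \<partial>M) \<partial>count_space UNIV)"
      using meas by (intro nn_integral_count_space_nn_integral) auto
    finally show "(\<integral>\<^sup>+p. ennreal (norm (case p of (x, k) \<Rightarrow> f k x)) \<partial>(M \<Otimes>\<^sub>M count_space UNIV)) < \<infinity>"
      using fin by simp
  qed
  show "(\<integral>x. (\<Sum>\<^sub>\<infinity>k. f k x) \<partial>M) = (\<Sum>\<^sub>\<infinity>k. \<integral>x. f k x \<partial>M)"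
    unfolding infsum_eq_lebesgue_integral using P.Fubini_integral[OF int] by simp
  show "integrable M (\<lambda>x. \<Sum>\<^sub>\<infinity>k. f k x)"
    unfolding infsum_eq_lebesgue_integral using P.integrable_fst[OF int] by simp
  have "(\<integral>\<^sup>+k. ennreal (norm (\<integral>x. f k x \<partial>M)) \<partial>count_space UNIV)
      \<le> (\<integral>\<^sup>+k. (\<integral>\<^sup>+x. ennreal (norm (f k x)) \<partial>M) \<partial>count_space UNIV)"
  proof (rule nn_integral_mono)
    fix k show "ennreal (norm (\<integral>x. f k x \<partial>M)) \<le> (\<integral>\<^sup>+x. ennreal (norm (f k x)) \<partial>M)"
      by (cases "integrable M (f k)") (simp_all add: integral_norm_bound_ennreal not_integrable_integral_eq)
  qed
  then show "(\<lambda>k. \<integral>x. f k x \<partial>M) summable_on UNIV"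
    unfolding summable_on_iff_nn_integral_finite using fin by (rule order_le_less_trans)
qed

lemma summable_bound:
  fixes f :: "'a \<Rightarrow> complex" and g :: "'a \<Rightarrow> real"
  assumes g: "g summable_on A" and le: "\<And>x. x \<in> A \<Longrightarrow> norm (f x) \<le> g x"
  shows "f summable_on A" and "norm (infsum f A) \<le> infsum g A"
proof -
  have "(\<lambda>x. norm (f x)) summable_on A"
    using Infinite_Sum.abs_summable_on_comparison_test'[OF g, of f] le by simp
  then show f: "f summable_on A" by (simp add: summable_on_iff_abs_summable_on_complex)
  show "norm (infsum f A) \<le> infsum g A"
    by (rule norm_infsum_le[OF has_sum_infsum[OF f] has_sum_infsum[OF g]]) (fact le)
qed

section \<open>The bilinear estimate and the Duhamel inequality\<close>

text \<open>
  The norms of \<open>calX_minus1\<close> and \<open>calX_1\<close> in terms of the moduli of the Fourier coefficients.  Families are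
  extended by \<open>0\<close> to negative times and to the zero frequency, so that time integrals run over the
  whole line and sums over all frequencies.
\<close>

definition energy_sup :: "(real \<Rightarrow> int^3 \<Rightarrow> ennreal) \<Rightarrow> ennreal" where
  "energy_sup h = (\<integral>\<^sup>+k. (SUP t. h t k * ennreal (1 / norm (kvec k))) \<partial>count_space UNIV)"

definition energy_int :: "(real \<Rightarrow> int^3 \<Rightarrow> ennreal) \<Rightarrow> ennreal" where
  "energy_int h = (\<integral>\<^sup>+k. (\<integral>\<^sup>+t. h t k * ennreal (norm (kvec k)) \<partial>lborel) \<partial>count_space UNIV)"

definition conv :: "(int^3 \<Rightarrow> ennreal) \<Rightarrow> int^3 \<Rightarrow> ennreal" where
  "conv f k = (\<integral>\<^sup>+l. f l * f (k - l) \<partial>count_space UNIV)"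

lemma measurable_conv:
  assumes "\<And>k. (\<lambda>t. h t k) \<in> borel_measurable M"
  shows "(\<lambda>t. conv (h t) k) \<in> borel_measurable M"
proof -
  interpret sigma_finite_measure "count_space (UNIV :: (int^3) set)"
    by (rule sigma_finite_measure_count_space)
  have [measurable]: "(\<lambda>(t, l). h t l) \<in> borel_measurable (M \<Otimes>\<^sub>M count_space UNIV)"
    by (rule measurable_countable_param) (use assms in auto)
  have [measurable]: "(\<lambda>(t, l). h t (k - l)) \<in> borel_measurable (M \<Otimes>\<^sub>M count_space UNIV)"
    by (rule measurable_countable_param) (use assms in auto)
  show ?thesis unfolding conv_def by measurable
qed

text \<open>
  One of \<open>b / a\<close> and \<open>a / b\<close> is at least \<open>1\<close>.
\<close>

lemma product_le_weighted_products:
  fixes x y :: ennreal and a b :: real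
  assumes "0 < a" "0 < b"
  shows "x * y \<le> (x * ennreal (1 / a)) * (y * ennreal b) + (y * ennreal (1 / b)) * (x * ennreal a)"
proof (cases "a \<le> b")
  case True
  then have "(1::ennreal) \<le> ennreal (1 / a * b)"
    using assms by (simp add: field_simps)
  then have "x * y * 1 \<le> x * y * ennreal (1 / a * b)" by (rule mult_left_mono) simp
  also have "\<dots> = (x * ennreal (1 / a)) * (y * ennreal b)"
    using assms by (subst ennreal_mult) (auto simp: mult_ac)
  finally show ?thesis by (simp add: add_increasing2)
next
  case False
  then have "(1::ennreal) \<le> ennreal (1 / b * a)"
    using assms by (simp add: field_simps)
  then have "x * y * 1 \<le> x * y * ennreal (1 / b * a)" by (rule mult_left_mono) simp
  also have "\<dots> = (y * ennreal (1 / b)) * (x * ennreal a)"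
    using assms by (subst ennreal_mult) (auto simp: mult_ac)
  finally show ?thesis by (simp add: add_increasing)
qed

text \<open>
  In a product of two modes, the one with the smaller frequency is measured by its supremum in time
  and the other one by its time integral; the weights \<open>1 / \<bar>l\<bar>\<close> and \<open>\<bar>m\<bar>\<close> then multiply to at least
  \<open>1\<close>.  Summing over all pairs of frequencies gives the product of the two norms.
\<close>

lemma nn_integral_conv_le:
  assumes meas [measurable]: "\<And>k. (\<lambda>t. h t k) \<in> borel_measurable lborel"
    and zero: "\<And>t. h t 0 = 0"
  shows "(\<integral>\<^sup>+k. (\<integral>\<^sup>+t. conv (h t) k \<partial>lborel) \<partial>count_space UNIV) \<le> 2 * energy_sup h * energy_int h"
proof -
  let ?cs = "count_space (UNIV :: (int^3) set)"
  define X where "X k = (SUP t. h t k * ennreal (1 / norm (kvec k)))" for k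
  define Y where "Y k = (\<integral>\<^sup>+t. h t k * ennreal (norm (kvec k)) \<partial>lborel)" for k
  have pair: "(\<integral>\<^sup>+t. h t l * h t m \<partial>lborel) \<le> X l * Y m + X m * Y l" for l m
  proof (cases "l = 0 \<or> m = 0")
    case True then show ?thesis using zero by auto
  next
    case False
    have "(\<integral>\<^sup>+t. h t l * h t m \<partial>lborel) \<le>
       (\<integral>\<^sup>+t. X l * (h t m * ennreal (norm (kvec m))) + X m * (h t l * ennreal (norm (kvec l))) \<partial>lborel)"
    proof (rule nn_integral_mono)
      fix t
      have "h t l * h t m \<le> (h t l * ennreal (1 / norm (kvec l))) * (h t m * ennreal (norm (kvec m)))
          + (h t m * ennreal (1 / norm (kvec m))) * (h t l * ennreal (norm (kvec l)))"
        using False by (intro product_le_weighted_products) auto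
      also have "\<dots> \<le> X l * (h t m * ennreal (norm (kvec m))) + X m * (h t l * ennreal (norm (kvec l)))"
        unfolding X_def by (intro add_mono mult_right_mono SUP_upper) auto
      finally show "h t l * h t m \<le> X l * (h t m * ennreal (norm (kvec m))) + X m * (h t l * ennreal (norm (kvec l)))" .
    qed
    also have "\<dots> = X l * Y m + X m * Y l"
      unfolding Y_def by (subst nn_integral_add) (auto simp: nn_integral_cmult)
    finally show ?thesis .
  qed
  have "(\<integral>\<^sup>+k. (\<integral>\<^sup>+t. conv (h t) k \<partial>lborel) \<partial>?cs)
      = (\<integral>\<^sup>+k. (\<integral>\<^sup>+l. (\<integral>\<^sup>+t. h t l * h t (k - l) \<partial>lborel) \<partial>?cs) \<partial>?cs)"
    unfolding conv_def by (intro nn_integral_cong nn_integral_count_space_nn_integral) auto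
  also have "\<dots> = (\<integral>\<^sup>+l. (\<integral>\<^sup>+k. (\<integral>\<^sup>+t. h t l * h t (k - l) \<partial>lborel) \<partial>?cs) \<partial>?cs)"
    by (rule nn_integral_count_space_nn_integral) auto
  also have "\<dots> = (\<integral>\<^sup>+l. (\<integral>\<^sup>+m. (\<integral>\<^sup>+t. h t l * h t m \<partial>lborel) \<partial>?cs) \<partial>?cs)"
  proof (rule nn_integral_cong)
    fix l
    show "(\<integral>\<^sup>+k. (\<integral>\<^sup>+t. h t l * h t (k - l) \<partial>lborel) \<partial>?cs) = (\<integral>\<^sup>+m. (\<integral>\<^sup>+t. h t l * h t m \<partial>lborel) \<partial>?cs)"
      by (rule nn_integral_bij_count_space[where g="\<lambda>k. k - l"])
         (auto intro!: bij_betwI[where g="\<lambda>k. k + l"])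
  qed
  also have "\<dots> \<le> (\<integral>\<^sup>+l. (\<integral>\<^sup>+m. X l * Y m + X m * Y l \<partial>?cs) \<partial>?cs)"
    by (intro nn_integral_mono pair)
  also have "\<dots> = (\<integral>\<^sup>+l. X l * energy_int h + energy_sup h * Y l \<partial>?cs)"
    by (intro nn_integral_cong, subst nn_integral_add)
       (auto simp: nn_integral_cmult nn_integral_multc energy_int_def energy_sup_def X_def Y_def)
  also have "\<dots> = energy_sup h * energy_int h + energy_sup h * energy_int h"
    by (subst nn_integral_add)
       (auto simp: nn_integral_cmult nn_integral_multc energy_int_def energy_sup_def X_def Y_def)
  also have "\<dots> = 2 * energy_sup h * energy_int h"
    by (simp add: mult_2 distrib_right)
  finally show ?thesis .
qed

text \<open>
  Vanishing for negative \<open>\<tau>\<close>, so that \<open>heat_kernel \<beta> k (t - s)\<close> restricts the Duhamel integral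
  to \<open>s \<le> t\<close>.
\<close>

definition heat_kernel :: "real \<Rightarrow> int^3 \<Rightarrow> real \<Rightarrow> ennreal" where
  "heat_kernel \<beta> k \<tau> = (if 0 \<le> \<tau> then ennreal (exp (- (\<beta> * (norm (kvec k))\<^sup>2 * \<tau>))) else 0)"

lemma measurable_heat_kernel [measurable]: "heat_kernel \<beta> k \<in> borel_measurable borel"
  unfolding heat_kernel_def by measurable

lemma heat_kernel_le_1: "0 \<le> \<beta> \<Longrightarrow> heat_kernel \<beta> k \<tau> \<le> 1"
  by (simp add: heat_kernel_def)

lemma nn_integral_heat_kernel:
  assumes "0 < \<beta>" "k \<noteq> 0"
  shows "(\<integral>\<^sup>+t. heat_kernel \<beta> k (t - s) \<partial>lborel) = ennreal (1 / (\<beta> * (norm (kvec k))\<^sup>2))"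
proof -
  define c where "c = \<beta> * (norm (kvec k))\<^sup>2"
  have c: "0 < c" using assms by (simp add: c_def)
  have "((\<lambda>t. - exp (- (c * (t - s))) / c) \<longlongrightarrow> - 0 / c) at_top"
  proof (intro tendsto_intros filterlim_compose[OF exp_at_bot])
    have "LIM t at_top. c * (- s + t) :> at_top"
      using c
      by (intro filterlim_tendsto_pos_mult_at_top[OF tendsto_const]
            filterlim_tendsto_add_at_top[OF tendsto_const] filterlim_ident)
    then show "LIM t at_top. - (c * (t - s)) :> at_bot"
      by (simp add: filterlim_uminus_at_bot)
  qed (use c in auto)
  then have "(\<integral>\<^sup>+t. ennreal (exp (- (c * (t - s)))) * indicator {s..} t \<partial>lborel)
     = ennreal (- 0 / c - (- exp (- (c * (s - s))) / c))"
    using c by (intro nn_integral_FTC_atLeast) (auto intro!: derivative_eq_intros)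
  moreover have "heat_kernel \<beta> k (t - s) = ennreal (exp (- (c * (t - s)))) * indicator {s..} t" for t
    by (simp add: heat_kernel_def c_def indicator_def)
  ultimately show ?thesis using c by (simp add: c_def)
qed

text \<open>
  The factor \<open>\<bar>k\<bar>\<close> of the nonlinearity is cancelled by the weight \<open>1 / \<bar>k\<bar>\<close> in the first norm.  In the
  second one it combines with the weight \<open>\<bar>k\<bar>\<close> to \<open>\<bar>k\<bar>\<^sup>2\<close>, which the time integral
  \<open>1 / (\<beta> \<bar>k\<bar>\<^sup>2)\<close> of the heat kernel compensates.  Both norms thus reduce to the total mass of the
  convolution.
\<close>

lemma energy_le_of_duhamel:
  assumes meas [measurable]: "\<And>k. (\<lambda>t. h t k) \<in> borel_measurable lborel"
    and zero: "\<And>t. h t 0 = 0"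
    and \<beta>: "0 < \<beta>"
    and duhamel: "\<And>t k. k \<noteq> 0 \<Longrightarrow> h t k \<le> B * (heat_kernel \<beta> k t * g0 k
        + A * (\<integral>\<^sup>+s. ennreal (norm (kvec k)) * (heat_kernel \<beta> k (t - s) * conv (h s) k) \<partial>lborel))"
  shows "energy_sup h + energy_int h \<le> B * ennreal (1 + 1 / \<beta>)
    * ((\<integral>\<^sup>+k. g0 k * ennreal (1 / norm (kvec k)) \<partial>count_space UNIV) + A * (2 * energy_sup h * energy_int h))"
proof -
  have [measurable]: "(\<lambda>t. conv (h t) k) \<in> borel_measurable borel" for k
    using measurable_conv[of h lborel k] meas by simp
  define Q where "Q k = (\<integral>\<^sup>+s. conv (h s) k \<partial>lborel)" for k
  \<comment> \<open>Up to constant factors, \<open>R k\<close> bounds the contribution of the frequency \<open>k\<close> to both norms.\<close>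
  define R where "R k = g0 k * ennreal (1 / norm (kvec k)) + A * Q k" for k
  have R: "(\<integral>\<^sup>+k. R k \<partial>count_space UNIV) \<le>
      (\<integral>\<^sup>+k. g0 k * ennreal (1 / norm (kvec k)) \<partial>count_space UNIV) + A * (2 * energy_sup h * energy_int h)"
    unfolding R_def using nn_integral_conv_le[of h, OF meas zero]
    by (subst nn_integral_add) (auto simp: nn_integral_cmult Q_def intro!: add_left_mono mult_left_mono)
  have inv: "ennreal (norm (kvec k)) * ennreal (1 / norm (kvec k)) = 1" if "k \<noteq> 0" for k
    using that by (subst ennreal_mult[symmetric]) auto
  have sup: "(SUP t. h t k * ennreal (1 / norm (kvec k))) \<le> B * R k" for k
  proof (cases "k = 0")
    case False
    have "h t k * ennreal (1 / norm (kvec k)) \<le> B * R k" for t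
    proof -
      have "(\<integral>\<^sup>+s. ennreal (norm (kvec k)) * (heat_kernel \<beta> k (t - s) * conv (h s) k) \<partial>lborel)
          \<le> (\<integral>\<^sup>+s. ennreal (norm (kvec k)) * (1 * conv (h s) k) \<partial>lborel)"
        using \<beta> by (intro nn_integral_mono mult_left_mono mult_right_mono heat_kernel_le_1) auto
      also have "\<dots> = ennreal (norm (kvec k)) * Q k"
        by (simp add: nn_integral_cmult Q_def)
      finally have "h t k \<le> B * (1 * g0 k + A * (ennreal (norm (kvec k)) * Q k))"
        using \<beta> by (intro order.trans[OF duhamel[OF False]] mult_left_mono add_mono mult_right_mono
            heat_kernel_le_1) auto
      then have "h t k * ennreal (1 / norm (kvec k)) \<le>
          B * (1 * g0 k + A * (ennreal (norm (kvec k)) * Q k)) * ennreal (1 / norm (kvec k))"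
        by (rule mult_right_mono) simp
      also have "\<dots> = B * (g0 k * ennreal (1 / norm (kvec k))
            + A * (Q k * (ennreal (norm (kvec k)) * ennreal (1 / norm (kvec k)))))"
        by (simp add: algebra_simps)
      finally show ?thesis by (simp add: inv[OF False] R_def)
    qed
    then show ?thesis by (intro SUP_least)
  qed (simp add: zero)
  have int: "(\<integral>\<^sup>+t. h t k * ennreal (norm (kvec k)) \<partial>lborel) \<le> B * ennreal (1 / \<beta>) * R k" for k
  proof (cases "k = 0")
    case False
    have beta: "ennreal (1 / (\<beta> * (norm (kvec k))\<^sup>2)) * (ennreal (norm (kvec k)) * ennreal (norm (kvec k)))
        = ennreal (1 / \<beta>)"
    proof -
      have "(1 / (\<beta> * (norm (kvec k))\<^sup>2)) * (norm (kvec k) * norm (kvec k)) = 1 / \<beta>"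
        using False \<beta> by (simp add: power2_eq_square)
      then show ?thesis using \<beta> by (simp only: ennreal_mult''[symmetric] norm_ge_zero mult_nonneg_nonneg)
    qed
    have beta': "ennreal (1 / (\<beta> * (norm (kvec k))\<^sup>2)) * ennreal (norm (kvec k)) = ennreal (1 / \<beta>) * ennreal (1 / norm (kvec k))"
    proof -
      have "(1 / (\<beta> * (norm (kvec k))\<^sup>2)) * norm (kvec k) = 1 / \<beta> * (1 / norm (kvec k))"
        using False \<beta> by (simp add: power2_eq_square)
      then show ?thesis using \<beta> by (metis ennreal_mult'' norm_ge_zero divide_nonneg_nonneg zero_le_one)
    qed
    have "(\<integral>\<^sup>+t. h t k * ennreal (norm (kvec k)) \<partial>lborel) \<le>
       (\<integral>\<^sup>+t. B * (heat_kernel \<beta> k t * (g0 k * ennreal (norm (kvec k))) +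
           A * (\<integral>\<^sup>+s. (ennreal (norm (kvec k)) * ennreal (norm (kvec k))) * (heat_kernel \<beta> k (t - s) * conv (h s) k) \<partial>lborel)) \<partial>lborel)"
    proof (rule nn_integral_mono)
      fix t
      have "h t k * ennreal (norm (kvec k)) \<le> B * (heat_kernel \<beta> k t * g0 k
        + A * (\<integral>\<^sup>+s. ennreal (norm (kvec k)) * (heat_kernel \<beta> k (t - s) * conv (h s) k) \<partial>lborel)) * ennreal (norm (kvec k))"
        by (rule mult_right_mono[OF duhamel[OF False]]) simp
      then show "h t k * ennreal (norm (kvec k)) \<le> B * (heat_kernel \<beta> k t * (g0 k * ennreal (norm (kvec k))) +
           A * (\<integral>\<^sup>+s. (ennreal (norm (kvec k)) * ennreal (norm (kvec k))) * (heat_kernel \<beta> k (t - s) * conv (h s) k) \<partial>lborel))"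
        by (simp add: nn_integral_cmult algebra_simps)
    qed
    also have "\<dots> = B * ((\<integral>\<^sup>+t. heat_kernel \<beta> k t \<partial>lborel) * (g0 k * ennreal (norm (kvec k))) +
       A * (\<integral>\<^sup>+t. (\<integral>\<^sup>+s. (ennreal (norm (kvec k)) * ennreal (norm (kvec k))) * (heat_kernel \<beta> k (t - s) * conv (h s) k) \<partial>lborel) \<partial>lborel))"
      by (simp add: nn_integral_cmult nn_integral_multc nn_integral_add)
    also have "(\<integral>\<^sup>+t. (\<integral>\<^sup>+s. (ennreal (norm (kvec k)) * ennreal (norm (kvec k))) * (heat_kernel \<beta> k (t - s) * conv (h s) k) \<partial>lborel) \<partial>lborel)
       = (\<integral>\<^sup>+s. (\<integral>\<^sup>+t. (ennreal (norm (kvec k)) * ennreal (norm (kvec k))) * (heat_kernel \<beta> k (t - s) * conv (h s) k) \<partial>lborel) \<partial>lborel)"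
      by (rule lborel_pair.Fubini'[symmetric]) measurable
    also have "\<dots> = (\<integral>\<^sup>+s. (ennreal (norm (kvec k)) * ennreal (norm (kvec k))) * (\<integral>\<^sup>+t. heat_kernel \<beta> k (t - s) \<partial>lborel) * conv (h s) k \<partial>lborel)"
      by (simp add: nn_integral_cmult nn_integral_multc mult.assoc)
    also have "\<dots> = ennreal (1 / \<beta>) * Q k"
      unfolding nn_integral_heat_kernel[OF \<beta> False] Q_def
      by (subst mult.commute[of "_ * _" "ennreal (1 / (\<beta> * _))"], subst beta) (simp add: nn_integral_cmult)
    also have "(\<integral>\<^sup>+t. heat_kernel \<beta> k t \<partial>lborel) = ennreal (1 / (\<beta> * (norm (kvec k))\<^sup>2))"
      using nn_integral_heat_kernel[OF \<beta> False, of 0] by simp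
    also have "B * (ennreal (1 / (\<beta> * (norm (kvec k))\<^sup>2)) * (g0 k * ennreal (norm (kvec k))) + A * (ennreal (1 / \<beta>) * Q k))
       = B * ennreal (1 / \<beta>) * R k"
      using beta' by (simp add: R_def algebra_simps)
    finally show ?thesis .
  qed (simp add: zero)
  have "energy_sup h + energy_int h \<le> (\<integral>\<^sup>+k. B * R k \<partial>count_space UNIV) + (\<integral>\<^sup>+k. B * ennreal (1 / \<beta>) * R k \<partial>count_space UNIV)"
    unfolding energy_sup_def energy_int_def by (intro add_mono nn_integral_mono sup int)
  also have "\<dots> = B * ennreal (1 + 1 / \<beta>) * (\<integral>\<^sup>+k. R k \<partial>count_space UNIV)"
    using \<beta> by (subst (1 2) nn_integral_cmult) (simp_all add: algebra_simps)
  also have "\<dots> \<le> B * ennreal (1 + 1 / \<beta>) * ((\<integral>\<^sup>+k. g0 k * ennreal (1 / norm (kvec k)) \<partial>count_space UNIV) + A * (2 * energy_sup h * energy_int h))"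
    by (rule mult_left_mono[OF R]) simp
  finally show ?thesis .
qed

section \<open>Exponential weights and the continuation argument\<close>

definition gevrey :: "(real \<Rightarrow> real) \<Rightarrow> (real \<Rightarrow> int^3 \<Rightarrow> ennreal) \<Rightarrow> real \<Rightarrow> int^3 \<Rightarrow> ennreal" where
  "gevrey \<rho> g t k = ennreal (exp (\<rho> t * norm1 k)) * g t k"

text \<open>
  The truncation at \<open>N\<close> in frequency and at \<open>M\<close> in the exponent makes the weight bounded, by
  \<open>exp (M * N)\<close>, so that the weighted norm is finite for every element of the solution space.
\<close>

definition gevrey_cut :: "real \<Rightarrow> real \<Rightarrow> (real \<Rightarrow> real) \<Rightarrow> (real \<Rightarrow> int^3 \<Rightarrow> ennreal) \<Rightarrow> real \<Rightarrow> int^3 \<Rightarrow> ennreal" where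
  "gevrey_cut N M \<rho> g t k = ennreal (exp (min (\<rho> t) M * min (norm1 k) N)) * g t k"

lemma energy_mult_le:
  assumes "\<And>t k. h t k \<le> c * g t k"
    and [measurable]: "\<And>k. (\<lambda>t. g t k) \<in> borel_measurable lborel"
  shows "energy_sup h + energy_int h \<le> c * (energy_sup g + energy_int g)"
proof -
  have "energy_sup h \<le> (\<integral>\<^sup>+k. c * (SUP t. g t k * ennreal (1 / norm (kvec k))) \<partial>count_space UNIV)"
    unfolding energy_sup_def
  proof (intro nn_integral_mono SUP_least)
    fix k t
    have "h t k * ennreal (1 / norm (kvec k)) \<le> c * (g t k * ennreal (1 / norm (kvec k)))"
      using assms(1) by (auto simp: mult.assoc[symmetric] intro!: mult_right_mono)
    also have "\<dots> \<le> c * (SUP t. g t k * ennreal (1 / norm (kvec k)))"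
      by (intro mult_left_mono SUP_upper) auto
    finally show "h t k * ennreal (1 / norm (kvec k)) \<le> c * (SUP t. g t k * ennreal (1 / norm (kvec k)))" .
  qed
  moreover have "energy_int h \<le> (\<integral>\<^sup>+k. (\<integral>\<^sup>+t. c * (g t k * ennreal (norm (kvec k))) \<partial>lborel) \<partial>count_space UNIV)"
    unfolding energy_int_def
    using assms(1) by (intro nn_integral_mono) (auto simp: mult.assoc[symmetric] intro!: mult_right_mono)
  ultimately have "energy_sup h + energy_int h \<le>
     (\<integral>\<^sup>+k. c * (SUP t. g t k * ennreal (1 / norm (kvec k))) \<partial>count_space UNIV) +
     (\<integral>\<^sup>+k. (\<integral>\<^sup>+t. c * (g t k * ennreal (norm (kvec k))) \<partial>lborel) \<partial>count_space UNIV)"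
    by (rule add_mono)
  also have "\<dots> = c * (energy_sup g + energy_int g)"
    by (simp add: nn_integral_cmult distrib_left energy_sup_def energy_int_def)
  finally show ?thesis .
qed

text \<open>
  The assumption \<open>gain\<close> says that the growth of the weight between the times \<open>s\<close> and \<open>t\<close> costs a
  constant factor \<open>exp b\<close> and the part \<open>\<mu> - \<beta>\<close> of the viscosity.
\<close>

locale gevrey_gain =
  fixes \<mu> \<beta> b :: real and \<rho> :: "real \<Rightarrow> real"
  assumes beta_pos: "0 < \<beta>"
    and rho_0: "\<rho> 0 = 0"
    and rho_mono: "\<And>s t. 0 \<le> s \<Longrightarrow> s \<le> t \<Longrightarrow> \<rho> s \<le> \<rho> t"
    and rho_cont: "continuous_on UNIV \<rho>"
    and gain: "\<And>s t k. 0 \<le> s \<Longrightarrow> s \<le> t \<Longrightarrow>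
        (\<rho> t - \<rho> s) * norm1 k \<le> b + (\<mu> - \<beta>) * (norm (kvec k))\<^sup>2 * (t - s)"
begin

lemma rho_nonneg: "0 \<le> t \<Longrightarrow> 0 \<le> \<rho> t"
  using rho_mono[of 0 t] rho_0 by simp

lemma rho_measurable [measurable]: "\<rho> \<in> borel_measurable borel"
  by (rule borel_measurable_continuous_onI[OF rho_cont])

lemma measurable_gevrey_cut:
  assumes [measurable]: "(\<lambda>t. g t k) \<in> borel_measurable lborel"
  shows "(\<lambda>t. gevrey_cut N M \<rho> g t k) \<in> borel_measurable lborel"
proof -
  have [measurable]: "(\<lambda>t. g t k) \<in> borel_measurable borel" using assms by simp
  show ?thesis unfolding gevrey_cut_def by measurable
qed

text \<open>
  Truncation only decreases the increments of the exponent, hence the estimate \<open>gain\<close> for the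
  untruncated weight suffices.
\<close>

lemma weight_kernel_le:
  assumes "0 \<le> s" "0 \<le> N"
  shows "ennreal (exp (min (\<rho> t) M * min (norm1 k) N)) * heat_kernel \<mu> k (t - s)
     \<le> ennreal (exp b) * (heat_kernel \<beta> k (t - s) * ennreal (exp (min (\<rho> s) M * min (norm1 k) N)))"
proof (cases "s \<le> t")
  case True
  let ?n = "min (norm1 k) N"
  have "min (\<rho> t) M * ?n - min (\<rho> s) M * ?n = (min (\<rho> t) M - min (\<rho> s) M) * ?n"
    by (simp add: left_diff_distrib)
  also have "\<dots> \<le> (\<rho> t - \<rho> s) * ?n"
    using assms norm1_nonneg[of k] rho_mono[OF assms(1) True] by (intro mult_right_mono) auto
  also have "\<dots> \<le> (\<rho> t - \<rho> s) * norm1 k"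
    using rho_mono[OF assms(1) True] by (intro mult_left_mono) auto
  also have "\<dots> \<le> b + (\<mu> - \<beta>) * (norm (kvec k))\<^sup>2 * (t - s)"
    by (rule gain[OF assms(1) True])
  finally have "min (\<rho> t) M * ?n + - (\<mu> * (norm (kvec k))\<^sup>2 * (t - s))
     \<le> b + (- (\<beta> * (norm (kvec k))\<^sup>2 * (t - s)) + min (\<rho> s) M * ?n)"
    by (simp add: algebra_simps)
  then have "exp (min (\<rho> t) M * ?n) * exp (- (\<mu> * (norm (kvec k))\<^sup>2 * (t - s)))
     \<le> exp b * (exp (- (\<beta> * (norm (kvec k))\<^sup>2 * (t - s))) * exp (min (\<rho> s) M * ?n))"
    by (simp only: exp_add[symmetric] exp_le_cancel_iff)
  then show ?thesis using True
    by (simp add: heat_kernel_def ennreal_mult''[symmetric] ennreal_leI)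
qed (simp add: heat_kernel_def)

text \<open>
  The truncated norm \<open>min \<bar>k\<bar>\<^sub>1 N\<close> is still subadditive.
\<close>

lemma weight_conv_le:
  assumes "0 \<le> s" "0 \<le> N" "0 \<le> M"
  shows "ennreal (exp (min (\<rho> s) M * min (norm1 k) N)) * conv (g s) k \<le> conv (gevrey_cut N M \<rho> g s) k"
proof -
  have "ennreal (exp (min (\<rho> s) M * min (norm1 k) N)) * (g s l * g s (k - l))
     \<le> gevrey_cut N M \<rho> g s l * gevrey_cut N M \<rho> g s (k - l)" for l
  proof -
    have "min (norm1 k) N \<le> min (norm1 l) N + min (norm1 (k - l)) N"
      using norm1_triangle[of k l] norm1_nonneg[of l] norm1_nonneg[of "k - l"] assms by linarith
    then have "min (\<rho> s) M * min (norm1 k) N \<le> min (\<rho> s) M * (min (norm1 l) N + min (norm1 (k - l)) N)"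
      using rho_nonneg[OF assms(1)] assms by (intro mult_left_mono) auto
    then have "exp (min (\<rho> s) M * min (norm1 k) N)
        \<le> exp (min (\<rho> s) M * min (norm1 l) N) * exp (min (\<rho> s) M * min (norm1 (k - l)) N)"
      by (simp add: exp_add[symmetric] distrib_left)
    then have "ennreal (exp (min (\<rho> s) M * min (norm1 k) N))
        \<le> ennreal (exp (min (\<rho> s) M * min (norm1 l) N)) * ennreal (exp (min (\<rho> s) M * min (norm1 (k - l)) N))"
      by (simp add: ennreal_mult''[symmetric] ennreal_leI)
    then have "ennreal (exp (min (\<rho> s) M * min (norm1 k) N)) * (g s l * g s (k - l))
        \<le> ennreal (exp (min (\<rho> s) M * min (norm1 l) N)) * ennreal (exp (min (\<rho> s) M * min (norm1 (k - l)) N)) * (g s l * g s (k - l))"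
      by (rule mult_right_mono) simp
    then show ?thesis by (simp add: gevrey_cut_def mult_ac)
  qed
  then show ?thesis
    unfolding conv_def by (subst nn_integral_cmult[symmetric]) (auto intro!: nn_integral_mono)
qed

lemma duhamel_gevrey_cut:
  assumes [measurable]: "\<And>k. (\<lambda>t. g t k) \<in> borel_measurable lborel"
    and neg: "\<And>t k. t < 0 \<Longrightarrow> g t k = 0"
    and duhamel: "\<And>t k. k \<noteq> 0 \<Longrightarrow> g t k \<le> heat_kernel \<mu> k t * g0 k
        + A * (\<integral>\<^sup>+s. ennreal (norm (kvec k)) * (heat_kernel \<mu> k (t - s) * conv (g s) k) \<partial>lborel)"
    and "0 \<le> N" "0 \<le> M" "k \<noteq> 0"
  shows "gevrey_cut N M \<rho> g t k \<le> ennreal (exp b) * (heat_kernel \<beta> k t * g0 k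
        + A * (\<integral>\<^sup>+s. ennreal (norm (kvec k)) * (heat_kernel \<beta> k (t - s) * conv (gevrey_cut N M \<rho> g s) k) \<partial>lborel))"
proof -
  let ?w = "\<lambda>t. ennreal (exp (min (\<rho> t) M * min (norm1 k) N))"
  have [measurable]: "(\<lambda>t. conv (g t) k) \<in> borel_measurable borel"
    using measurable_conv[of g lborel k] by simp
  have [measurable]: "(\<lambda>t. conv (gevrey_cut N M \<rho> g t) k) \<in> borel_measurable borel"
    using measurable_conv[of "gevrey_cut N M \<rho> g" lborel k] measurable_gevrey_cut by simp
  have term1: "?w t * heat_kernel \<mu> k t \<le> ennreal (exp b) * heat_kernel \<beta> k t"
    using weight_kernel_le[of 0 N t M k] rho_0 \<open>0 \<le> M\<close> \<open>0 \<le> N\<close> by simp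
  have term2: "?w t * (ennreal (norm (kvec k)) * (heat_kernel \<mu> k (t - s) * conv (g s) k))
     \<le> ennreal (exp b) * (ennreal (norm (kvec k)) * (heat_kernel \<beta> k (t - s) * conv (gevrey_cut N M \<rho> g s) k))" for s
  proof (cases "s < 0")
    case False
    have "?w t * (ennreal (norm (kvec k)) * (heat_kernel \<mu> k (t - s) * conv (g s) k))
       = ennreal (norm (kvec k)) * conv (g s) k * (?w t * heat_kernel \<mu> k (t - s))"
      by (simp add: mult_ac)
    also have "\<dots> \<le> ennreal (norm (kvec k)) * conv (g s) k * (ennreal (exp b) * (heat_kernel \<beta> k (t - s) * ?w s))"
      using False \<open>0 \<le> N\<close> by (intro mult_left_mono weight_kernel_le) auto
    also have "\<dots> = ennreal (exp b) * (ennreal (norm (kvec k)) * (heat_kernel \<beta> k (t - s) * (?w s * conv (g s) k)))"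
      by (simp add: mult_ac)
    also have "\<dots> \<le> ennreal (exp b) * (ennreal (norm (kvec k)) * (heat_kernel \<beta> k (t - s) * conv (gevrey_cut N M \<rho> g s) k))"
      using False assms by (intro mult_left_mono weight_conv_le) auto
    finally show ?thesis .
  qed (simp add: conv_def neg)
  have "gevrey_cut N M \<rho> g t k \<le> ?w t * (heat_kernel \<mu> k t * g0 k
        + A * (\<integral>\<^sup>+s. ennreal (norm (kvec k)) * (heat_kernel \<mu> k (t - s) * conv (g s) k) \<partial>lborel))"
    unfolding gevrey_cut_def by (rule mult_left_mono[OF duhamel[OF \<open>k \<noteq> 0\<close>]]) simp
  also have "\<dots> = (?w t * heat_kernel \<mu> k t) * g0 k
        + A * (?w t * (\<integral>\<^sup>+s. ennreal (norm (kvec k)) * (heat_kernel \<mu> k (t - s) * conv (g s) k) \<partial>lborel))"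
    by (simp add: algebra_simps)
  also have "?w t * (\<integral>\<^sup>+s. ennreal (norm (kvec k)) * (heat_kernel \<mu> k (t - s) * conv (g s) k) \<partial>lborel)
      = (\<integral>\<^sup>+s. ?w t * (ennreal (norm (kvec k)) * (heat_kernel \<mu> k (t - s) * conv (g s) k)) \<partial>lborel)"
    by (rule nn_integral_cmult[symmetric]) measurable
  also have "(?w t * heat_kernel \<mu> k t) * g0 k + A * \<dots> \<le> (ennreal (exp b) * heat_kernel \<beta> k t) * g0 k
      + A * (\<integral>\<^sup>+s. ennreal (exp b) * (ennreal (norm (kvec k)) * (heat_kernel \<beta> k (t - s) * conv (gevrey_cut N M \<rho> g s) k)) \<partial>lborel)"
    by (intro add_mono mult_right_mono mult_left_mono nn_integral_mono term1 term2) auto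
  also have "(\<integral>\<^sup>+s. ennreal (exp b) * (ennreal (norm (kvec k)) * (heat_kernel \<beta> k (t - s) * conv (gevrey_cut N M \<rho> g s) k)) \<partial>lborel)
     = ennreal (exp b) * (\<integral>\<^sup>+s. ennreal (norm (kvec k)) * (heat_kernel \<beta> k (t - s) * conv (gevrey_cut N M \<rho> g s) k) \<partial>lborel)"
    by (rule nn_integral_cmult) measurable
  finally show ?thesis by (simp add: algebra_simps)
qed

text \<open>
  The truncation in frequency bounds the effect of raising \<open>M\<close> by a factor close to \<open>1\<close>; this is the
  continuity on which the continuation argument rests.
\<close>

lemma gevrey_cut_step:
  assumes "0 \<le> N" "0 \<le> \<delta>"
  shows "gevrey_cut N (M + \<delta>) \<rho> g t k \<le> ennreal (exp (\<delta> * N)) * gevrey_cut N M \<rho> g t k"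
proof -
  let ?n = "min (norm1 k) N"
  have n: "0 \<le> ?n" "?n \<le> N" using norm1_nonneg[of k] assms by auto
  have "min (\<rho> t) (M + \<delta>) * ?n \<le> (min (\<rho> t) M + \<delta>) * ?n"
    using assms n by (intro mult_right_mono) auto
  also have "\<dots> \<le> min (\<rho> t) M * ?n + \<delta> * N"
    using assms n by (simp add: distrib_right mult_left_mono)
  finally have "exp (min (\<rho> t) (M + \<delta>) * ?n) \<le> exp (\<delta> * N) * exp (min (\<rho> t) M * ?n)"
    by (simp add: exp_add[symmetric] add.commute)
  then have "ennreal (exp (min (\<rho> t) (M + \<delta>) * ?n)) \<le> ennreal (exp (\<delta> * N)) * ennreal (exp (min (\<rho> t) M * ?n))"
    by (simp add: ennreal_mult''[symmetric] ennreal_leI)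
  then show ?thesis unfolding gevrey_cut_def mult.assoc[symmetric] by (rule mult_right_mono) simp
qed

end

text \<open>
  A sequence that grows at most by a factor \<open>2\<close> in each step cannot pass from the neighbourhood of the
  small root of \<open>x = D (e + A x\<^sup>2)\<close>, which is of size \<open>D e\<close>, to the large root of size \<open>1 / (D A)\<close>:
  if \<open>x j \<le> c e\<close> then \<open>D A x (Suc j) \<le> 1/2\<close>, and the quadratic term can be absorbed on the left.
\<close>

lemma small_root_continuation:
  fixes x :: "nat \<Rightarrow> real"
  assumes nonneg: "\<And>j. 0 \<le> x j"
    and start: "x 0 \<le> c * e"
    and growth: "\<And>j. x (Suc j) \<le> 2 * x j"
    and quadratic: "\<And>j. x j \<le> D * (e + A * x j * x j)"
    and small: "4 * D * A * c * e \<le> 1"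
    and "2 * D \<le> c" "0 \<le> e" "0 \<le> D" "0 \<le> A"
  shows "x j \<le> c * e"
proof (induction j)
  case (Suc j)
  have "D * A * x (Suc j) \<le> D * A * (2 * (c * e))"
    using order.trans[OF growth[of j] mult_left_mono[OF Suc.IH, of 2]] assms
    by (intro mult_left_mono) auto
  also have "\<dots> \<le> 1 / 2" using small by simp
  finally have "D * A * x (Suc j) * x (Suc j) \<le> 1 / 2 * x (Suc j)"
    using nonneg by (rule mult_right_mono)
  then have "x (Suc j) \<le> 2 * D * e"
    using quadratic[of "Suc j"] by (simp add: algebra_simps)
  also have "\<dots> \<le> c * e" using assms by (intro mult_right_mono) auto
  finally show ?case .
qed (fact start)

text \<open>
  Monotone convergence, in both norms.
\<close>

lemma energy_SUP:
  assumes inc: "\<And>t k. incseq (\<lambda>n. h n t k)"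
    and [measurable]: "\<And>n k. (\<lambda>t. h n t k) \<in> borel_measurable lborel"
    and bound: "\<And>n. energy_sup (h n) + energy_int (h n) \<le> C"
  shows "energy_sup (\<lambda>t k. SUP n. h n t k) + energy_int (\<lambda>t k. SUP n. h n t k) \<le> C"
proof -
  have mult_SUP: "(SUP n. h n t k) * ennreal r = (SUP n. h n t k * ennreal r)" for t k r
    by (simp add: SUP_mult_right_ennreal)
  have inc': "incseq (\<lambda>n. h n t k * ennreal r)" for t k r
    using inc by (auto simp: incseq_def intro!: mult_right_mono)
  have incX: "incseq (\<lambda>n. energy_sup (h n))"
    unfolding energy_sup_def incseq_def
    using inc' by (intro allI impI nn_integral_mono SUP_mono') (auto simp: incseq_def)
  have incY: "incseq (\<lambda>n. energy_int (h n))"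
    unfolding energy_int_def incseq_def
    using inc' by (intro allI impI nn_integral_mono) (auto simp: incseq_def)
  have "energy_sup (\<lambda>t k. SUP n. h n t k)
      = (\<integral>\<^sup>+k. (SUP n. SUP t. h n t k * ennreal (1 / norm (kvec k))) \<partial>count_space UNIV)"
    unfolding energy_sup_def mult_SUP by (subst SUP_commute) simp
  also have "\<dots> = (SUP n. energy_sup (h n))"
    unfolding energy_sup_def
    using inc' by (intro nn_integral_monotone_convergence_SUP)
      (auto simp: incseq_def le_fun_def intro!: SUP_mono')
  finally have X: "energy_sup (\<lambda>t k. SUP n. h n t k) = (SUP n. energy_sup (h n))" .
  have "energy_int (\<lambda>t k. SUP n. h n t k)
      = (\<integral>\<^sup>+k. (SUP n. \<integral>\<^sup>+t. h n t k * ennreal (norm (kvec k)) \<partial>lborel) \<partial>count_space UNIV)"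
    unfolding energy_int_def mult_SUP
    using inc' by (intro nn_integral_cong nn_integral_monotone_convergence_SUP)
      (auto simp: incseq_def le_fun_def)
  also have "\<dots> = (SUP n. energy_int (h n))"
    unfolding energy_int_def
    using inc' by (intro nn_integral_monotone_convergence_SUP)
      (auto simp: incseq_def le_fun_def intro!: nn_integral_mono)
  finally have Y: "energy_int (\<lambda>t k. SUP n. h n t k) = (SUP n. energy_int (h n))" .
  show ?thesis unfolding X Y
    by (subst ennreal_SUP_add[symmetric]) (use incX incY bound in \<open>auto intro!: SUP_least\<close>)
qed

context gevrey_gain
begin

text \<open>
  The continuation parameter is the truncation level \<open>M\<close>, at fixed \<open>N\<close>.  It starts at \<open>M = 0\<close>, where
  the weight is trivial, and moves in steps that are short enough for the norm to at most double.  The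
  smallness condition involves only the constants of the Duhamel inequality, hence the resulting bound
  survives the limit \<open>M, N \<rightarrow> \<infinity>\<close>.
\<close>

theorem gevrey_energy_bound:
  assumes meas [measurable]: "\<And>k. (\<lambda>t. g t k) \<in> borel_measurable lborel"
    and zero: "\<And>t. g t 0 = 0"
    and neg: "\<And>t k. t < 0 \<Longrightarrow> g t k = 0"
    and duhamel: "\<And>t k. k \<noteq> 0 \<Longrightarrow> g t k \<le> heat_kernel \<mu> k t * g0 k
        + ennreal A * (\<integral>\<^sup>+s. ennreal (norm (kvec k)) * (heat_kernel \<mu> k (t - s) * conv (g s) k) \<partial>lborel)"
    and data: "(\<integral>\<^sup>+k. g0 k * ennreal (1 / norm (kvec k)) \<partial>count_space UNIV) = ennreal e"
    and start: "energy_sup g + energy_int g \<le> ennreal (K * e)"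
    and c: "2 * D \<le> c" "K \<le> c" and D: "D = exp b * (1 + 1 / \<beta>)"
    and small: "8 * D * A * c * e \<le> 1"
    and "0 \<le> e" "0 \<le> A"
  shows "energy_sup (gevrey \<rho> g) + energy_int (gevrey \<rho> g) \<le> ennreal (c * e)"
proof -
  define E where "E N M = energy_sup (gevrey_cut N M \<rho> g) + energy_int (gevrey_cut N M \<rho> g)" for N M
  have D0: "0 \<le> D" using D beta_pos by simp
  have [measurable]: "(\<lambda>t. gevrey_cut N M \<rho> g t k) \<in> borel_measurable lborel" for N M k
    by (rule measurable_gevrey_cut) measurable
  have E_step: "E N (M + \<delta>) \<le> ennreal (exp (\<delta> * N)) * E N M" if "0 \<le> N" "0 \<le> \<delta>" for N M \<delta>
    unfolding E_def by (intro energy_mult_le gevrey_cut_step that) measurable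
  have "gevrey_cut N 0 \<rho> g = g" for N
  proof (intro ext)
    fix t k show "gevrey_cut N 0 \<rho> g t k = g t k"
      using rho_nonneg[of t] neg[of t k] by (cases "t < 0") (auto simp: gevrey_cut_def)
  qed
  then have E_0: "E N 0 \<le> ennreal (K * e)" for N using start by (simp add: E_def)
  have E_fin: "E N M < \<infinity>" if "0 \<le> N" "0 \<le> M" for N M
  proof -
    have "E N M \<le> ennreal (exp (M * N)) * ennreal (K * e)"
      using order.trans[OF E_step[OF that, of 0] mult_left_mono[OF E_0]] by simp
    then show ?thesis by (simp add: ennreal_mult_less_top order_le_less_trans)
  qed
  have E_quad: "E N M \<le> ennreal D * (ennreal e + ennreal (2 * A) * E N M * E N M)" if "0 \<le> N" "0 \<le> M" for N M
  proof -
    let ?X = "energy_sup (gevrey_cut N M \<rho> g)" and ?Y = "energy_int (gevrey_cut N M \<rho> g)"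
    have "E N M \<le> ennreal (exp b) * ennreal (1 + 1 / \<beta>) * (ennreal e + ennreal A * (2 * ?X * ?Y))"
      unfolding E_def data[symmetric]
      by (rule energy_le_of_duhamel[OF _ _ beta_pos duhamel_gevrey_cut[OF meas neg duhamel]])
         (use that zero in \<open>auto simp: gevrey_cut_def[of _ _ _ _ _ 0]\<close>)
    also have "\<dots> = ennreal D * (ennreal e + ennreal (2 * A) * ?X * ?Y)"
      using D beta_pos \<open>0 \<le> A\<close> by (simp add: ennreal_mult mult_ac)
    also have "\<dots> \<le> ennreal D * (ennreal e + ennreal (2 * A) * E N M * E N M)"
      unfolding E_def by (intro mult_left_mono add_mono mult_mono) (auto simp: add_increasing add_increasing2)
    finally show ?thesis .
  qed
  have E_bound: "E N M \<le> ennreal (c * e)" if "0 \<le> N" "0 \<le> M" for N M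
  proof -
    \<comment> \<open>The number \<open>n\<close> of steps is such that one step of length \<open>M / n\<close> at most doubles the norm.\<close>
    obtain n :: nat where "max 1 (M * N / ln 2) \<le> real n" using real_arch_simple by blast
    then have n: "M * N / ln 2 \<le> real n" "0 < n" by auto
    define \<delta> where "\<delta> = M / real n"
    have \<delta>: "0 \<le> \<delta>" using that by (simp add: \<delta>_def)
    have "\<delta> * N \<le> ln 2" using n by (simp add: \<delta>_def field_simps)
    then have "exp (\<delta> * N) \<le> 2" by (metis exp_le_cancel_iff exp_ln zero_less_numeral)
    then have exp2: "ennreal (exp (\<delta> * N)) \<le> ennreal 2" by (rule ennreal_leI)
    define x where "x j = enn2real (E N (real j * \<delta>))" for j :: nat
    have x: "E N (real j * \<delta>) = ennreal (x j)" for j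
      using E_fin[of N "real j * \<delta>"] that \<delta> by (simp add: x_def)
    have x0: "0 \<le> x j" for j by (simp add: x_def)
    have "x n \<le> c * e"
    proof (rule small_root_continuation[where D=D and A="2 * A"])
      have "ennreal (x 0) \<le> ennreal (K * e)" using E_0[of N] x[of 0] by simp
      also have "\<dots> \<le> ennreal (c * e)" using c \<open>0 \<le> e\<close> by (intro ennreal_leI mult_right_mono)
      finally show "x 0 \<le> c * e" using c D0 \<open>0 \<le> e\<close> by (subst (asm) ennreal_le_iff) auto
      show "x (Suc j) \<le> 2 * x j" for j
      proof -
        have "ennreal (x (Suc j)) \<le> ennreal (exp (\<delta> * N)) * ennreal (x j)"
          using E_step[OF that(1) \<delta>, of "real j * \<delta>"] x[of j] x[of "Suc j"] by (simp add: algebra_simps)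
        also have "\<dots> \<le> ennreal 2 * ennreal (x j)" by (rule mult_right_mono[OF exp2]) simp
        also have "\<dots> = ennreal (2 * x j)" using x0 by (subst ennreal_mult) auto
        finally show ?thesis using x0[of j] by (subst (asm) ennreal_le_iff) auto
      qed
      show "x j \<le> D * (e + 2 * A * x j * x j)" for j
      proof -
        have "ennreal (x j) \<le> ennreal D * (ennreal e + ennreal (2 * A) * ennreal (x j) * ennreal (x j))"
          using E_quad[of N "real j * \<delta>"] that \<delta> x[of j] by simp
        also have "\<dots> = ennreal (D * (e + 2 * A * x j * x j))"
          using D0 \<open>0 \<le> A\<close> \<open>0 \<le> e\<close> x0[of j] by (simp add: ennreal_mult)
        finally show ?thesis using D0 \<open>0 \<le> A\<close> \<open>0 \<le> e\<close> x0[of j] by (subst (asm) ennreal_le_iff) auto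
      qed
      show "4 * D * (2 * A) * c * e \<le> 1" using small by simp
    qed (use assms D0 x0 in auto)
    moreover have "real n * \<delta> = M" using n by (simp add: \<delta>_def)
    ultimately show ?thesis using x[of n] by (simp add: ennreal_leI)
  qed
  have inc: "incseq (\<lambda>n. gevrey_cut (real n) (real n) \<rho> g t k)" for t k
  proof (cases "t < 0")
    case False
    then show ?thesis
      unfolding gevrey_cut_def incseq_def using rho_nonneg[of t] norm1_nonneg[of k]
      by (intro allI impI mult_right_mono ennreal_leI) (auto intro!: mult_mono)
  qed (simp add: gevrey_cut_def neg incseq_def)
  have "gevrey \<rho> g t k = (SUP n. gevrey_cut (real n) (real n) \<rho> g t k)" for t k
  proof (cases "t < 0")
    case False
    obtain n :: nat where n: "max (\<rho> t) (norm1 k) \<le> real n" using real_arch_simple by blast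
    have "gevrey_cut (real n) (real n) \<rho> g t k = gevrey \<rho> g t k"
      using n by (simp add: gevrey_cut_def gevrey_def min_absorb1)
    moreover have "gevrey_cut (real n) (real n) \<rho> g t k \<le> gevrey \<rho> g t k" for n
      unfolding gevrey_cut_def gevrey_def using rho_nonneg[of t] norm1_nonneg[of k] False
      by (intro mult_right_mono ennreal_leI) (auto intro!: mult_mono)
    ultimately show ?thesis
      using SUP_upper[of n UNIV "\<lambda>n. gevrey_cut (real n) (real n) \<rho> g t k"]
      by (intro antisym SUP_least) auto
  qed (simp add: gevrey_cut_def gevrey_def neg)
  then have "gevrey \<rho> g = (\<lambda>t k. SUP n. gevrey_cut (real n) (real n) \<rho> g t k)" by (intro ext)
  then show ?thesis
    using E_bound unfolding E_def by (simp, intro energy_SUP inc) auto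
qed

end

text \<open>
  With \<open>y = \<surd>(t - s)\<close>, Young's inequality splits \<open>y \<bar>k\<bar>\<^sub>1 \<le> 3/2 + y\<^sup>2 \<bar>k\<bar>\<^sup>2 / 2\<close>, where
  \<open>\<bar>k\<bar>\<^sub>1\<^sup>2 \<le> 3 \<bar>k\<bar>\<^sup>2\<close>; half of the viscosity is spent.
\<close>

lemma gevrey_gain_sqrt:
  assumes "0 < \<mu>"
  shows "gevrey_gain \<mu> (\<mu> / 2) (3 / 2 * \<mu>) (\<lambda>t. \<mu> * sqrt t)"
proof
  fix s t :: real and k assume st: "0 \<le> s" "s \<le> t"
  define y where "y = sqrt (t - s)"
  have y: "0 \<le> y" "t - s = y\<^sup>2" using st by (auto simp: y_def)
  have "sqrt t \<le> sqrt s + sqrt (t - s)" using sqrt_add_le_add_sqrt[of s "t - s"] st by simp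
  then have "\<mu> * sqrt t - \<mu> * sqrt s \<le> \<mu> * y"
    using assms by (simp add: right_diff_distrib[symmetric] y_def)
  then have "(\<mu> * sqrt t - \<mu> * sqrt s) * norm1 k \<le> \<mu> * y * norm1 k"
    using norm1_nonneg by (rule mult_right_mono)
  also have "\<dots> = \<mu> * (y * norm1 k)" by simp
  also have "\<dots> \<le> \<mu> * (3 / 2 + (norm (kvec k))\<^sup>2 * y\<^sup>2 / 2)"
  proof (rule mult_left_mono)
    have "2 * (y * norm1 k) * 3 \<le> 3 * 3 + (y * norm1 k)\<^sup>2"
      using sum_squares_bound[of 3 "y * norm1 k"] by (simp add: power2_eq_square)
    also have "(y * norm1 k)\<^sup>2 \<le> y\<^sup>2 * (3 * (norm (kvec k))\<^sup>2)"
      unfolding power_mult_distrib by (intro mult_left_mono norm1_sq_le) auto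
    finally show "y * norm1 k \<le> 3 / 2 + (norm (kvec k))\<^sup>2 * y\<^sup>2 / 2" by (simp add: field_simps)
  qed (use assms in auto)
  finally show "(\<mu> * sqrt t - \<mu> * sqrt s) * norm1 k \<le> 3 / 2 * \<mu> + (\<mu> - \<mu> / 2) * (norm (kvec k))\<^sup>2 * (t - s)"
    by (simp add: y(2) algebra_simps)
qed (use assms in \<open>auto intro!: continuous_intros mult_left_mono\<close>)

lemma gevrey_gain_linear:
  assumes "0 < \<mu>" "0 < \<alpha>" "\<alpha> < 1"
  shows "gevrey_gain \<mu> ((1 - \<alpha>) * \<mu>) 0 (\<lambda>t. \<alpha> * \<mu> * t)"
proof
  fix s t :: real and k assume st: "0 \<le> s" "s \<le> t"
  have "(\<alpha> * \<mu> * t - \<alpha> * \<mu> * s) * norm1 k = \<alpha> * \<mu> * (t - s) * norm1 k"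
    by (simp add: algebra_simps)
  also have "\<dots> \<le> \<alpha> * \<mu> * (t - s) * (norm (kvec k))\<^sup>2"
    using assms st by (intro mult_left_mono norm1_le_norm_kvec_sq) auto
  finally show "(\<alpha> * \<mu> * t - \<alpha> * \<mu> * s) * norm1 k \<le> 0 + (\<mu> - (1 - \<alpha>) * \<mu>) * (norm (kvec k))\<^sup>2 * (t - s)"
    by (simp add: algebra_simps)
qed (use assms in \<open>auto intro!: continuous_intros mult_left_mono\<close>)

section \<open>Fourier analysis on the torus\<close>

lemma torus_cell_eq_cbox: "torus_cell = cbox 0 (\<chi> j. 2 * pi)"
  by (auto simp: torus_cell_def mem_box_cart)

lemma compact_torus_cell: "compact torus_cell"
  by (simp add: torus_cell_eq_cbox compact_cbox)

lemma torus_cell_borel [measurable]: "torus_cell \<in> sets borel"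
  by (simp add: torus_cell_eq_cbox)

lemma measure_torus_cell: "measure lborel torus_cell = (2 * pi) ^ 3"
  unfolding torus_cell_eq_cbox by (subst content_cbox_cart) (auto simp: interval_eq_empty_cart)

lemma set_integrable_torus_cell:
  fixes f :: "real^3 \<Rightarrow> complex"
  assumes "continuous_on UNIV f"
  shows "set_integrable lborel torus_cell f"
  unfolding set_integrable_def
  by (rule borel_integrable_compact[OF compact_torus_cell]) (use assms continuous_on_subset in blast)

lemma norm_integral_torus_cell_le:
  fixes f :: "real^3 \<Rightarrow> complex"
  assumes "\<And>x. x \<in> torus_cell \<Longrightarrow> norm (f x) \<le> B" "0 \<le> B"
  shows "norm (set_lebesgue_integral lborel torus_cell f) \<le> (2 * pi) ^ 3 * B"
proof -
  have fin: "emeasure lborel torus_cell < \<infinity>"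
    using emeasure_compact_finite[OF compact_torus_cell] by simp
  have "ennreal (norm (set_lebesgue_integral lborel torus_cell f))
      \<le> (\<integral>\<^sup>+x. ennreal B * indicator torus_cell x \<partial>lborel)"
  proof (cases "set_integrable lborel torus_cell f")
    case True
    have "ennreal (norm (set_lebesgue_integral lborel torus_cell f))
        \<le> (\<integral>\<^sup>+x. ennreal (norm (indicator torus_cell x *\<^sub>R f x)) \<partial>lborel)"
      using True unfolding set_lebesgue_integral_def set_integrable_def
      by (rule integral_norm_bound_ennreal)
    also have "\<dots> \<le> (\<integral>\<^sup>+x. ennreal B * indicator torus_cell x \<partial>lborel)"
      using assms by (intro nn_integral_mono) (auto simp: indicator_def intro!: ennreal_leI)
    finally show ?thesis .
  next
    case False
    then show ?thesis
      by (simp add: set_lebesgue_integral_def set_integrable_def not_integrable_integral_eq)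
  qed
  also have "\<dots> = ennreal B * emeasure lborel torus_cell"
    by (subst nn_integral_cmult_indicator) auto
  also have "\<dots> = ennreal ((2 * pi) ^ 3 * B)"
    using fin assms by (subst emeasure_eq_ennreal_measure) (auto simp: measure_torus_cell ennreal_mult''[symmetric] mult.commute)
  finally show ?thesis using assms by (subst (asm) ennreal_le_iff) auto
qed

text \<open>
  Fubini's theorem for one coordinate against the two others.
\<close>

lemma integral_torus_cell_eq_0:
  fixes g :: "real^3 \<Rightarrow> complex"
  assumes cont: "continuous_on UNIV g"
    and lines: "\<And>p. set_lebesgue_integral lborel {0..2 * pi} (\<lambda>y. g (p + y *\<^sub>R axis j 1)) = 0"
  shows "set_lebesgue_integral lborel torus_cell g = 0"
proof -
  interpret product_sigma_finite "\<lambda>_::real^3. lborel :: real measure" ..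
  define e where "e = (axis j 1 :: real^3)"
  define I where "I = (Basis :: (real^3) set) - {e}"
  have e: "e \<in> Basis" by (auto simp: e_def Basis_vec_def)
  have I: "finite I" "e \<notin> I" "insert e I = Basis" using e by (auto simp: I_def)
  define S where "S x = (\<Sum>b\<in>Basis. x b *\<^sub>R b)" for x :: "real^3 \<Rightarrow> real"
  define P where "P x = (\<Sum>b\<in>I. x b *\<^sub>R b)" for x :: "real^3 \<Rightarrow> real"
  define G where "G x = indicator torus_cell x *\<^sub>R g x" for x
  have [measurable]: "S \<in> borel_measurable (PiM Basis (\<lambda>_. lborel))"
    unfolding S_def by measurable
  have G_int: "integrable lborel G"
    using set_integrable_torus_cell[OF cont] by (simp add: G_def[abs_def] set_integrable_def)
  have lb: "(lborel :: (real^3) measure) = distr (PiM Basis (\<lambda>_. lborel)) borel S"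
    unfolding S_def by (rule lborel_eq)
  have G_meas [measurable]: "G \<in> borel_measurable borel"
    using borel_measurable_integrable[OF G_int] by simp
  have int: "integrable (PiM (insert e I) (\<lambda>_. lborel)) (\<lambda>x. G (S x))"
    using G_int unfolding I(3) by (subst (asm) lb) (simp add: integrable_distr_eq)
  have upd: "S (x(e := y)) = P x + y *\<^sub>R e" for x y
    unfolding S_def P_def I(3)[symmetric] using I by (subst sum.insert) (auto intro!: sum.cong)
  \<comment> \<open>The point \<open>P x\<close> has vanishing \<open>j\<close>-th coordinate: the indicator of the cell factorizes.\<close>
  have P_j: "P x $ j = 0" for x
  proof -
    have "b $ j = 0" if "b \<in> I" for b
      using that e by (auto simp: I_def e_def Basis_vec_def axis_def)
    then show ?thesis by (simp add: P_def)
  qed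
  have cell: "indicator torus_cell (P x + y *\<^sub>R e) =
      (indicator {q. \<forall>i. i \<noteq> j \<longrightarrow> 0 \<le> q $ i \<and> q $ i \<le> 2 * pi} (P x) * indicator {0..2 * pi} y :: real)" for x y
  proof -
    have "(P x + y *\<^sub>R e) $ i = (if i = j then y else P x $ i)" for i
      by (simp add: e_def axis_def P_j)
    then show ?thesis by (auto simp: indicator_def torus_cell_def)
  qed
  have "set_lebesgue_integral lborel torus_cell g = integral\<^sup>L (PiM (insert e I) (\<lambda>_. lborel)) (\<lambda>x. G (S x))"
    unfolding set_lebesgue_integral_def I(3) G_def[symmetric] by (subst lb, subst integral_distr) auto
  also have "\<dots> = (\<integral>x. (\<integral>y. G (S (x(e := y))) \<partial>lborel) \<partial>PiM I (\<lambda>_. lborel))"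
    by (rule product_integral_insert[OF I(1,2) int])
  also have "\<dots> = (\<integral>x. 0 \<partial>PiM I (\<lambda>_. lborel :: real measure))"
  proof (rule Bochner_Integration.integral_cong[OF refl])
    fix x
    show "(\<integral>y. G (S (x(e := y))) \<partial>lborel) = 0"
      using lines[of "P x", folded e_def]
      by (simp add: upd G_def cell set_lebesgue_integral_def flip: scaleR_scaleR)
  qed
  finally show ?thesis by simp
qed

lemma partial_deriv_eq:
  assumes "(\<psi> has_derivative D) (at x)"
  shows "partial_deriv j \<psi> x = D (axis j 1)"
proof -
  have "((\<lambda>s. x + s *\<^sub>R axis j 1) has_derivative (\<lambda>s. s *\<^sub>R axis j 1)) (at 0)"
    by (auto intro!: derivative_eq_intros)
  then have "((\<lambda>s. \<psi> (x + s *\<^sub>R axis j 1)) has_derivative (\<lambda>s. D (s *\<^sub>R axis j 1))) (at 0)"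
    by (rule has_derivative_compose) (use assms in simp)
  moreover have "linear D" using assms by (rule has_derivative_linear)
  ultimately have "((\<lambda>s. \<psi> (x + s *\<^sub>R axis j 1)) has_vector_derivative D (axis j 1)) (at 0)"
    by (simp add: has_vector_derivative_def linear_cmul)
  then show ?thesis unfolding partial_deriv_def by (rule vector_derivative_at)
qed

lemma has_vector_derivative_along_axis:
  assumes "\<psi> differentiable_on UNIV"
  shows "((\<lambda>s. \<psi> (p + s *\<^sub>R axis j 1)) has_vector_derivative partial_deriv j \<psi> (p + s *\<^sub>R axis j 1)) (at s within S)"
proof -
  obtain D where D: "(\<psi> has_derivative D) (at (p + s *\<^sub>R axis j 1))"
    using assms by (auto simp: differentiable_on_def differentiable_def)
  have "((\<lambda>s. p + s *\<^sub>R axis j 1) has_derivative (\<lambda>s. s *\<^sub>R axis j 1)) (at s within S)"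
    by (auto intro!: derivative_eq_intros)
  then have "((\<lambda>s. \<psi> (p + s *\<^sub>R axis j 1)) has_derivative (\<lambda>s. D (s *\<^sub>R axis j 1))) (at s within S)"
    by (rule has_derivative_compose) (rule D)
  moreover have "linear D" using D by (rule has_derivative_linear)
  ultimately show ?thesis
    by (simp add: has_vector_derivative_def linear_cmul partial_deriv_eq[OF D])
qed

text \<open>
  On every segment of the cell in direction \<open>j\<close> the integral of the derivative is a difference of
  boundary values, which vanishes by periodicity.  Both the orthogonality of the exponentials and the
  decay of Fourier coefficients of test functions follow from this.
\<close>

lemma integral_partial_deriv_eq_0:
  assumes diff: "\<psi> differentiable_on UNIV" and cont: "continuous_on UNIV (partial_deriv j \<psi>)"
    and per: "periodic \<psi>"
  shows "set_lebesgue_integral lborel torus_cell (partial_deriv j \<psi>) = 0"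
proof (rule integral_torus_cell_eq_0[OF cont])
  fix p
  have "has_bochner_integral lborel (\<lambda>s. indicator {0..2 * pi} s *\<^sub>R partial_deriv j \<psi> (p + s *\<^sub>R axis j 1))
      (\<psi> (p + (2 * pi) *\<^sub>R axis j 1) - \<psi> (p + 0 *\<^sub>R axis j 1))"
    by (rule has_bochner_integral_FTC_Icc)
       (auto intro!: has_vector_derivative_along_axis diff continuous_on_compose2[OF cont] continuous_intros)
  then show "set_lebesgue_integral lborel {0..2 * pi} (\<lambda>s. partial_deriv j \<psi> (p + s *\<^sub>R axis j 1)) = 0"
    using per by (simp add: set_lebesgue_integral_def has_bochner_integral_integral_eq periodic_def)
qed

lemma torus_exp_add: "torus_exp (k + l) x = torus_exp k x * torus_exp l x"
  by (simp add: torus_exp_def kvec_add inner_add_left cis_mult)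

lemma torus_exp_0 [simp]: "torus_exp 0 x = 1"
  by (simp add: torus_exp_def)

lemma norm_torus_exp [simp]: "norm (torus_exp k x) = 1"
  by (simp add: torus_exp_def)

lemma has_derivative_exp_complex:
  fixes f :: "'a::real_normed_vector \<Rightarrow> complex"
  assumes "(f has_derivative f') (at x within S)"
  shows "((\<lambda>x. exp (f x)) has_derivative (\<lambda>h. exp (f x) * f' h)) (at x within S)"
  using has_derivative_compose[OF assms, of exp "\<lambda>h. exp (f x) * h"]
    DERIV_exp[of "f x"] by (simp add: has_field_derivative_def)

lemma has_derivative_torus_exp:
  "(torus_exp k has_derivative (\<lambda>h. torus_exp k x * (\<i> * of_real (kvec k \<bullet> h)))) (at x)"
proof -
  have "((\<lambda>x. \<i> * complex_of_real (kvec k \<bullet> x)) has_derivative (\<lambda>h. \<i> * of_real (kvec k \<bullet> h))) (at x)"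
    by (auto intro!: derivative_eq_intros)
  from has_derivative_exp_complex[OF this] show ?thesis
    by (simp add: torus_exp_def[abs_def] cis_conv_exp)
qed

lemma partial_deriv_torus_exp:
  "partial_deriv j (\<lambda>x. c * torus_exp k x) = (\<lambda>x. (c * (\<i> * of_int (k $ j))) * torus_exp k x)"
proof
  fix x
  have "((\<lambda>x. c * torus_exp k x) has_derivative (\<lambda>h. c * (torus_exp k x * (\<i> * of_real (kvec k \<bullet> h))))) (at x)"
    by (intro has_derivative_mult_right has_derivative_torus_exp)
  from partial_deriv_eq[OF this]
  show "partial_deriv j (\<lambda>x. c * torus_exp k x) x = (c * (\<i> * of_int (k $ j))) * torus_exp k x"
    by (simp add: inner_axis kvec_def)
qed

lemma continuous_on_torus_exp [continuous_intros]: "continuous_on S (torus_exp k)"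
  unfolding torus_exp_def[abs_def] by (intro continuous_intros)

lemma torus_exp_test_function: "(\<lambda>x. c * torus_exp k x) \<in> test_functions"
proof -
  have "C_k n (\<lambda>x. c * torus_exp k x)" for n
  proof (induction n arbitrary: c)
    case 0 show ?case by (auto intro!: continuous_intros)
  next
    case (Suc n)
    have "(\<lambda>x. c * torus_exp k x) differentiable_on UNIV"
      unfolding differentiable_on_def differentiable_def
      using has_derivative_mult_right[OF has_derivative_torus_exp] by blast
    then show ?case using Suc by (simp add: partial_deriv_torus_exp)
  qed
  moreover have "torus_exp k (x + (2 * pi) *\<^sub>R axis j 1) = torus_exp k x" for x j
    by (simp add: torus_exp_def inner_add_right inner_axis kvec_def cis_mult[symmetric])
  ultimately show ?thesis by (simp add: test_functions_def periodic_def)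
qed

lemma test_functionD:
  assumes "\<phi> \<in> test_functions"
  shows "\<phi> differentiable_on UNIV" "continuous_on UNIV (partial_deriv j \<phi>)" "periodic \<phi>" "continuous_on UNIV \<phi>"
proof -
  have "C_k (Suc 0) \<phi>" "C_k 0 \<phi>" "periodic \<phi>" using assms unfolding test_functions_def by blast+
  then show "\<phi> differentiable_on UNIV" "continuous_on UNIV (partial_deriv j \<phi>)" "periodic \<phi>" "continuous_on UNIV \<phi>"
    by auto
qed

lemma regular_distribution_torus_exp_partial_deriv:
  assumes \<phi>: "\<phi> \<in> test_functions"
  shows "regular_distribution (torus_exp k) (partial_deriv j \<phi>)
     = - (\<i> * of_int (k $ j)) * regular_distribution (torus_exp k) \<phi>"
proof -
  note \<phi>' = test_functionD[OF \<phi>]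
  let ?\<psi> = "\<lambda>x. torus_exp k x * \<phi> x"
  have pd: "partial_deriv j ?\<psi> = (\<lambda>x. \<i> * of_int (k $ j) * (torus_exp k x * \<phi> x) + torus_exp k x * partial_deriv j \<phi> x)"
  proof
    fix x
    obtain D where D: "(\<phi> has_derivative D) (at x)"
      using \<phi>'(1) by (auto simp: differentiable_on_def differentiable_def)
    have "(?\<psi> has_derivative (\<lambda>h. torus_exp k x * D h + torus_exp k x * (\<i> * of_real (kvec k \<bullet> h)) * \<phi> x)) (at x)"
      by (rule has_derivative_mult[OF has_derivative_torus_exp D])
    from partial_deriv_eq[OF this]
    show "partial_deriv j ?\<psi> x = \<i> * of_int (k $ j) * (torus_exp k x * \<phi> x) + torus_exp k x * partial_deriv j \<phi> x"
      by (simp add: partial_deriv_eq[OF D] inner_axis kvec_def)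
  qed
  have "set_lebesgue_integral lborel torus_cell (partial_deriv j ?\<psi>) = 0"
  proof (rule integral_partial_deriv_eq_0)
    show "?\<psi> differentiable_on UNIV"
      using \<phi>'(1) has_derivative_torus_exp
      by (intro differentiable_on_mult) (auto simp: differentiable_on_def differentiable_def)
    show "continuous_on UNIV (partial_deriv j ?\<psi>)"
      unfolding pd by (intro continuous_intros \<phi>')
    show "periodic ?\<psi>"
      using \<phi>'(3) torus_exp_test_function[of 1 k] by (simp add: test_functions_def periodic_def)
  qed
  moreover have "set_integrable lborel torus_cell (\<lambda>x. \<i> * of_int (k $ j) * (torus_exp k x * \<phi> x))"
      "set_integrable lborel torus_cell (\<lambda>x. torus_exp k x * partial_deriv j \<phi> x)"
    by (intro set_integrable_torus_cell continuous_intros \<phi>')+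
  ultimately have "\<i> * of_int (k $ j) * set_lebesgue_integral lborel torus_cell (\<lambda>x. torus_exp k x * \<phi> x)
     + set_lebesgue_integral lborel torus_cell (\<lambda>x. torus_exp k x * partial_deriv j \<phi> x) = 0"
    unfolding pd by (simp add: set_integral_add)
  then show ?thesis
    unfolding regular_distribution_def by (simp add: add_eq_0_iff2)
qed

text \<open>
  The decay \<open>O(1 / \<bar>k\<bar>)\<close> of the coefficients of a test function.  It is dual to
  the weight \<open>1 / \<bar>k\<bar>\<close> in the norms of the data and of the solution.
\<close>

lemma norm_kvec_times_regular_distribution_le:
  assumes \<phi>: "\<phi> \<in> test_functions" and B: "\<And>j x. x \<in> torus_cell \<Longrightarrow> norm (partial_deriv j \<phi> x) \<le> B" "0 \<le> B"
  shows "norm (kvec k) * norm (regular_distribution (torus_exp k) \<phi>) \<le> 3 * ((2 * pi) ^ 3 * B)"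
proof -
  have "\<bar>real_of_int (k $ j)\<bar> * norm (regular_distribution (torus_exp k) \<phi>) \<le> (2 * pi) ^ 3 * B" for j
  proof -
    have "\<bar>real_of_int (k $ j)\<bar> * norm (regular_distribution (torus_exp k) \<phi>)
        = norm (regular_distribution (torus_exp k) (partial_deriv j \<phi>))"
      by (simp add: regular_distribution_torus_exp_partial_deriv[OF \<phi>] norm_mult)
    also have "\<dots> \<le> (2 * pi) ^ 3 * B"
      unfolding regular_distribution_def
      by (rule norm_integral_torus_cell_le) (use B in \<open>auto simp: norm_mult\<close>)
    finally show ?thesis .
  qed
  then have "(\<Sum>j\<in>(UNIV::3 set). \<bar>real_of_int (k $ j)\<bar> * norm (regular_distribution (torus_exp k) \<phi>))
      \<le> (\<Sum>j\<in>(UNIV::3 set). (2 * pi) ^ 3 * B)"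
    by (rule sum_mono)
  then have "norm1 k * norm (regular_distribution (torus_exp k) \<phi>) \<le> 3 * ((2 * pi) ^ 3 * B)"
    by (simp add: norm1_def sum_distrib_right)
  then show ?thesis
    using mult_right_mono[OF norm_kvec_le_norm1[of k], of "norm (regular_distribution (torus_exp k) \<phi>)"] by simp
qed

lemma regular_distribution_scale:
  "regular_distribution f (\<lambda>x. c * \<phi> x) = c * regular_distribution f \<phi>"
  unfolding regular_distribution_def by (simp add: mult.left_commute)

lemma regular_distribution_orthogonal:
  "regular_distribution (torus_exp l) (\<lambda>x. c * torus_exp (- k) x) = (if l = k then c * (2 * pi) ^ 3 else 0)"
proof -
  have prod: "torus_exp l x * torus_exp (- k) x = torus_exp (l - k) x" for x
    by (simp flip: torus_exp_add)
  have "set_lebesgue_integral lborel torus_cell (torus_exp m) = (if m = 0 then (2 * pi) ^ 3 else 0)" for m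
  proof (cases "m = 0")
    case True
    then have "set_lebesgue_integral lborel torus_cell (torus_exp m) = set_lebesgue_integral lborel torus_cell (\<lambda>_. 1)"
      by (intro set_lebesgue_integral_cong) auto
    also have "\<dots> = of_real (measure lborel torus_cell)"
      using emeasure_compact_finite[OF compact_torus_cell]
      by (simp add: set_lebesgue_integral_def of_real_def)
    finally show ?thesis using True by (simp add: measure_torus_cell)
  next
    case False
    then obtain j where j: "m $ j \<noteq> 0" by (auto simp: vec_eq_iff)
    have "regular_distribution (torus_exp m) (partial_deriv j (\<lambda>x. 1 * torus_exp 0 x))
        = - (\<i> * of_int (m $ j)) * regular_distribution (torus_exp m) (\<lambda>x. 1 * torus_exp 0 x)"
      by (rule regular_distribution_torus_exp_partial_deriv[OF torus_exp_test_function])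
    moreover have "partial_deriv j (\<lambda>x. 1) = (\<lambda>x. 0)"
      using partial_deriv_torus_exp[of j 1 0] by simp
    ultimately show ?thesis using False j
      by (simp add: regular_distribution_def set_lebesgue_integral_def[where f="\<lambda>_. 0"])
  qed
  then show ?thesis
    unfolding regular_distribution_scale by (simp add: regular_distribution_def prod)
qed

text \<open>
  By orthogonality the weak sum has a single nonzero term, whatever the coefficients are.
\<close>

lemma fourier_series_torus_exp:
  "fourier_series c (\<lambda>x. a * torus_exp (- k) x) = a * (2 * pi) ^ 3 * c k"
proof -
  have "fourier_series c (\<lambda>x. a * torus_exp (- k) x)
      = (\<Sum>\<^sub>\<infinity>l\<in>{k}. c l * regular_distribution (torus_exp l) (\<lambda>x. a * torus_exp (- k) x))"
    unfolding fourier_series_def by (rule infsum_cong_neutral) (auto simp: regular_distribution_orthogonal)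
  then show ?thesis by (simp add: regular_distribution_orthogonal)
qed

lemma fourier_coeff_fourier_series [simp]: "fourier_coeff (fourier_series c) k = c k"
  using fourier_series_torus_exp[of c 1 k] by (simp add: fourier_coeff_def)

section \<open>Fourier coefficients of the nonlinearity\<close>

lemma measurable_torus_exp [measurable]: "torus_exp k \<in> borel_measurable borel"
  by (rule borel_measurable_continuous_onI) (rule continuous_on_torus_exp)

lemma regular_distribution_series:
  assumes sum: "(\<integral>\<^sup>+k. ennreal (norm (c k)) \<partial>count_space UNIV) < \<infinity>"
    and [measurable]: "\<phi> \<in> borel_measurable borel"
    and B: "\<And>x. x \<in> torus_cell \<Longrightarrow> norm (\<phi> x) \<le> B" "0 \<le> B"
  shows "regular_distribution (\<lambda>x. \<Sum>\<^sub>\<infinity>k. c k * torus_exp k x) \<phi> = fourier_series c \<phi>"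
proof -
  let ?f = "\<lambda>k x. c k * (indicator torus_cell x *\<^sub>R (torus_exp k x * \<phi> x))"
  have "(\<integral>\<^sup>+k. (\<integral>\<^sup>+x. ennreal (norm (?f k x)) \<partial>lborel) \<partial>count_space UNIV)
      \<le> (\<integral>\<^sup>+k. (\<integral>\<^sup>+x. ennreal (norm (c k)) * ennreal B * indicator torus_cell x \<partial>lborel) \<partial>count_space UNIV)"
    using B by (intro nn_integral_mono)
      (auto simp: indicator_def norm_mult ennreal_mult''[symmetric] intro!: ennreal_leI mult_left_mono)
  also have "\<dots> = (\<integral>\<^sup>+k. ennreal (norm (c k)) * (ennreal B * emeasure lborel torus_cell) \<partial>count_space UNIV)"
    by (simp add: nn_integral_cmult mult.assoc)
  also have "\<dots> = (\<integral>\<^sup>+k. ennreal (norm (c k)) \<partial>count_space UNIV) * (ennreal B * emeasure lborel torus_cell)"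
    by (rule nn_integral_multc) simp
  also have "\<dots> < \<infinity>"
    using sum emeasure_compact_finite[OF compact_torus_cell] by (simp add: ennreal_mult_less_top)
  finally have fin: "(\<integral>\<^sup>+k. (\<integral>\<^sup>+x. ennreal (norm (?f k x)) \<partial>lborel) \<partial>count_space UNIV) < \<infinity>" .
  have "(\<integral>x. (\<Sum>\<^sub>\<infinity>k. ?f k x) \<partial>lborel) = (\<Sum>\<^sub>\<infinity>k. \<integral>x. ?f k x \<partial>lborel)"
    by (rule integral_infsum[OF lborel.sigma_finite_measure_axioms _ fin]) measurable
  moreover have "indicator torus_cell x *\<^sub>R ((\<Sum>\<^sub>\<infinity>k. c k * torus_exp k x) * \<phi> x) = (\<Sum>\<^sub>\<infinity>k. ?f k x)" for x
    by (simp add: infsum_cmult_left'[symmetric] indicator_def mult.assoc)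
  moreover have "(\<integral>x. ?f k x \<partial>lborel) = c k * regular_distribution (torus_exp k) \<phi>" for k
    by (simp only: regular_distribution_def set_lebesgue_integral_def integral_mult_right_zero)
  ultimately show ?thesis
    unfolding fourier_series_def by (subst regular_distribution_def) (simp only: set_lebesgue_integral_def)
qed

lemma measurable_torus_value [measurable]: "torus_value T \<in> borel_measurable borel"
  unfolding torus_value_def[abs_def] by (rule measurable_infsum) measurable

lemma norm_torus_value_le:
  "ennreal (norm (torus_value T x)) \<le> (\<integral>\<^sup>+k. ennreal (norm (fourier_coeff T k)) \<partial>count_space UNIV)"
  using norm_infsum_le_nn_integral[of "\<lambda>k. fourier_coeff T k * torus_exp k x" UNIV]
  by (simp add: torus_value_def norm_mult)

lemma norm_fourier_coeff_le_fourier_vec: "norm (fourier_coeff (u $ i) k) \<le> norm (fourier_vec u k)"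
  using Finite_Cartesian_Product.norm_nth_le[of "fourier_vec u k" i] by (simp add: fourier_vec_def)

text \<open>
  Convergence of the two series is absolute, so that they can be integrated term by term one after
  the other.
\<close>

lemma fourier_coeff_tensor:
  assumes fin: "(\<integral>\<^sup>+l. ennreal (norm (fourier_vec u l)) \<partial>count_space UNIV) < \<infinity>"
  shows "fourier_coeff (tensor u i j) k = (\<Sum>\<^sub>\<infinity>l. fourier_coeff (u $ i) l * fourier_coeff (u $ j) (k - l))"
proof -
  have fin_i: "(\<integral>\<^sup>+l. ennreal (norm (fourier_coeff (u $ i) l)) \<partial>count_space UNIV) < \<infinity>" for i
    by (rule order_le_less_trans[OF _ fin]) (intro nn_integral_mono ennreal_leI norm_fourier_coeff_le_fourier_vec)
  define B where "B = enn2real (\<integral>\<^sup>+l. ennreal (norm (fourier_coeff (u $ j) l)) \<partial>count_space UNIV)"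
  have B: "norm (torus_value (u $ j) x) \<le> B" for x
  proof -
    have "ennreal (norm (torus_value (u $ j) x)) \<le> ennreal B"
      using norm_torus_value_le[of "u $ j" x] fin_i[of j] by (simp add: B_def)
    then show ?thesis by (subst (asm) ennreal_le_iff) (auto simp: B_def)
  qed
  have inner: "regular_distribution (torus_exp l) (\<lambda>x. torus_value (u $ j) x * torus_exp (- k) x)
      = (2 * pi) ^ 3 * fourier_coeff (u $ j) (k - l)" for l
  proof -
    have "regular_distribution (torus_exp l) (\<lambda>x. torus_value (u $ j) x * torus_exp (- k) x)
        = regular_distribution (\<lambda>x. \<Sum>\<^sub>\<infinity>m. fourier_coeff (u $ j) m * torus_exp m x) (\<lambda>x. 1 * torus_exp (- (k - l)) x)"
      unfolding regular_distribution_def torus_value_def[symmetric]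
      using torus_exp_add[of l "- k"] by (intro set_lebesgue_integral_cong) (auto simp: mult_ac)
    also have "\<dots> = fourier_series (fourier_coeff (u $ j)) (\<lambda>x. 1 * torus_exp (- (k - l)) x)"
      by (rule regular_distribution_series[OF fin_i, of _ 1]) auto
    finally show ?thesis unfolding fourier_series_torus_exp by simp
  qed
  have "tensor u i j (torus_exp (- k)) = regular_distribution (\<lambda>x. \<Sum>\<^sub>\<infinity>l. fourier_coeff (u $ i) l * torus_exp l x)
      (\<lambda>x. torus_value (u $ j) x * torus_exp (- k) x)"
    unfolding tensor_def regular_distribution_def torus_value_def[symmetric] by (simp add: mult.assoc)
  also have "\<dots> = fourier_series (fourier_coeff (u $ i)) (\<lambda>x. torus_value (u $ j) x * torus_exp (- k) x)"
    using B order_trans[OF norm_ge_zero B]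
    by (intro regular_distribution_series[OF fin_i, of _ B]) (auto simp: norm_mult)
  also have "\<dots> = (\<Sum>\<^sub>\<infinity>l. (2 * pi) ^ 3 * (fourier_coeff (u $ i) l * fourier_coeff (u $ j) (k - l)))"
    unfolding fourier_series_def inner by (simp add: mult_ac)
  also have "\<dots> = (2 * pi) ^ 3 * (\<Sum>\<^sub>\<infinity>l. fourier_coeff (u $ i) l * fourier_coeff (u $ j) (k - l))"
    by (rule infsum_cmult_right')
  finally show ?thesis by (simp add: fourier_coeff_def)
qed

lemma norm_fourier_coeff_tensor_le:
  assumes fin: "(\<integral>\<^sup>+l. ennreal (norm (fourier_vec u l)) \<partial>count_space UNIV) < \<infinity>"
  shows "ennreal (norm (fourier_coeff (tensor u i j) k)) \<le> conv (\<lambda>l. ennreal (norm (fourier_vec u l))) k"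
  unfolding fourier_coeff_tensor[OF fin] conv_def
proof (rule order.trans[OF norm_infsum_le_nn_integral], rule nn_integral_mono)
  fix l
  show "ennreal (norm (fourier_coeff (u $ i) l * fourier_coeff (u $ j) (k - l)))
      \<le> ennreal (norm (fourier_vec u l)) * ennreal (norm (fourier_vec u (k - l)))"
    by (simp add: norm_mult ennreal_mult''[symmetric])
       (intro ennreal_leI mult_mono norm_fourier_coeff_le_fourier_vec; simp)
qed

lemma div_tensor_torus_exp:
  "(div_tensor u $ i) (\<lambda>x. a * torus_exp (- k) x)
     = a * (2 * pi) ^ 3 * (\<Sum>j\<in>UNIV. \<i> * of_int (k $ j) * fourier_coeff (tensor u i j) k)"
proof -
  have "distr_partial j (tensor u i j) (\<lambda>x. a * torus_exp (- k) x)
     = a * (2 * pi) ^ 3 * (\<i> * of_int (k $ j) * fourier_coeff (tensor u i j) k)" for j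
    unfolding distr_partial_def partial_deriv_torus_exp tensor_def regular_distribution_scale
    by (simp add: fourier_coeff_def)
  then show ?thesis by (simp add: div_tensor_def sum_distrib_left)
qed

lemma fourier_coeff_div_tensor:
  "fourier_coeff (div_tensor u $ i) k = (\<Sum>j\<in>UNIV. \<i> * of_int (k $ j) * fourier_coeff (tensor u i j) k)"
  using div_tensor_torus_exp[of u i 1 k] by (simp add: fourier_coeff_def)

lemma fourier_coeff_leray_div_tensor:
  "fourier_coeff (leray (div_tensor u) $ i) k = fourier_coeff (div_tensor u $ i) k
     - of_int (k $ i) * (\<Sum>j\<in>UNIV. of_int (k $ j) * fourier_coeff (div_tensor u $ j) k) / of_real ((norm (kvec k))\<^sup>2)"
proof -
  define S where "S = (\<Sum>j\<in>UNIV. of_int (k $ j) * fourier_coeff (div_tensor u $ j) k)"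
  have div: "fourier_coeff (distr_div (div_tensor u)) k
      = (\<Sum>j\<in>UNIV. \<i> * of_int (k $ j) * fourier_coeff (div_tensor u $ j) k)"
  proof -
    have "distr_partial j (div_tensor u $ j) (torus_exp (- k))
        = (2 * pi) ^ 3 * (\<i> * of_int (k $ j) * fourier_coeff (div_tensor u $ j) k)" for j
      unfolding distr_partial_def
      using partial_deriv_torus_exp[of j 1 "- k"] div_tensor_torus_exp[of u j "\<i> * of_int ((- k) $ j)" k]
      by (simp add: fourier_coeff_div_tensor del: fourier_coeff_fourier_series)
    then show ?thesis
      by (simp add: fourier_coeff_def distr_div_def sum_divide_distrib)
  qed
  have "distr_partial i (inverse_laplacian (distr_div (div_tensor u))) (torus_exp (- k)) / of_real ((2 * pi) ^ 3)
      = (2 * pi) ^ 3 * (\<i> * of_int (k $ i) * (of_real (- 1 / (norm (kvec k))\<^sup>2) * fourier_coeff (distr_div (div_tensor u)) k)) / of_real ((2 * pi) ^ 3)"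
    unfolding distr_partial_def inverse_laplacian_def fourier_multiplier_def
    using partial_deriv_torus_exp[of i 1 "- k"]
      fourier_series_torus_exp[of _ "\<i> * of_int ((- k) $ i)" k]
    by simp
  also have "\<dots> = \<i> * of_int (k $ i) * (of_real (- 1 / (norm (kvec k))\<^sup>2) * (\<i> * S))"
  proof -
    have "fourier_coeff (distr_div (div_tensor u)) k = \<i> * S"
      unfolding div S_def by (simp add: sum_distrib_left mult.assoc)
    then show ?thesis by simp
  qed
  also have "\<dots> = of_int (k $ i) * S / of_real ((norm (kvec k))\<^sup>2)"
    by (simp add: field_simps)
  finally show ?thesis
    by (simp add: leray_def fourier_coeff_def[of "\<lambda>\<phi>. (div_tensor u $ i) \<phi> - _ \<phi>"] diff_divide_distrib
        fourier_coeff_def[of "div_tensor u $ i"] S_def)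
qed

text \<open>
  The divergence contributes three terms of size at most \<open>\<bar>k\<bar> q\<close> to each component, and the
  projection adds a vector whose components are at most three times as large: \<open>12 = 3 + 9\<close>.
\<close>

lemma norm_fourier_coeff_leray_div_tensor_le:
  assumes q: "\<And>i j. norm (fourier_coeff (tensor u i j) k) \<le> q"
  shows "norm (fourier_coeff (leray (div_tensor u) $ i) k) \<le> 12 * norm (kvec k) * q"
proof -
  let ?n = "norm (kvec k)"
  have k: "\<bar>real_of_int (k $ j)\<bar> \<le> ?n" for j
    using component_le_norm_cart[of "kvec k" j] by (simp add: kvec_def)
  have q0: "0 \<le> q" using q[of 1 1] norm_ge_zero order_trans by blast
  have D: "norm (fourier_coeff (div_tensor u $ j) k) \<le> 3 * ?n * q" for j
  proof -
    have "norm (fourier_coeff (div_tensor u $ j) k) \<le> (\<Sum>m\<in>(UNIV::3 set). ?n * q)"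
      unfolding fourier_coeff_div_tensor
      by (rule sum_norm_le) (auto simp: norm_mult intro!: mult_mono k q)
    then show ?thesis by simp
  qed
  have "norm (of_int (k $ i) * (\<Sum>j\<in>UNIV. of_int (k $ j) * fourier_coeff (div_tensor u $ j) k) / complex_of_real (?n\<^sup>2))
      \<le> 9 * ?n * q"
  proof (cases "k = 0")
    case False
    have "norm (\<Sum>j\<in>(UNIV::3 set). of_int (k $ j) * fourier_coeff (div_tensor u $ j) k) \<le> (\<Sum>j\<in>(UNIV::3 set). ?n * (3 * ?n * q))"
      by (rule sum_norm_le) (auto simp: norm_mult intro!: mult_mono k D)
    then have "norm (of_int (k $ i) * (\<Sum>j\<in>UNIV. of_int (k $ j) * fourier_coeff (div_tensor u $ j) k))
        \<le> ?n * (9 * ?n\<^sup>2 * q)"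
      unfolding norm_mult using k[of i] by (intro mult_mono) (auto simp: power2_eq_square)
    then have "norm (of_int (k $ i) * (\<Sum>j\<in>UNIV. of_int (k $ j) * fourier_coeff (div_tensor u $ j) k)) / ?n\<^sup>2
        \<le> ?n * (9 * ?n\<^sup>2 * q) / ?n\<^sup>2"
      by (rule divide_right_mono) simp
    then have "norm (of_int (k $ i) * (\<Sum>j\<in>UNIV. of_int (k $ j) * fourier_coeff (div_tensor u $ j) k) / complex_of_real (?n\<^sup>2))
        \<le> ?n * (9 * ?n\<^sup>2 * q) / ?n\<^sup>2"
      by (simp only: norm_divide norm_of_real abs_power2)
    also have "\<dots> = 9 * ?n * q" using False by (simp add: power2_eq_square)
    finally show ?thesis .
  qed simp
  then have "norm (fourier_coeff (leray (div_tensor u) $ i) k) \<le> 3 * ?n * q + 9 * ?n * q"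
    unfolding fourier_coeff_leray_div_tensor by (intro order.trans[OF norm_triangle_ineq4] add_mono D)
  also have "\<dots> \<le> 12 * ?n * q" using q0 by (simp add: mult_right_mono)
  finally show ?thesis .
qed

text \<open>
  The Bochner integral of a function that is not Borel measurable is \<open>0\<close>, hence the time integral in
  the mild formulation carries information only if its integrand is measurable at every time, not just
  almost everywhere.  Sums of complex numbers that fail to converge are \<open>0\<close>, which keeps the pointwise
  values of the velocity jointly measurable in time and space.
\<close>

lemma measurable_fourier_coeff_leray_div_tensor:
  assumes [measurable]: "\<And>i l. (\<lambda>s. fourier_coeff (w s $ i) l) \<in> borel_measurable borel"
  shows "(\<lambda>s. fourier_coeff (leray (div_tensor (w s)) $ i) k) \<in> borel_measurable borel"
proof -
  have tv [measurable]: "(\<lambda>(s, x). torus_value (w s $ i) x) \<in> borel_measurable (borel \<Otimes>\<^sub>M borel)" for i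
    unfolding torus_value_def case_prod_beta' by (rule measurable_infsum) measurable
  have [measurable]: "(\<lambda>s. fourier_coeff (tensor (w s) i j) k) \<in> borel_measurable borel" for i j
    unfolding fourier_coeff_def tensor_def regular_distribution_def set_lebesgue_integral_def
    by (rule borel_measurable_divide, rule lborel.borel_measurable_lebesgue_integral) measurable
  show ?thesis
    unfolding fourier_coeff_leray_div_tensor fourier_coeff_div_tensor by measurable
qed

section \<open>Pairing Fourier series with test functions\<close>

text \<open>
  The factor \<open>1 / \<bar>k\<bar>\<close> is supplied by the decay of the coefficients of \<open>\<phi>\<close>; the mean is estimated
  separately, by the supremum of \<open>\<phi>\<close>.
\<close>

lemma fourier_series_abs_bound:
  assumes \<phi>: "\<phi> \<in> test_functions"
    and B: "\<And>x. x \<in> torus_cell \<Longrightarrow> norm (\<phi> x) \<le> B"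
      "\<And>j x. x \<in> torus_cell \<Longrightarrow> norm (partial_deriv j \<phi> x) \<le> B" "0 \<le> B"
  shows "(\<integral>\<^sup>+k. ennreal (norm (c k * regular_distribution (torus_exp k) \<phi>)) \<partial>count_space UNIV)
    \<le> ennreal (3 * (2 * pi) ^ 3 * B)
      * (ennreal (norm (c 0)) + (\<integral>\<^sup>+k. ennreal (norm (c k)) * ennreal (1 / norm (kvec k)) \<partial>count_space UNIV))"
proof -
  let ?B = "3 * (2 * pi) ^ 3 * B"
  have E0: "norm (regular_distribution (torus_exp k) \<phi>) \<le> (2 * pi) ^ 3 * B" for k
    unfolding regular_distribution_def
    by (rule norm_integral_torus_cell_le) (use B in \<open>auto simp: norm_mult\<close>)
  have E: "norm (kvec k) * norm (regular_distribution (torus_exp k) \<phi>) \<le> ?B" for k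
    using norm_kvec_times_regular_distribution_le[OF \<phi>, of B k] B by (simp add: mult.assoc)
  have "ennreal (norm (c k * regular_distribution (torus_exp k) \<phi>))
     \<le> ennreal ?B * (ennreal (norm (c k)) * indicator {0} k + ennreal (norm (c k)) * ennreal (1 / norm (kvec k)))" for k
  proof (cases "k = 0")
    case True
    have "norm (c 0) * norm (regular_distribution (torus_exp 0) \<phi>) \<le> norm (c 0) * ((2 * pi) ^ 3 * B)"
      by (intro mult_left_mono E0) simp
    also have "\<dots> \<le> ?B * norm (c 0)"
      using B(3) by (simp add: mult_ac mult_left_mono)
    finally show ?thesis
      using True B(3) by (simp add: norm_mult ennreal_mult''[symmetric] ennreal_leI)
  next
    case False
    have "norm (c k * regular_distribution (torus_exp k) \<phi>)
        = norm (c k) * (1 / norm (kvec k)) * (norm (kvec k) * norm (regular_distribution (torus_exp k) \<phi>))"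
      using False by (simp add: norm_mult)
    also have "\<dots> \<le> norm (c k) * (1 / norm (kvec k)) * ?B"
      by (intro mult_left_mono E) simp
    finally show ?thesis
      using False B(3) by (simp add: ennreal_mult''[symmetric] ennreal_leI mult_ac)
  qed
  then have "(\<integral>\<^sup>+k. ennreal (norm (c k * regular_distribution (torus_exp k) \<phi>)) \<partial>count_space UNIV)
     \<le> (\<integral>\<^sup>+k. ennreal ?B * (ennreal (norm (c k)) * indicator {0} k + ennreal (norm (c k)) * ennreal (1 / norm (kvec k))) \<partial>count_space UNIV)"
    by (intro nn_integral_mono)
  also have "\<dots> = ennreal ?B * ((\<integral>\<^sup>+k. ennreal (norm (c k)) * indicator {0} k \<partial>count_space UNIV)
      + (\<integral>\<^sup>+k. ennreal (norm (c k)) * ennreal (1 / norm (kvec k)) \<partial>count_space UNIV))"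
    by (subst nn_integral_cmult, simp, subst nn_integral_add) auto
  also have "(\<integral>\<^sup>+k. ennreal (norm (c k)) * indicator {0} k \<partial>count_space UNIV) = ennreal (norm (c 0))"
    by (subst nn_integral_indicator_singleton) auto
  finally show ?thesis .
qed

lemma test_function_bounds:
  assumes "\<phi> \<in> test_functions"
  obtains B where "\<And>x. x \<in> torus_cell \<Longrightarrow> norm (\<phi> x) \<le> B"
      "\<And>j x. x \<in> torus_cell \<Longrightarrow> norm (partial_deriv j \<phi> x) \<le> B" "0 \<le> B"
proof -
  have bd: "\<exists>b. \<forall>x\<in>torus_cell. norm (f x) \<le> b" if "continuous_on UNIV f" for f :: "real^3 \<Rightarrow> complex"
    using compact_imp_bounded[OF compact_continuous_image[OF continuous_on_subset[OF that subset_UNIV] compact_torus_cell]]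
    by (auto simp: bounded_iff)
  obtain b0 where b0: "\<forall>x\<in>torus_cell. norm (\<phi> x) \<le> b0"
    using bd test_functionD[OF assms] by blast
  have "\<forall>j. \<exists>b. \<forall>x\<in>torus_cell. norm (partial_deriv j \<phi> x) \<le> b"
    using bd test_functionD[OF assms] by blast
  then obtain b where b: "\<forall>j. \<forall>x\<in>torus_cell. norm (partial_deriv j \<phi> x) \<le> b j" by metis
  define B where "B = max 0 (max b0 (Max (range b)))"
  have bB: "b j \<le> B" for j
    using Max_ge[of "range b" "b j"] by (simp add: B_def le_max_iff_disj)
  show ?thesis
  proof (rule that[of B])
    show "norm (\<phi> x) \<le> B" if "x \<in> torus_cell" for x
      using b0 that by (force simp: B_def)
    show "norm (partial_deriv j \<phi> x) \<le> B" if "x \<in> torus_cell" for j x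
      using b that bB[of j] order_trans by blast
  qed (simp add: B_def)
qed

lemma summable_fourier_series:
  assumes "\<phi> \<in> test_functions"
    and "(\<integral>\<^sup>+k. ennreal (norm (c k)) * ennreal (1 / norm (kvec k)) \<partial>count_space UNIV) < \<infinity>"
  shows "(\<lambda>k. c k * regular_distribution (torus_exp k) \<phi>) summable_on UNIV"
proof -
  obtain B where B: "\<And>x. x \<in> torus_cell \<Longrightarrow> norm (\<phi> x) \<le> B"
      "\<And>j x. x \<in> torus_cell \<Longrightarrow> norm (partial_deriv j \<phi> x) \<le> B" "0 \<le> B"
    using test_function_bounds[OF assms(1)] by metis
  have "ennreal (3 * (2 * pi) ^ 3 * B)
      * (ennreal (norm (c 0)) + (\<integral>\<^sup>+k. ennreal (norm (c k)) * ennreal (1 / norm (kvec k)) \<partial>count_space UNIV)) < \<infinity>"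
    using assms(2) by (simp add: ennreal_mult_less_top)
  then show ?thesis
    unfolding summable_on_iff_nn_integral_finite
    using fourier_series_abs_bound[OF assms(1) B, of c] by (rule order_le_less_trans[rotated])
qed

section \<open>Fourier moduli of time-dependent distributions\<close>

definition modulus :: "curve \<Rightarrow> real \<Rightarrow> int^3 \<Rightarrow> ennreal" where
  "modulus v t k = (if 0 \<le> t \<and> k \<noteq> 0 then ennreal (norm (fourier_vec (v t) k)) else 0)"

text \<open>
  A time-dependent distribution is measurable in time on \<open>(0,\<infinity>)\<close>.  Extended by \<open>0\<close> it is Borel
  measurable on the whole line, with the same time integrals.
\<close>

definition restrict_pos :: "curve \<Rightarrow> curve" where
  "restrict_pos v s = (if 0 < s then v s else (\<chi> i. (\<lambda>\<phi>. 0)))"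

lemma norm_calX_minus1_eq: "norm_calX_minus1 v = energy_sup (modulus v)"
proof -
  have "(SUP t\<in>{0..}. ennreal (norm (fourier_vec (v t) k) / norm (kvec k)))
      = (SUP t. modulus v t k * ennreal (1 / norm (kvec k)))" if "k \<noteq> 0" for k
  proof (rule antisym)
    show "(SUP t\<in>{0..}. ennreal (norm (fourier_vec (v t) k) / norm (kvec k)))
      \<le> (SUP t. modulus v t k * ennreal (1 / norm (kvec k)))"
      by (rule SUP_mono) (use that in \<open>auto simp: modulus_def ennreal_mult''[symmetric] intro!: exI[of _ "_::real"]\<close>)
    show "(SUP t. modulus v t k * ennreal (1 / norm (kvec k)))
      \<le> (SUP t\<in>{0..}. ennreal (norm (fourier_vec (v t) k) / norm (kvec k)))"
    proof (rule SUP_least)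
      fix t
      show "modulus v t k * ennreal (1 / norm (kvec k)) \<le> (SUP t\<in>{0..}. ennreal (norm (fourier_vec (v t) k) / norm (kvec k)))"
        using SUP_upper[of t "{0..}" "\<lambda>t. ennreal (norm (fourier_vec (v t) k) / norm (kvec k))"]
        by (auto simp: modulus_def ennreal_mult''[symmetric])
    qed
  qed
  then have "norm_calX_minus1 v = (\<integral>\<^sup>+k. (SUP t. modulus v t k * ennreal (1 / norm (kvec k))) \<partial>count_space (UNIV - {0}))"
    unfolding norm_calX_minus1_def infsum_ennreal_eq_nn_integral by (intro nn_integral_cong) auto
  then show ?thesis
    unfolding energy_sup_def by (subst (asm) nn_integral_count_space_zero_mode) (auto simp: modulus_def)
qed

lemma norm_calX_1_eq: "norm_calX_1 v = energy_int (modulus v)"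
proof -
  have "norm_calX_1 v = (\<integral>\<^sup>+k. (\<integral>\<^sup>+t. modulus v t k * ennreal (norm (kvec k)) \<partial>lborel) \<partial>count_space (UNIV - {0}))"
    unfolding norm_calX_1_def infsum_ennreal_eq_nn_integral
    by (intro nn_integral_cong)
       (auto simp: modulus_def indicator_def ennreal_mult''[symmetric] mult.commute)
  then show ?thesis
    unfolding energy_int_def by (subst (asm) nn_integral_count_space_zero_mode) (auto simp: modulus_def)
qed

lemma norm_Y_eq: "norm_Y v = energy_sup (modulus v) + energy_int (modulus v)"
  by (simp add: norm_Y_def norm_calX_minus1_eq norm_calX_1_eq)

lemma norm_X_minus1_eq:
  "norm_X_minus1 u = (\<integral>\<^sup>+k. ennreal (norm (fourier_vec u k)) * ennreal (1 / norm (kvec k)) \<partial>count_space UNIV)"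
  unfolding norm_X_minus1_def infsum_ennreal_eq_nn_integral
  by (subst nn_integral_count_space_zero_mode) (auto simp: ennreal_mult''[symmetric])

text \<open>
  Local integrability is given on compact intervals; \<open>(0,\<infinity>)\<close> is their increasing union.
\<close>

lemma measurable_pairing:
  assumes "time_distribution f" "\<phi> \<in> test_functions"
  shows "(\<lambda>s. if 0 < s then (f s $ i) \<phi> else 0) \<in> borel_measurable borel"
proof -
  let ?g = "\<lambda>n s. indicator {1 / real (Suc n)..real (Suc (Suc n))} s *\<^sub>R (f s $ i) \<phi>"
  have "?g n \<in> borel_measurable borel" for n
  proof -
    have "1 / real (Suc n) \<le> 1" by simp
    then have "1 / real (Suc n) < real (Suc (Suc n))" by (simp only: of_nat_Suc)
    then have "set_integrable lborel {1 / real (Suc n)..real (Suc (Suc n))} (\<lambda>s. (f s $ i) \<phi>)"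
      using assms unfolding time_distribution_def by (metis of_nat_0_less_iff zero_less_Suc zero_less_divide_1_iff)
    then show ?thesis
      unfolding set_integrable_def by (auto dest: borel_measurable_integrable)
  qed
  moreover have "(\<lambda>n. ?g n s) \<longlonglongrightarrow> (if 0 < s then (f s $ i) \<phi> else 0)" for s
  proof (rule tendsto_eventually, cases "0 < s")
    case True
    obtain m :: nat where m: "max (1 / s) s \<le> real m" using real_arch_simple by blast
    have "?g n s = (f s $ i) \<phi>" if "m \<le> n" for n
    proof -
      have "max (1 / s) s \<le> real (Suc n)" using m that by linarith
      then have "1 / real (Suc n) \<le> s \<and> s \<le> real (Suc (Suc n))"
        using True by (simp add: field_simps)
      then show ?thesis by simp
    qed
    then show "\<forall>\<^sub>F n in sequentially. ?g n s = (if 0 < s then (f s $ i) \<phi> else 0)"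
      using True by (auto simp: eventually_sequentially)
  next
    case False
    have "\<not> 1 / real (Suc n) \<le> s" for n using False
      by (smt (verit) of_nat_0_less_iff zero_less_Suc zero_less_divide_1_iff)
    then show "\<forall>\<^sub>F n in sequentially. ?g n s = (if 0 < s then (f s $ i) \<phi> else 0)"
      using False by simp
  qed
  ultimately show ?thesis by (rule borel_measurable_LIMSEQ_metric)
qed

lemma fourier_coeff_zero [simp]: "fourier_coeff (\<lambda>\<phi>. 0) k = 0"
  by (simp add: fourier_coeff_def)

lemma torus_exp_in_test_functions: "torus_exp k \<in> test_functions"
  using torus_exp_test_function[of 1 k] by simp

lemma measurable_fourier_coeff_restrict_pos:
  assumes "time_distribution v"
  shows "(\<lambda>s. fourier_coeff (restrict_pos v s $ i) k) \<in> borel_measurable borel"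
proof -
  have "(\<lambda>s. fourier_coeff (restrict_pos v s $ i) k)
      = (\<lambda>s. (if 0 < s then (v s $ i) (torus_exp (- k)) else 0) / of_real ((2 * pi) ^ 3))"
    by (auto simp: restrict_pos_def fourier_coeff_def)
  then show ?thesis
    using measurable_pairing[OF assms torus_exp_in_test_functions, of i "- k"] by simp
qed

lemma measurable_modulus:
  assumes "time_distribution v"
  shows "(\<lambda>t. modulus v t k) \<in> borel_measurable borel"
proof -
  note [measurable] = measurable_fourier_coeff_restrict_pos[OF assms]
  have "(\<lambda>t. ennreal (norm (fourier_vec (restrict_pos v t) k))) \<in> borel_measurable borel"
    unfolding fourier_vec_def norm_vec_def L2_set_def by simp
  then have [measurable]: "(\<lambda>t. if k \<noteq> 0 \<and> 0 < t then ennreal (norm (fourier_vec (restrict_pos v t) k)) else 0) \<in> borel_measurable borel"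
    by measurable
  have "(\<lambda>t. modulus v t k) = (\<lambda>t. if t = 0 then modulus v 0 k
      else if k \<noteq> 0 \<and> 0 < t then ennreal (norm (fourier_vec (restrict_pos v t) k)) else 0)"
    by (auto simp: modulus_def restrict_pos_def)
  then show ?thesis by simp
qed

section \<open>Mild solutions in Fourier variables\<close>

locale mild =
  fixes \<mu> :: real and v0 :: "functional^3" and v :: curve
  assumes mu_pos: "0 < \<mu>" and mild: "mild_solution \<mu> v0 v"
begin

lemma v0_space: "v0 \<in> space_X_minus1" and v_space: "v \<in> space_Y"
  using mild by (auto simp: mild_solution_def)

lemma v_time: "time_distribution v"
  using v_space by (simp add: space_Y_def space_calX_1_def)

lemma energy_sup_finite: "energy_sup (modulus v) < \<infinity>"
  and energy_int_finite: "energy_int (modulus v) < \<infinity>"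
  using v_space by (simp_all add: space_Y_def space_calX_1_def space_calX_minus1_def norm_calX_minus1_eq norm_calX_1_eq)

lemmas modulus_measurable [measurable] = measurable_modulus[OF v_time]

lemma conv_measurable [measurable]: "(\<lambda>s. conv (modulus v s) k) \<in> borel_measurable borel"
  by (rule measurable_conv) measurable

lemma conv_finite: "(\<integral>\<^sup>+k. (\<integral>\<^sup>+s. conv (modulus v s) k \<partial>lborel) \<partial>count_space UNIV) < \<infinity>"
proof -
  have "(\<integral>\<^sup>+k. (\<integral>\<^sup>+s. conv (modulus v s) k \<partial>lborel) \<partial>count_space UNIV) \<le> 2 * energy_sup (modulus v) * energy_int (modulus v)"
    by (rule nn_integral_conv_le) (auto simp: modulus_def[of _ _ 0])
  also have "\<dots> < \<infinity>"
    using energy_sup_finite energy_int_finite by (simp add: ennreal_mult_less_top)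
  finally show ?thesis .
qed

lemma AE_modulus: "AE s in lborel. \<forall>k. ennreal (norm (fourier_vec (restrict_pos v s) k)) = modulus v s k"
proof -
  have "AE s in lborel. 0 < s \<longrightarrow> fourier_vec (v s) 0 = 0"
    using v_space by (simp add: space_Y_def space_calX_minus1_def)
  moreover have "AE s in lborel. s \<noteq> (0::real)" by (rule AE_lborel_singleton)
  ultimately show ?thesis
  proof eventually_elim
    case (elim s)
    have "fourier_vec (\<chi> i. (\<lambda>\<phi>. 0)) k = 0" for k
      by (simp add: fourier_vec_def vec_eq_iff)
    then show ?case using elim by (auto simp: modulus_def restrict_pos_def)
  qed
qed

text \<open>
  A frequency other than \<open>0\<close> has length at least \<open>1\<close>, so the \<open>calX_1\<close> norm dominates the time
  integral of the sum of the moduli.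
\<close>

lemma AE_summable: "AE s in lborel. (\<integral>\<^sup>+k. ennreal (norm (fourier_vec (restrict_pos v s) k)) \<partial>count_space UNIV) < \<infinity>"
proof -
  have "(\<integral>\<^sup>+s. (\<integral>\<^sup>+k. modulus v s k * ennreal (norm (kvec k)) \<partial>count_space UNIV) \<partial>lborel) = energy_int (modulus v)"
    unfolding energy_int_def by (rule nn_integral_count_space_nn_integral) auto
  then have fin: "(\<integral>\<^sup>+s. (\<integral>\<^sup>+k. modulus v s k * ennreal (norm (kvec k)) \<partial>count_space UNIV) \<partial>lborel) \<noteq> \<infinity>"
    using energy_int_finite by simp
  have "(\<lambda>s. \<integral>\<^sup>+k. modulus v s k * ennreal (norm (kvec k)) \<partial>count_space UNIV) \<in> borel_measurable lborel"
  proof -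
    interpret sigma_finite_measure "count_space (UNIV :: (int^3) set)"
      by (rule sigma_finite_measure_count_space)
    have [measurable]: "(\<lambda>(s, k). modulus v s k * ennreal (norm (kvec k))) \<in> borel_measurable (lborel \<Otimes>\<^sub>M count_space UNIV)"
      by (rule measurable_countable_param) simp
    show ?thesis by measurable
  qed
  then have "AE s in lborel. (\<integral>\<^sup>+k. modulus v s k * ennreal (norm (kvec k)) \<partial>count_space UNIV) \<noteq> \<infinity>"
    by (rule nn_integral_noteq_infinite[OF _ fin])
  then show ?thesis using AE_modulus
  proof eventually_elim
    case (elim s)
    have "(\<integral>\<^sup>+k. modulus v s k \<partial>count_space UNIV) \<le> (\<integral>\<^sup>+k. modulus v s k * ennreal (norm (kvec k)) \<partial>count_space UNIV)"
    proof (rule nn_integral_mono)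
      fix k
      have "modulus v s k * 1 \<le> modulus v s k * ennreal (norm (kvec k))" if "k \<noteq> 0"
        using one_le_norm_kvec[OF that] by (intro mult_left_mono) auto
      then show "modulus v s k \<le> modulus v s k * ennreal (norm (kvec k))"
        by (cases "k = 0") (auto simp: modulus_def[of _ _ 0])
    qed
    then show ?case using elim by (simp add: top.not_eq_extremum order_le_less_trans)
  qed
qed

definition nonlin :: "3 \<Rightarrow> int^3 \<Rightarrow> real \<Rightarrow> complex" where
  "nonlin i k s = fourier_coeff (leray (div_tensor (restrict_pos v s)) $ i) k"

lemma nonlin_measurable [measurable]: "nonlin i k \<in> borel_measurable borel"
  unfolding nonlin_def[abs_def]
  by (rule measurable_fourier_coeff_leray_div_tensor) (rule measurable_fourier_coeff_restrict_pos[OF v_time])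

text \<open>
  At almost every time the velocity has mean zero and an absolutely convergent Fourier series, and
  then the bound for the nonlinearity applies.
\<close>

lemma AE_nonlin: "AE s in lborel. \<forall>i k. ennreal (norm (nonlin i k s)) \<le> ennreal (12 * norm (kvec k)) * conv (modulus v s) k"
  using AE_modulus AE_summable
proof eventually_elim
  case (elim s)
  show ?case
  proof (intro allI)
    fix i k
    let ?T = "\<lambda>(i, j). norm (fourier_coeff (tensor (restrict_pos v s) i j) k)"
    \<comment> \<open>The maximum is attained, so that it is bounded by the convolution even where that is infinite.\<close>
    define q where "q = Max (range ?T)"
    have fin: "finite (range ?T)" by simp
    have q: "norm (fourier_coeff (tensor (restrict_pos v s) i j) k) \<le> q" for i j
      unfolding q_def by (rule order.trans[OF _ Max_ge[OF fin rangeI[of ?T "(i, j)"]]]) simp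
    have "q \<in> range ?T" unfolding q_def by (rule Max_in) auto
    then obtain i' j' where "q = norm (fourier_coeff (tensor (restrict_pos v s) i' j') k)" by auto
    then have conv: "ennreal q \<le> conv (modulus v s) k"
      using norm_fourier_coeff_tensor_le[OF elim(2), of i' j' k] elim(1) by simp
    have "ennreal (norm (nonlin i k s)) \<le> ennreal (12 * norm (kvec k) * q)"
      unfolding nonlin_def by (intro ennreal_leI norm_fourier_coeff_leray_div_tensor_le q)
    also have "\<dots> = ennreal (12 * norm (kvec k)) * ennreal q"
      by (rule ennreal_mult') simp
    also have "\<dots> \<le> ennreal (12 * norm (kvec k)) * conv (modulus v s) k"
      by (rule mult_left_mono[OF conv]) simp
    finally show "ennreal (norm (nonlin i k s)) \<le> ennreal (12 * norm (kvec k)) * conv (modulus v s) k" .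
  qed
qed

definition duhamel_integrand :: "real \<Rightarrow> 3 \<Rightarrow> int^3 \<Rightarrow> real \<Rightarrow> complex" where
  "duhamel_integrand t i k s =
     indicator {0..t} s *\<^sub>R (of_real (exp (- (\<mu> * (t - s)) * (norm (kvec k))\<^sup>2)) * nonlin i k s)"

lemma duhamel_integrand_measurable [measurable]: "duhamel_integrand t i k \<in> borel_measurable borel"
  unfolding duhamel_integrand_def[abs_def] by measurable

lemma AE_duhamel_integrand:
  "AE s in lborel. \<forall>i k. ennreal (norm (duhamel_integrand t i k s))
      \<le> 12 * (ennreal (norm (kvec k)) * (heat_kernel \<mu> k (t - s) * conv (modulus v s) k))"
  using AE_nonlin
proof eventually_elim
  case (elim s)
  show ?case
  proof (intro allI)
    fix i k
    show "ennreal (norm (duhamel_integrand t i k s))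
      \<le> 12 * (ennreal (norm (kvec k)) * (heat_kernel \<mu> k (t - s) * conv (modulus v s) k))"
    proof (cases "0 \<le> s \<and> s \<le> t")
      case True
      have "ennreal (norm (duhamel_integrand t i k s))
          = heat_kernel \<mu> k (t - s) * ennreal (norm (nonlin i k s))"
        using True by (simp add: duhamel_integrand_def heat_kernel_def norm_mult ennreal_mult' mult_ac)
      also have "\<dots> \<le> heat_kernel \<mu> k (t - s) * (ennreal (12 * norm (kvec k)) * conv (modulus v s) k)"
        using elim by (intro mult_left_mono) auto
      finally show ?thesis by (simp add: ennreal_mult mult_ac)
    qed (auto simp: duhamel_integrand_def)
  qed
qed

lemma mild_series:
  assumes "0 \<le> t" "\<phi> \<in> test_functions"
  shows "(v t $ i) \<phi> =
     fourier_series (\<lambda>k. of_real (exp (- (\<mu> * t) * (norm (kvec k))\<^sup>2)) * fourier_coeff (v0 $ i) k) \<phi>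
     - (\<integral>s. fourier_series (\<lambda>k. duhamel_integrand t i k s) \<phi> \<partial>lborel)"
proof -
  let ?f = "\<lambda>s. indicator {0..t} s *\<^sub>R heat (\<mu> * (t - s)) (leray (div_tensor (v s)) $ i) \<phi>"
  let ?g = "\<lambda>s. fourier_series (\<lambda>k. duhamel_integrand t i k s) \<phi>"
  have g [measurable]: "?g \<in> borel_measurable borel"
    unfolding fourier_series_def by (rule measurable_infsum) measurable
  have eq: "?f s = ?g s" if "s \<noteq> 0" for s
    using that
    by (auto simp: heat_def fourier_multiplier_def fourier_series_def duhamel_integrand_def nonlin_def
        restrict_pos_def indicator_def)
  \<comment> \<open>A change at the single time \<open>0\<close> preserves Borel measurability, hence also the integral.\<close>
  have "?f = (\<lambda>s. if s = 0 then ?f 0 else ?g s)"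
    using eq by (auto simp: fun_eq_iff)
  then have [measurable]: "?f \<in> borel_measurable borel"
    by (simp only:) measurable
  have "(\<integral>s. ?f s \<partial>lborel) = (\<integral>s. ?g s \<partial>lborel)"
    using AE_lborel_singleton[of "0::real"] by (intro integral_cong_AE) (auto elim!: eventually_mono dest: eq)
  moreover have "(v t $ i) \<phi> = heat (\<mu> * t) (v0 $ i) \<phi> - (\<integral>s. ?f s \<partial>lborel)"
    using mild assms by (simp add: mild_solution_def set_lebesgue_integral_def)
  ultimately show ?thesis by (simp add: heat_def fourier_multiplier_def)
qed

lemma fourier_coeff_mild:
  assumes "0 \<le> t"
  shows "fourier_coeff (v t $ i) k = of_real (exp (- (\<mu> * t) * (norm (kvec k))\<^sup>2)) * fourier_coeff (v0 $ i) k
     - (\<integral>s. duhamel_integrand t i k s \<partial>lborel)"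
  using mild_series[OF assms torus_exp_in_test_functions, of i "- k"] fourier_series_torus_exp[of _ 1 k]
  by (simp add: fourier_coeff_def[of "v t $ i"] diff_divide_distrib)

text \<open>
  The constant \<open>36 = 3 * 12\<close>, and the factor \<open>3\<close> in front of the data, come from estimating the
  Euclidean norm of a coefficient by the sum of its three components.
\<close>

lemma duhamel_inequality:
  assumes "k \<noteq> 0"
  shows "modulus v t k \<le> heat_kernel \<mu> k t * ennreal (3 * norm (fourier_vec v0 k))
    + ennreal 36 * (\<integral>\<^sup>+s. ennreal (norm (kvec k)) * (heat_kernel \<mu> k (t - s) * conv (modulus v s) k) \<partial>lborel)"
proof (cases "0 \<le> t")
  case True
  let ?I = "\<integral>\<^sup>+s. ennreal (norm (kvec k)) * (heat_kernel \<mu> k (t - s) * conv (modulus v s) k) \<partial>lborel"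
  have comp: "ennreal (norm (fourier_coeff (v t $ i) k)) \<le> heat_kernel \<mu> k t * ennreal (norm (fourier_vec v0 k)) + 12 * ?I" for i
  proof -
    have "ennreal (norm (fourier_coeff (v t $ i) k))
        \<le> ennreal (norm (of_real (exp (- (\<mu> * t) * (norm (kvec k))\<^sup>2)) * fourier_coeff (v0 $ i) k)
           + norm (\<integral>s. duhamel_integrand t i k s \<partial>lborel))"
      unfolding fourier_coeff_mild[OF True] by (intro ennreal_leI norm_triangle_ineq4)
    also have "\<dots> = heat_kernel \<mu> k t * ennreal (norm (fourier_coeff (v0 $ i) k))
           + ennreal (norm (\<integral>s. duhamel_integrand t i k s \<partial>lborel))"
      using True by (simp add: heat_kernel_def norm_mult ennreal_mult' mult_ac)
    also have "\<dots> \<le> heat_kernel \<mu> k t * ennreal (norm (fourier_vec v0 k)) + 12 * ?I"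
    proof (intro add_mono mult_left_mono ennreal_leI norm_fourier_coeff_le_fourier_vec)
      have "ennreal (norm (\<integral>s. duhamel_integrand t i k s \<partial>lborel)) \<le> (\<integral>\<^sup>+s. ennreal (norm (duhamel_integrand t i k s)) \<partial>lborel)"
        by (cases "integrable lborel (duhamel_integrand t i k)")
           (simp_all add: integral_norm_bound_ennreal not_integrable_integral_eq)
      also have "\<dots> \<le> (\<integral>\<^sup>+s. 12 * (ennreal (norm (kvec k)) * (heat_kernel \<mu> k (t - s) * conv (modulus v s) k)) \<partial>lborel)"
        by (intro nn_integral_mono_AE eventually_mono[OF AE_duhamel_integrand[of t]]) blast
      also have "\<dots> = 12 * ?I" by (rule nn_integral_cmult) measurable
      finally show "ennreal (norm (\<integral>s. duhamel_integrand t i k s \<partial>lborel)) \<le> 12 * ?I" .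
    qed simp
    finally show ?thesis .
  qed
  have "modulus v t k \<le> ennreal (\<Sum>i\<in>UNIV. norm (fourier_coeff (v t $ i) k))"
    using L2_set_le_sum[of UNIV "\<lambda>i. norm (fourier_coeff (v t $ i) k)"]
    by (simp add: modulus_def True assms fourier_vec_def norm_vec_def ennreal_leI)
  also have "\<dots> = (\<Sum>i\<in>UNIV. ennreal (norm (fourier_coeff (v t $ i) k)))"
    by simp
  also have "\<dots> \<le> (\<Sum>i\<in>(UNIV::3 set). heat_kernel \<mu> k t * ennreal (norm (fourier_vec v0 k)) + 12 * ?I)"
    by (intro sum_mono comp)
  also have "\<dots> = heat_kernel \<mu> k t * ennreal (3 * norm (fourier_vec v0 k)) + ennreal 36 * ?I"
    by (simp add: ennreal_mult distrib_left mult_ac)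
  finally show ?thesis .
qed (simp add: modulus_def)

text \<open>
  Fubini's theorem in the mild formulation.  The double sum and integral converges absolutely:
  the nonlinearity is at most a multiple of \<open>\<bar>k\<bar>\<close> times the convolution, whose total mass is finite by
  the bilinear estimate, and the factor \<open>\<bar>k\<bar>\<close> is absorbed by the test function.
\<close>

lemma mild_eq_fourier_series:
  assumes t: "0 \<le> t" and \<phi>: "\<phi> \<in> test_functions"
  shows "(v t $ i) \<phi> = fourier_series (fourier_coeff (v t $ i)) \<phi>"
proof -
  let ?E = "\<lambda>k. regular_distribution (torus_exp k) \<phi>"
  obtain B where B: "\<And>x. x \<in> torus_cell \<Longrightarrow> norm (\<phi> x) \<le> B"
      "\<And>j x. x \<in> torus_cell \<Longrightarrow> norm (partial_deriv j \<phi> x) \<le> B" "0 \<le> B"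
    using test_function_bounds[OF \<phi>] by metis
  let ?B = "3 * (2 * pi) ^ 3 * B"
  have E: "norm (kvec k) * norm (?E k) \<le> ?B" for k
    using norm_kvec_times_regular_distribution_le[OF \<phi>, of B k] B by (simp add: mult.assoc)
  define a where "a k = of_real (exp (- (\<mu> * t) * (norm (kvec k))\<^sup>2)) * fourier_coeff (v0 $ i) k" for k
  have "(\<integral>\<^sup>+k. ennreal (norm (a k)) * ennreal (1 / norm (kvec k)) \<partial>count_space UNIV) \<le> norm_X_minus1 v0"
    unfolding norm_X_minus1_eq
  proof (intro nn_integral_mono mult_right_mono ennreal_leI)
    fix k
    have "norm (a k) \<le> 1 * norm (fourier_coeff (v0 $ i) k)"
      unfolding a_def norm_mult using mu_pos t by (intro mult_right_mono) auto
    then show "norm (a k) \<le> norm (fourier_vec v0 k)"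
      using norm_fourier_coeff_le_fourier_vec[of v0 i k] by simp
  qed simp
  then have suma: "(\<lambda>k. a k * ?E k) summable_on UNIV"
    using v0_space by (intro summable_fourier_series[OF \<phi>]) (auto simp: space_X_minus1_def intro: order_le_less_trans)
  have "(\<integral>\<^sup>+k. (\<integral>\<^sup>+s. ennreal (norm (duhamel_integrand t i k s * ?E k)) \<partial>lborel) \<partial>count_space UNIV)
     \<le> (\<integral>\<^sup>+k. (\<integral>\<^sup>+s. 12 * ennreal ?B * conv (modulus v s) k \<partial>lborel) \<partial>count_space UNIV)"
  proof (rule nn_integral_mono, rule nn_integral_mono_AE, rule eventually_mono[OF AE_duhamel_integrand[of t]])
    fix k s
    assume "\<forall>i k. ennreal (norm (duhamel_integrand t i k s))
      \<le> 12 * (ennreal (norm (kvec k)) * (heat_kernel \<mu> k (t - s) * conv (modulus v s) k))"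
    then have "ennreal (norm (duhamel_integrand t i k s)) * ennreal (norm (?E k))
      \<le> 12 * (ennreal (norm (kvec k)) * (heat_kernel \<mu> k (t - s) * conv (modulus v s) k)) * ennreal (norm (?E k))"
      by (intro mult_right_mono) auto
    also have "\<dots> = 12 * (ennreal (norm (kvec k) * norm (?E k)) * (heat_kernel \<mu> k (t - s) * conv (modulus v s) k))"
      by (simp add: ennreal_mult mult_ac)
    also have "\<dots> \<le> 12 * (ennreal ?B * (1 * conv (modulus v s) k))"
      using mu_pos by (intro mult_left_mono mult_mono mult_right_mono heat_kernel_le_1 ennreal_leI E) auto
    finally show "ennreal (norm (duhamel_integrand t i k s * ?E k)) \<le> 12 * ennreal ?B * conv (modulus v s) k"
      by (simp add: norm_mult ennreal_mult mult_ac)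
  qed
  also have "\<dots> = 12 * ennreal ?B * (\<integral>\<^sup>+k. (\<integral>\<^sup>+s. conv (modulus v s) k \<partial>lborel) \<partial>count_space UNIV)"
    by (simp add: nn_integral_cmult)
  also have "\<dots> < \<infinity>"
    using conv_finite by (simp add: ennreal_mult_less_top)
  finally have fin: "(\<integral>\<^sup>+k. (\<integral>\<^sup>+s. ennreal (norm (duhamel_integrand t i k s * ?E k)) \<partial>lborel) \<partial>count_space UNIV) < \<infinity>" .
  note swap = lborel.sigma_finite_measure_axioms _ fin
  have int: "(\<integral>s. duhamel_integrand t i k s * ?E k \<partial>lborel) = (\<integral>s. duhamel_integrand t i k s \<partial>lborel) * ?E k" for k
    by simp
  have sumb: "(\<lambda>k. (\<integral>s. duhamel_integrand t i k s \<partial>lborel) * ?E k) summable_on UNIV"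
    unfolding int[symmetric] by (rule summable_integral[OF swap]) measurable
  have "(\<integral>s. fourier_series (\<lambda>k. duhamel_integrand t i k s) \<phi> \<partial>lborel)
      = (\<Sum>\<^sub>\<infinity>k. (\<integral>s. duhamel_integrand t i k s \<partial>lborel) * ?E k)"
    unfolding int[symmetric] fourier_series_def by (rule integral_infsum[OF swap]) measurable
  then have "(v t $ i) \<phi> = (\<Sum>\<^sub>\<infinity>k. a k * ?E k) - (\<Sum>\<^sub>\<infinity>k. (\<integral>s. duhamel_integrand t i k s \<partial>lborel) * ?E k)"
    using mild_series[OF t \<phi>, of i] by (simp add: a_def fourier_series_def)
  also have "\<dots> = (\<Sum>\<^sub>\<infinity>k. a k * ?E k + - ((\<integral>s. duhamel_integrand t i k s \<partial>lborel) * ?E k))"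
    using suma sumb by (subst infsum_add) (simp_all only: infsum_uminus summable_on_uminus diff_conv_add_uminus)
  also have "\<dots> = fourier_series (fourier_coeff (v t $ i)) \<phi>"
    unfolding fourier_series_def fourier_coeff_mild[OF t] a_def[symmetric]
    by (intro infsum_cong) (simp add: algebra_simps)
  finally show ?thesis .
qed

end

section \<open>Holomorphic extension to a strip\<close>

text \<open>
  The bilinear product \<open>k \<cdot> z\<close>, without complex conjugation, so that it is holomorphic in \<open>z\<close>.
\<close>

definition kdot :: "int^3 \<Rightarrow> complex^3 \<Rightarrow> complex" where
  "kdot k z = (\<Sum>j\<in>UNIV. of_int (k $ j) * z $ j)"

lemma kdot_add: "kdot k (z + w) = kdot k z + kdot k w"
  by (simp add: kdot_def distrib_left sum.distrib)

lemma kdot_scale: "kdot k (c *s z) = c * kdot k z"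
  by (simp add: kdot_def sum_distrib_left mult_ac)

lemma norm_kdot_le: "norm (kdot k z) \<le> norm1 k * norm z"
proof -
  have "norm (kdot k z) \<le> (\<Sum>j\<in>UNIV. \<bar>real_of_int (k $ j)\<bar> * norm z)"
    unfolding kdot_def
    by (rule sum_norm_le) (auto simp: norm_mult intro!: mult_left_mono Finite_Cartesian_Product.norm_nth_le)
  then show ?thesis by (simp add: norm1_def sum_distrib_right)
qed

lemma norm_exp_kdot_le: "norm (exp (\<i> * kdot k z)) \<le> exp (norm1 k * norm (\<chi> j. Im (z $ j)))"
proof -
  have "\<bar>Im (kdot k z)\<bar> \<le> (\<Sum>j\<in>UNIV. \<bar>real_of_int (k $ j)\<bar> * norm (\<chi> j. Im (z $ j)))"
    unfolding kdot_def Im_sum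
  proof (rule order.trans[OF sum_abs], rule sum_mono)
    fix j
    have "\<bar>Im (z $ j)\<bar> \<le> norm (\<chi> j. Im (z $ j))"
      using component_le_norm_cart[of "\<chi> j. Im (z $ j)" j] by simp
    then show "\<bar>Im (of_int (k $ j) * z $ j)\<bar> \<le> \<bar>real_of_int (k $ j)\<bar> * norm (\<chi> j. Im (z $ j))"
      by (simp add: abs_mult mult_left_mono)
  qed
  then show ?thesis by (simp add: norm1_def sum_distrib_right abs_le_iff)
qed

lemma le_exp_scaled:
  fixes x \<delta> :: real
  assumes "0 < \<delta>"
  shows "x \<le> exp (\<delta> * x) / \<delta>"
proof -
  have "\<delta> * x \<le> exp (\<delta> * x)" using exp_ge_add_one_self[of "\<delta> * x"] by linarith
  then show ?thesis using assms by (simp add: field_simps)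
qed

lemma square_le_exp_scaled:
  fixes x \<delta> :: real
  assumes "0 < \<delta>" "0 \<le> x"
  shows "x\<^sup>2 \<le> 4 / \<delta>\<^sup>2 * exp (\<delta> * x)"
proof -
  have "x \<le> exp (\<delta> / 2 * x) / (\<delta> / 2)" using assms by (intro le_exp_scaled) simp
  then have "x\<^sup>2 \<le> (exp (\<delta> / 2 * x) / (\<delta> / 2))\<^sup>2" using assms by (intro power_mono)
  also have "\<dots> = 4 / \<delta>\<^sup>2 * exp (\<delta> * x)"
    by (simp add: power_divide flip: exp_double)
  finally show ?thesis .
qed

lemma norm_exp_minus_linear_le:
  fixes w :: complex
  shows "norm (exp w - 1 - w) \<le> exp (norm w) * (norm w)\<^sup>2"
proof -
  have "norm (exp w - (\<Sum>k\<le>1. w ^ k / fact k)) \<le> exp \<bar>Re w\<bar> * norm w ^ Suc 1 / fact 1"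
    by (rule Taylor_exp)
  also have "\<dots> \<le> exp (norm w) * (norm w)\<^sup>2"
    using abs_Re_le_cmod[of w] by (simp add: power2_eq_square mult_right_mono)
  finally show ?thesis by (simp add: algebra_simps)
qed

text \<open>
  The termwise derivative is verified directly.  For \<open>\<bar>h\<bar> \<le> \<delta>\<close> the \<open>k\<close>-th term deviates from its
  linearization at \<open>z\<close> by at most \<open>\<bar>c k\<bar> exp ((y + \<delta>) \<bar>k\<bar>\<^sub>1) \<bar>k\<bar>\<^sub>1\<^sup>2 \<bar>h\<bar>\<^sup>2\<close>, where \<open>y = \<bar>Im z\<bar>\<close>.
  A further \<open>\<delta>\<close> in the exponent pays for the factor \<open>\<bar>k\<bar>\<^sub>1\<^sup>2\<close>, and \<open>y + 2 \<delta> < R\<close> makes the sum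
  finite.
\<close>

lemma holomorphic_fourier_series:
  assumes sum: "\<And>r. r < R \<Longrightarrow> (\<lambda>k. norm (c k) * exp (r * norm1 k)) summable_on UNIV"
  shows "holomorphic3_on (\<lambda>z. \<Sum>\<^sub>\<infinity>k. c k * exp (\<i> * kdot k z)) (complex_strip R)"
  unfolding holomorphic3_on_def
proof
  fix z assume "z \<in> complex_strip R"
  define y where "y = norm (\<chi> j. Im (z $ j))"
  define \<delta> where "\<delta> = (R - y) / 3"
  have \<delta>: "0 < \<delta>" "y + 2 * \<delta> < R"
  proof -
    have "y < R" using \<open>z \<in> complex_strip R\<close> by (simp add: y_def complex_strip_def)
    then show "0 < \<delta>" by (simp add: \<delta>_def)
    show "y + 2 * \<delta> < R" using \<open>y < R\<close> unfolding \<delta>_def by (simp add: field_simps)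
  qed
  define F where "F z = (\<Sum>\<^sub>\<infinity>k. c k * exp (\<i> * kdot k z))" for z
  define D where "D h = (\<Sum>\<^sub>\<infinity>k. c k * exp (\<i> * kdot k z) * (\<i> * kdot k h))" for h
  define g where "g k = norm (c k) * exp ((y + 2 * \<delta>) * norm1 k)" for k
  have g: "g summable_on UNIV" unfolding g_def by (rule sum) fact
  define S where "S = infsum g UNIV"
  have ez: "norm (exp (\<i> * kdot k z)) \<le> exp (y * norm1 k)" for k
    using norm_exp_kdot_le[of k z] by (simp add: y_def mult.commute)
  have F_sum: "(\<lambda>k. c k * exp (\<i> * kdot k (z + h))) summable_on UNIV" if "norm h \<le> \<delta>" for h
  proof (rule summable_bound(1)[OF g])
    fix k
    have "norm (\<chi> j. Im ((z + h) $ j)) \<le> y + \<delta>"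
    proof -
      have "norm (\<chi> j. Im (h $ j)) \<le> norm h"
        unfolding norm_vec_def by (intro L2_set_mono) (auto simp: abs_Im_le_cmod)
      moreover have "(\<chi> j. Im ((z + h) $ j)) = (\<chi> j. Im (z $ j)) + (\<chi> j. Im (h $ j))"
        by (simp add: vec_eq_iff)
      ultimately show ?thesis
        using norm_triangle_ineq[of "\<chi> j. Im (z $ j)" "\<chi> j. Im (h $ j)"] that by (simp add: y_def)
    qed
    then have "norm1 k * norm (\<chi> j. Im ((z + h) $ j)) \<le> norm1 k * (y + 2 * \<delta>)"
      using \<delta> norm1_nonneg by (intro mult_left_mono) auto
    then have "norm (exp (\<i> * kdot k (z + h))) \<le> exp ((y + 2 * \<delta>) * norm1 k)"
      using norm_exp_kdot_le[of k "z + h"] by (simp add: mult.commute order.trans)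
    then show "norm (c k * exp (\<i> * kdot k (z + h))) \<le> g k"
      unfolding g_def norm_mult by (intro mult_left_mono) auto
  qed
  have D_term: "norm (c k * exp (\<i> * kdot k z) * (\<i> * kdot k h)) \<le> g k * (norm h / \<delta>)" for k h
  proof -
    have "norm (c k * exp (\<i> * kdot k z) * (\<i> * kdot k h)) \<le> norm (c k) * exp (y * norm1 k) * (norm1 k * norm h)"
    proof -
      have "norm (c k * exp (\<i> * kdot k z)) \<le> norm (c k) * exp (y * norm1 k)"
        unfolding norm_mult by (rule mult_left_mono[OF ez]) simp
      moreover have "norm (\<i> * kdot k h) \<le> norm1 k * norm h"
        using norm_kdot_le[of k h] by (simp add: norm_mult)
      ultimately show ?thesis
        unfolding norm_mult[of "c k * _"] by (rule mult_mono) auto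
    qed
    also have "\<dots> \<le> norm (c k) * exp (y * norm1 k) * ((exp (2 * \<delta> * norm1 k) / \<delta>) * norm h)"
    proof (intro mult_left_mono mult_right_mono)
      have "norm1 k \<le> exp (\<delta> * norm1 k) / \<delta>" by (rule le_exp_scaled) fact
      also have "\<dots> \<le> exp (2 * \<delta> * norm1 k) / \<delta>"
        using \<delta> norm1_nonneg[of k] by (intro divide_right_mono) auto
      finally show "norm1 k \<le> exp (2 * \<delta> * norm1 k) / \<delta>" .
    qed auto
    also have "\<dots> = g k * (norm h / \<delta>)"
      by (simp add: g_def distrib_right exp_add)
    finally show ?thesis .
  qed
  have D_sum: "(\<lambda>k. c k * exp (\<i> * kdot k z) * (\<i> * kdot k h)) summable_on UNIV" for h
    by (rule summable_bound(1)[OF summable_on_cmult_left[OF g] D_term])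
  have D_bound: "norm (D h) \<le> norm h * (S / \<delta>)" for h
    using summable_bound(2)[OF summable_on_cmult_left[OF g] D_term, of h]
    unfolding infsum_cmult_left' by (simp add: D_def S_def mult.commute)
  have D_add: "D (h + h') = D h + D h'" for h h'
    unfolding D_def using D_sum by (subst infsum_add[symmetric]) (auto simp: kdot_add distrib_left)
  have D_scale: "D (a *s h) = a * D h" for a h
    unfolding D_def infsum_cmult_right'[symmetric] by (simp add: kdot_scale mult_ac)
  have "bounded_linear D"
  proof (rule bounded_linear_intro[OF D_add _ D_bound])
    fix r :: real and h :: "complex^3"
    have "r *\<^sub>R h = complex_of_real r *s h" by (simp add: vec_eq_iff scaleR_conv_of_real[where 'a=complex])
    then show "D (r *\<^sub>R h) = r *\<^sub>R D h" by (simp add: D_scale scaleR_conv_of_real)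
  qed
  have quad: "norm (F (z + h) - F z - D h) \<le> S * (4 / \<delta>\<^sup>2) * (norm h)\<^sup>2" if h: "norm h \<le> \<delta>" for h
  proof -
    have "F (z + h) - F z - D h = (\<Sum>\<^sub>\<infinity>k. c k * exp (\<i> * kdot k (z + h)) + - (c k * exp (\<i> * kdot k (z + 0)))
        + - (c k * exp (\<i> * kdot k z) * (\<i> * kdot k h)))"
    proof -
      note s1 = F_sum[OF h]
      have s2: "(\<lambda>k. - (c k * exp (\<i> * kdot k (z + 0)))) summable_on UNIV"
        unfolding summable_on_uminus using F_sum[of 0] \<delta> by simp
      have s3: "(\<lambda>k. - (c k * exp (\<i> * kdot k z) * (\<i> * kdot k h))) summable_on UNIV"
        unfolding summable_on_uminus by (rule D_sum)
      show ?thesis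
        unfolding infsum_add[OF summable_on_add[OF s1 s2] s3] infsum_add[OF s1 s2] infsum_uminus
        by (simp add: F_def D_def)
    qed
    also have "\<dots> = (\<Sum>\<^sub>\<infinity>k. c k * exp (\<i> * kdot k z) * (exp (\<i> * kdot k h) - 1 - \<i> * kdot k h))"
      by (intro infsum_cong) (simp add: kdot_add exp_add algebra_simps)
    also have "norm \<dots> \<le> (\<Sum>\<^sub>\<infinity>k. g k * (4 / \<delta>\<^sup>2 * (norm h)\<^sup>2))"
    proof (rule summable_bound(2)[OF summable_on_cmult_left[OF g]])
      fix k
      have w: "norm (\<i> * kdot k h) \<le> norm1 k * norm h"
        using norm_kdot_le by (simp add: norm_mult)
      have "norm (exp (\<i> * kdot k h) - 1 - \<i> * kdot k h) \<le> exp (norm (\<i> * kdot k h)) * (norm (\<i> * kdot k h))\<^sup>2"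
        by (rule norm_exp_minus_linear_le)
      also have "\<dots> \<le> exp (norm1 k * norm h) * (norm1 k * norm h)\<^sup>2"
        using w by (intro mult_mono power_mono) auto
      also have "\<dots> \<le> exp (\<delta> * norm1 k) * (norm1 k * norm h)\<^sup>2"
        using mult_left_mono[OF h norm1_nonneg[of k]] by (intro mult_right_mono) (auto simp: mult.commute)
      also have "\<dots> \<le> exp (\<delta> * norm1 k) * (4 / \<delta>\<^sup>2 * exp (\<delta> * norm1 k) * (norm h)\<^sup>2)"
        unfolding power_mult_distrib
        by (intro mult_left_mono mult_right_mono square_le_exp_scaled \<delta> norm1_nonneg) auto
      finally have "norm (c k) * norm (exp (\<i> * kdot k z)) * norm (exp (\<i> * kdot k h) - 1 - \<i> * kdot k h)
          \<le> norm (c k) * exp (y * norm1 k) * (exp (\<delta> * norm1 k) * (4 / \<delta>\<^sup>2 * exp (\<delta> * norm1 k) * (norm h)\<^sup>2))"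
        using ez[of k] by (intro mult_mono) auto
      also have "\<dots> = g k * (4 / \<delta>\<^sup>2 * (norm h)\<^sup>2)"
      proof -
        have "exp ((y + 2 * \<delta>) * norm1 k) = exp (y * norm1 k) * (exp (\<delta> * norm1 k) * exp (\<delta> * norm1 k))"
          by (simp add: exp_add[symmetric] algebra_simps)
        then show ?thesis by (simp add: g_def)
      qed
      finally show "norm (c k * exp (\<i> * kdot k z) * (exp (\<i> * kdot k h) - 1 - \<i> * kdot k h)) \<le> g k * (4 / \<delta>\<^sup>2 * (norm h)\<^sup>2)"
        by (simp add: norm_mult)
    qed
    also have "\<dots> = S * (4 / \<delta>\<^sup>2) * (norm h)\<^sup>2"
      unfolding infsum_cmult_left' S_def by simp
    finally show ?thesis .
  qed
  have "(F has_derivative D) (at z)"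
  proof (rule has_derivativeI_sandwich[OF \<delta>(1) \<open>bounded_linear D\<close>])
    fix w assume w: "w \<noteq> z" "dist w z < \<delta>"
    have "norm (F w - F z - D (w - z)) \<le> S * (4 / \<delta>\<^sup>2) * (norm (w - z))\<^sup>2"
      using quad[of "w - z"] w by (simp add: dist_norm)
    then show "norm (F w - F z - D (w - z)) / norm (w - z) \<le> S * (4 / \<delta>\<^sup>2) * norm (w - z)"
      using w by (simp add: power2_eq_square field_simps)
  next
    have "((\<lambda>w. S * (4 / \<delta>\<^sup>2) * norm (w - z)) \<longlongrightarrow> S * (4 / \<delta>\<^sup>2) * norm (z - z)) (at z)"
      by (intro tendsto_intros)
    then show "((\<lambda>w. S * (4 / \<delta>\<^sup>2) * norm (w - z)) \<longlongrightarrow> 0) (at z)" by simp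
  qed
  then show "\<exists>D. ((\<lambda>z. \<Sum>\<^sub>\<infinity>k. c k * exp (\<i> * kdot k z)) has_derivative D) (at z) \<and> (\<forall>c w. D (c *s w) = c * D w)"
    unfolding F_def[abs_def] using D_scale by blast
qed

lemma exp_kdot_of_real: "exp (\<i> * kdot k (of_real_vec x)) = torus_exp k x"
proof -
  have "kdot k (of_real_vec x) = of_real (kvec k \<bullet> x)"
    by (simp add: kdot_def of_real_vec_def inner_vec_def kvec_def)
  then show ?thesis by (simp add: torus_exp_def cis_conv_exp)
qed

lemma extends_to_strip_fourier_series:
  assumes "0 < R" and sum: "\<And>r. r < R \<Longrightarrow> (\<lambda>k. norm (c k) * exp (r * norm1 k)) summable_on UNIV"
    and T: "\<And>\<phi>. \<phi> \<in> test_functions \<Longrightarrow> T \<phi> = fourier_series c \<phi>"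
  shows "extends_to_strip T R"
proof -
  define F where "F z = (\<Sum>\<^sub>\<infinity>k. c k * exp (\<i> * kdot k z))" for z
  have F: "F (of_real_vec x) = (\<Sum>\<^sub>\<infinity>k. c k * torus_exp k x)" for x
    by (simp add: F_def exp_kdot_of_real)
  have "holomorphic3_on F (complex_strip R)"
    unfolding F_def[abs_def] by (rule holomorphic_fourier_series[OF sum])
  moreover have "periodic (\<lambda>x. F (of_real_vec x))"
    using torus_exp_in_test_functions unfolding F by (simp add: test_functions_def periodic_def)
  moreover have "T \<phi> = regular_distribution (\<lambda>x. F (of_real_vec x)) \<phi>" if \<phi>: "\<phi> \<in> test_functions" for \<phi>
  proof -
    obtain B where B: "\<And>x. x \<in> torus_cell \<Longrightarrow> norm (\<phi> x) \<le> B" "0 \<le> B"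
      using test_function_bounds[OF \<phi>] by metis
    have "(\<lambda>k. norm (c k)) summable_on UNIV" using sum[OF \<open>0 < R\<close>] by simp
    then have "c summable_on UNIV" by (simp add: summable_on_iff_abs_summable_on_complex)
    then have "regular_distribution (\<lambda>x. \<Sum>\<^sub>\<infinity>k. c k * torus_exp k x) \<phi> = fourier_series c \<phi>"
      unfolding summable_on_iff_nn_integral_finite
      by (rule regular_distribution_series[OF _ borel_measurable_continuous_onI[OF test_functionD(4)[OF \<phi>]] B])
    then show ?thesis unfolding F T[OF \<phi>] ..
  qed
  ultimately show ?thesis unfolding extends_to_strip_def by blast
qed

section \<open>The weighted solution\<close>

text \<open>
  A distribution of order at most one, by the decay of the coefficients of test functions.
\<close>

lemma torus_distribution_fourier_series:
  assumes fin: "(\<integral>\<^sup>+k. ennreal (norm (c k)) * ennreal (1 / norm (kvec k)) \<partial>count_space UNIV) < \<infinity>"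
  shows "torus_distribution (fourier_series c)"
proof -
  let ?W = "ennreal (norm (c 0)) + (\<integral>\<^sup>+k. ennreal (norm (c k)) * ennreal (1 / norm (kvec k)) \<partial>count_space UNIV)"
  have W: "?W = ennreal (enn2real ?W)" using fin by simp
  have add: "fourier_series c (\<lambda>x. \<phi> x + \<psi> x) = fourier_series c \<phi> + fourier_series c \<psi>"
    if "\<phi> \<in> test_functions" "\<psi> \<in> test_functions" for \<phi> \<psi>
  proof -
    have "regular_distribution (torus_exp k) (\<lambda>x. \<phi> x + \<psi> x)
        = regular_distribution (torus_exp k) \<phi> + regular_distribution (torus_exp k) \<psi>" for k
    proof -
      have "set_integrable lborel torus_cell (\<lambda>x. torus_exp k x * \<phi> x)"
        "set_integrable lborel torus_cell (\<lambda>x. torus_exp k x * \<psi> x)"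
        using test_functionD(4) that by (auto intro!: set_integrable_torus_cell continuous_intros)
      then show ?thesis
        unfolding regular_distribution_def distrib_left by (rule set_integral_add(2))
    qed
    then show ?thesis
      unfolding fourier_series_def
      using summable_fourier_series[OF that(1) fin] summable_fourier_series[OF that(2) fin]
      by (subst infsum_add[symmetric]) (auto simp: distrib_left)
  qed
  have scale: "fourier_series c (\<lambda>x. a * \<phi> x) = a * fourier_series c \<phi>" for a \<phi>
    unfolding fourier_series_def regular_distribution_scale infsum_cmult_right'[symmetric]
    by (simp add: mult_ac)
  have bound: "norm (fourier_series c \<phi>) \<le> (3 * (2 * pi) ^ 3 * enn2real ?W) * B"
    if \<phi>: "\<phi> \<in> test_functions" and B: "\<And>js x. length js \<le> 1 \<Longrightarrow> norm (foldr partial_deriv js \<phi> x) \<le> B" for \<phi> B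
  proof -
    have B': "norm (\<phi> x) \<le> B" "norm (partial_deriv j \<phi> x) \<le> B" for x j
      using B[of "[]" x] B[of "[j]" x] by auto
    have B0: "0 \<le> B" using B'(1)[of 0] norm_ge_zero order_trans by blast
    have "ennreal (norm (fourier_series c \<phi>))
        \<le> (\<integral>\<^sup>+k. ennreal (norm (c k * regular_distribution (torus_exp k) \<phi>)) \<partial>count_space UNIV)"
      unfolding fourier_series_def by (rule norm_infsum_le_nn_integral)
    also have "\<dots> \<le> ennreal (3 * (2 * pi) ^ 3 * B) * ?W"
      by (rule fourier_series_abs_bound[OF \<phi> B' B0])
    also have "\<dots> = ennreal ((3 * (2 * pi) ^ 3 * enn2real ?W) * B)"
      using B0 by (subst W, subst ennreal_mult[symmetric]) (auto simp: mult_ac)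
    finally show ?thesis using B0 by (subst (asm) ennreal_le_iff) auto
  qed
  show ?thesis
    unfolding torus_distribution_def using add scale bound
    by (intro conjI ballI allI exI[of _ 1] exI[of _ "3 * (2 * pi) ^ 3 * enn2real ?W"] impI) auto
qed

lemma fourier_coeff_exp_absD:
  "fourier_coeff (exp_absD \<rho> v t $ i) k = of_real (exp (\<rho> t * norm1 k)) * fourier_coeff (v t $ i) k"
  by (simp add: exp_absD_def fourier_multiplier_def norm1_def)

lemma modulus_exp_absD: "modulus (exp_absD \<rho> v) = gevrey \<rho> (modulus v)"
proof (intro ext)
  fix t k
  have "fourier_vec (exp_absD \<rho> v t) k = exp (\<rho> t * norm1 k) *\<^sub>R fourier_vec (v t) k"
    unfolding vec_eq_iff
    by (simp add: fourier_vec_def fourier_coeff_exp_absD scaleR_conv_of_real[where 'a=complex])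
  then show "modulus (exp_absD \<rho> v) t k = gevrey \<rho> (modulus v) t k"
    by (simp add: modulus_def gevrey_def ennreal_mult)
qed

lemma norm_fourier_coeff_le_energy_sup:
  assumes "0 \<le> t"
  shows "(\<integral>\<^sup>+k. ennreal (norm (fourier_coeff (u t $ i) k)) * ennreal (1 / norm (kvec k)) \<partial>count_space UNIV)
    \<le> energy_sup (modulus u)"
  unfolding energy_sup_def
proof (rule nn_integral_mono)
  fix k
  have "ennreal (norm (fourier_coeff (u t $ i) k)) * ennreal (1 / norm (kvec k)) \<le> modulus u t k * ennreal (1 / norm (kvec k))"
    using assms norm_fourier_coeff_le_fourier_vec[of "u t" i k]
    by (cases "k = 0") (auto simp: modulus_def intro!: mult_right_mono ennreal_leI)
  also have "\<dots> \<le> (SUP t. modulus u t k * ennreal (1 / norm (kvec k)))"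
    by (rule SUP_upper) simp
  finally show "ennreal (norm (fourier_coeff (u t $ i) k)) * ennreal (1 / norm (kvec k))
     \<le> (SUP t. modulus u t k * ennreal (1 / norm (kvec k)))" .
qed

text \<open>
  At almost every positive time the mean vanishes and the pairing with a test function is bounded by
  a multiple of the \<open>calX_minus1\<close> norm, hence integrable on bounded intervals.
\<close>

lemma time_distribution_exp_absD:
  assumes v: "time_distribution v" and [measurable]: "\<rho> \<in> borel_measurable borel"
    and mean: "AE t in lborel. 0 < t \<longrightarrow> fourier_vec (v t) 0 = 0"
    and fin: "energy_sup (modulus (exp_absD \<rho> v)) < \<infinity>"
  shows "time_distribution (exp_absD \<rho> v)"
proof -
  let ?u = "exp_absD \<rho> v"
  have u: "(?u t $ i) = fourier_series (fourier_coeff (?u t $ i))" for t i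
  proof -
    have "(?u t $ i) = fourier_series (\<lambda>k. of_real (exp (\<rho> t * norm1 k)) * fourier_coeff (v t $ i) k)"
      by (simp add: exp_absD_def fourier_multiplier_def norm1_def)
    moreover have "fourier_coeff (?u t $ i) = (\<lambda>k. of_real (exp (\<rho> t * norm1 k)) * fourier_coeff (v t $ i) k)"
      by (rule ext) (rule fourier_coeff_exp_absD)
    ultimately show ?thesis by (simp only:)
  qed
  have distr: "torus_distribution (?u t $ i)" if "0 \<le> t" for t i
    by (subst u, rule torus_distribution_fourier_series,
        rule order_le_less_trans[OF norm_fourier_coeff_le_energy_sup[OF that] fin])
  have int: "set_integrable lborel {a..b} (\<lambda>t. (?u t $ i) \<phi>)"
    if \<phi>: "\<phi> \<in> test_functions" and ab: "0 < a" for i \<phi> a b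
  proof -
    obtain B where B: "\<And>x. x \<in> torus_cell \<Longrightarrow> norm (\<phi> x) \<le> B"
        "\<And>j x. x \<in> torus_cell \<Longrightarrow> norm (partial_deriv j \<phi> x) \<le> B" "0 \<le> B"
      using test_function_bounds[OF \<phi>] by metis
    define M where "M = enn2real (ennreal (3 * (2 * pi) ^ 3 * B) * energy_sup (modulus ?u))"
    have M: "ennreal (3 * (2 * pi) ^ 3 * B) * energy_sup (modulus ?u) = ennreal M"
      using fin by (simp add: M_def ennreal_mult_less_top)
    have bound: "norm ((?u t $ i) \<phi>) \<le> M" if t: "0 < t" "fourier_vec (v t) 0 = 0" for t
    proof -
      have zero: "fourier_coeff (?u t $ i) 0 = 0"
        using t by (simp add: fourier_coeff_exp_absD fourier_vec_def vec_eq_iff)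
      have "ennreal (norm ((?u t $ i) \<phi>))
          \<le> (\<integral>\<^sup>+k. ennreal (norm (fourier_coeff (?u t $ i) k * regular_distribution (torus_exp k) \<phi>)) \<partial>count_space UNIV)"
        by (subst u, subst fourier_series_def, rule norm_infsum_le_nn_integral)
      also have "\<dots> \<le> ennreal (3 * (2 * pi) ^ 3 * B) * (ennreal (norm (fourier_coeff (?u t $ i) 0))
          + (\<integral>\<^sup>+k. ennreal (norm (fourier_coeff (?u t $ i) k)) * ennreal (1 / norm (kvec k)) \<partial>count_space UNIV))"
        by (rule fourier_series_abs_bound[OF \<phi> B])
      also have "\<dots> \<le> ennreal (3 * (2 * pi) ^ 3 * B) * energy_sup (modulus ?u)"
        using norm_fourier_coeff_le_energy_sup[of t ?u i] t zero by (intro mult_left_mono) auto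
      finally show ?thesis unfolding M by (subst (asm) ennreal_le_iff) (auto simp: M_def)
    qed
    note [measurable] = measurable_fourier_coeff_restrict_pos[OF v]
    have meas: "(\<lambda>t. indicator {a..b} t *\<^sub>R (?u t $ i) \<phi>) \<in> borel_measurable lborel"
    proof -
      have "(\<lambda>t. indicator {a..b} t *\<^sub>R (?u t $ i) \<phi>)
          = (\<lambda>t. indicator {a..b} t *\<^sub>R (\<Sum>\<^sub>\<infinity>k. of_real (exp (\<rho> t * norm1 k))
              * fourier_coeff (restrict_pos v t $ i) k * regular_distribution (torus_exp k) \<phi>))"
        using ab by (subst u) (auto simp: fun_eq_iff fourier_series_def fourier_coeff_exp_absD restrict_pos_def indicator_def)
      moreover have "(\<lambda>t. \<Sum>\<^sub>\<infinity>k. of_real (exp (\<rho> t * norm1 k))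
              * fourier_coeff (restrict_pos v t $ i) k * regular_distribution (torus_exp k) \<phi>) \<in> borel_measurable borel"
        by (rule measurable_infsum) measurable
      ultimately show ?thesis by simp
    qed
    show ?thesis
      unfolding set_integrable_def
    proof (rule integrableI_bounded_set[where A="{a..b}" and B=M])
      show "AE t in lborel. t \<in> {a..b} \<longrightarrow> norm (indicator {a..b} t *\<^sub>R (?u t $ i) \<phi>) \<le> M"
        using mean by eventually_elim (use bound ab in auto)
    qed (use meas in \<open>auto simp: emeasure_lborel_Icc_eq\<close>)
  qed
  show ?thesis unfolding time_distribution_def using distr int by blast
qed

text \<open>
  The constant in the smallness condition is \<open>864 = 8 * 36 * 3\<close>: the numerical factor of
  \<open>gevrey_energy_bound\<close>, the constant of the Duhamel inequality, and the factor of the data in it.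
\<close>

locale mild_gevrey = mild \<mu> v0 v + gevrey_gain \<mu> \<beta> b \<rho> for \<mu> v0 v \<beta> b \<rho> +
  fixes K n0 D c :: real
  assumes bound: "norm_Y v \<le> ennreal K * norm_X_minus1 v0"
    and data: "norm_X_minus1 v0 = ennreal n0" "0 \<le> n0"
    and D: "D = exp b * (1 + 1 / \<beta>)" and c: "2 * D \<le> c" "0 < K" "K \<le> c"
    and small: "864 * D * c * n0 \<le> 1"
begin

lemma norm_exp_absD: "norm_Y (exp_absD \<rho> v) \<le> ennreal (3 * c * n0)"
proof -
  have "energy_sup (gevrey \<rho> (modulus v)) + energy_int (gevrey \<rho> (modulus v)) \<le> ennreal (c * (3 * n0))"
  proof (rule gevrey_energy_bound[where A=36 and K=K and D=D and e="3 * n0"])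
    show "(\<integral>\<^sup>+k. ennreal (3 * norm (fourier_vec v0 k)) * ennreal (1 / norm (kvec k)) \<partial>count_space UNIV) = ennreal (3 * n0)"
    proof -
      have "(\<integral>\<^sup>+k. ennreal (3 * norm (fourier_vec v0 k)) * ennreal (1 / norm (kvec k)) \<partial>count_space UNIV)
          = (\<integral>\<^sup>+k. 3 * (ennreal (norm (fourier_vec v0 k)) * ennreal (1 / norm (kvec k))) \<partial>count_space UNIV)"
        by (intro nn_integral_cong) (simp add: ennreal_mult mult.assoc)
      also have "\<dots> = 3 * norm_X_minus1 v0"
        unfolding norm_X_minus1_eq by (rule nn_integral_cmult) simp
      finally show ?thesis by (simp add: data ennreal_mult)
    qed
    have "energy_sup (modulus v) + energy_int (modulus v) \<le> ennreal (K * n0)"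
      using bound data c by (simp add: norm_Y_eq ennreal_mult)
    also have "\<dots> \<le> ennreal (K * (3 * n0))" using data c by (intro ennreal_leI mult_left_mono) auto
    finally show "energy_sup (modulus v) + energy_int (modulus v) \<le> ennreal (K * (3 * n0))" .
    show "(\<lambda>t. modulus v t k) \<in> borel_measurable lborel" for k by simp
    show "modulus v t 0 = 0" for t by (simp add: modulus_def)
    show "modulus v t k = 0" if "t < 0" for t k using that by (simp add: modulus_def)
    show "modulus v t k \<le> heat_kernel \<mu> k t * ennreal (3 * norm (fourier_vec v0 k))
      + ennreal 36 * (\<integral>\<^sup>+s. ennreal (norm (kvec k)) * (heat_kernel \<mu> k (t - s) * conv (modulus v s) k) \<partial>lborel)"
      if "k \<noteq> 0" for t k by (rule duhamel_inequality[OF that])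
  qed (use small data c D in auto)
  then show ?thesis by (simp add: norm_Y_eq modulus_exp_absD mult_ac)
qed

lemma energy_exp_absD_finite:
  "energy_sup (modulus (exp_absD \<rho> v)) < \<infinity>" "energy_int (modulus (exp_absD \<rho> v)) < \<infinity>"
  using order_le_less_trans[OF norm_exp_absD ennreal_less_top] by (auto simp: norm_Y_eq)

lemma mean_zero: "AE t in lborel. 0 < t \<longrightarrow> fourier_vec (v t) 0 = 0"
  using v_space by (simp add: space_Y_def space_calX_minus1_def)

lemma exp_absD_space_Y: "exp_absD \<rho> v \<in> space_Y"
proof -
  have "time_distribution (exp_absD \<rho> v)"
    by (rule time_distribution_exp_absD[OF v_time rho_measurable mean_zero energy_exp_absD_finite(1)])
  moreover have "AE t in lborel. 0 < t \<longrightarrow> fourier_vec (exp_absD \<rho> v t) 0 = 0"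
    using mean_zero by eventually_elim (simp add: fourier_vec_def vec_eq_iff fourier_coeff_exp_absD)
  ultimately show ?thesis
    using energy_exp_absD_finite
    by (simp add: space_Y_def space_calX_minus1_def space_calX_1_def norm_calX_minus1_eq norm_calX_1_eq)
qed

text \<open>
  Any loss \<open>\<delta> = \<rho>(t) - r\<close> in the exponent absorbs the factor \<open>\<bar>k\<bar>\<close> by which the norm of
  \<open>calX_minus1\<close> falls short of absolute summability.
\<close>

lemma extends_to_strip_rho:
  assumes t: "0 \<le> t" "0 < \<rho> t"
  shows "extends_to_strip (v t $ i) (\<rho> t)"
proof (rule extends_to_strip_fourier_series[OF t(2) _ mild_eq_fourier_series[OF t(1)]])
  fix r assume r: "r < \<rho> t"
  let ?a = "\<lambda>k. fourier_coeff (v t $ i) k"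
  define \<delta> where "\<delta> = \<rho> t - r"
  have \<delta>: "0 < \<delta>" using r by (simp add: \<delta>_def)
  have "(\<integral>\<^sup>+k. ennreal (norm (?a k * of_real (exp (r * norm1 k)))) \<partial>count_space UNIV)
     \<le> (\<integral>\<^sup>+k. ennreal (norm (?a 0)) * indicator {0} k
        + ennreal (1 / \<delta>) * (ennreal (norm (fourier_coeff (exp_absD \<rho> v t $ i) k)) * ennreal (1 / norm (kvec k))) \<partial>count_space UNIV)"
  proof (rule nn_integral_mono)
    fix k
    show "ennreal (norm (?a k * of_real (exp (r * norm1 k))))
     \<le> ennreal (norm (?a 0)) * indicator {0} k
        + ennreal (1 / \<delta>) * (ennreal (norm (fourier_coeff (exp_absD \<rho> v t $ i) k)) * ennreal (1 / norm (kvec k)))"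
    proof (cases "k = 0")
      case False
      have n: "0 < norm (kvec k)" using False by simp
      have "norm (kvec k) \<le> exp (\<delta> * norm1 k) / \<delta>"
        using norm_kvec_le_norm1[of k] le_exp_scaled[OF \<delta>, of "norm1 k"] by simp
      then have "exp (r * norm1 k) * norm (kvec k) \<le> exp (r * norm1 k) * (exp (\<delta> * norm1 k) / \<delta>)"
        by (intro mult_left_mono) auto
      also have "\<dots> = exp (\<rho> t * norm1 k) / \<delta>"
        by (simp add: exp_add[symmetric] \<delta>_def algebra_simps)
      finally have "exp (r * norm1 k) \<le> (exp (\<rho> t * norm1 k) / \<delta>) / norm (kvec k)"
        using n by (simp only: pos_le_divide_eq)
      then have "exp (r * norm1 k) \<le> 1 / \<delta> * exp (\<rho> t * norm1 k) * (1 / norm (kvec k))"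
        by simp
      then have "norm (?a k) * exp (r * norm1 k) \<le> norm (?a k) * (1 / \<delta> * exp (\<rho> t * norm1 k) * (1 / norm (kvec k)))"
        by (rule mult_left_mono) simp
      also have "\<dots> = 1 / \<delta> * (norm (fourier_coeff (exp_absD \<rho> v t $ i) k) * (1 / norm (kvec k)))"
        by (simp add: fourier_coeff_exp_absD norm_mult)
      finally have "ennreal (norm (?a k * of_real (exp (r * norm1 k))))
          \<le> ennreal (1 / \<delta> * (norm (fourier_coeff (exp_absD \<rho> v t $ i) k) * (1 / norm (kvec k))))"
        by (intro ennreal_leI) (simp add: norm_mult)
      also have "\<dots> = ennreal (1 / \<delta>) * (ennreal (norm (fourier_coeff (exp_absD \<rho> v t $ i) k)) * ennreal (1 / norm (kvec k)))"
        using \<delta> by (simp only: ennreal_mult divide_nonneg_nonneg zero_le_one norm_ge_zero less_imp_le mult_nonneg_nonneg)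
      finally show ?thesis using False by simp
    qed (simp add: norm1_def)
  qed
  also have "\<dots> = (\<integral>\<^sup>+k. ennreal (norm (?a 0)) * indicator {0::int^3} k \<partial>count_space UNIV)
     + ennreal (1 / \<delta>) * (\<integral>\<^sup>+k. ennreal (norm (fourier_coeff (exp_absD \<rho> v t $ i) k)) * ennreal (1 / norm (kvec k)) \<partial>count_space UNIV)"
    by (subst nn_integral_add) (auto simp: nn_integral_cmult)
  also have "\<dots> < \<infinity>"
    using order_le_less_trans[OF norm_fourier_coeff_le_energy_sup[OF t(1)] energy_exp_absD_finite(1)]
    by (simp add: nn_integral_indicator_singleton ennreal_mult_less_top)
  finally have "(\<lambda>k. ?a k * of_real (exp (r * norm1 k))) summable_on UNIV"
    by (simp only: summable_on_iff_nn_integral_finite)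
  then show "(\<lambda>k. norm (?a k) * exp (r * norm1 k)) summable_on UNIV"
    by (simp add: summable_on_iff_abs_summable_on_complex norm_mult)
qed

lemma analyticity_radius_ge:
  assumes "0 \<le> t" "0 < \<rho> t"
  shows "ereal (\<rho> t) \<le> analyticity_radius (v t)"
  unfolding analyticity_radius_def using assms extends_to_strip_rho by (intro Sup_upper) blast

end

section \<open>Analyticity of small mild solutions\<close>

theorem theorem2:
  fixes \<mu> \<epsilon>1 K :: real
  assumes "\<mu> > 0"
    and "small_data_wellposed \<mu> \<epsilon>1 K"
  shows "\<forall>\<alpha>::real. 0 < \<alpha> \<and> \<alpha> < 1 \<longrightarrow>
    (\<exists>\<epsilon>0 C. 0 < \<epsilon>0 \<and> \<epsilon>0 \<le> \<epsilon>1 \<and> 0 < C \<and>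
      (\<forall>v0\<in>space_X_minus1. norm_X_minus1 v0 < ennreal \<epsilon>0 \<longrightarrow>
        (\<forall>v. bounded_mild_solution \<mu> K v0 v \<longrightarrow>
          (\<forall>t>0. analyticity_radius (v t) \<ge> ereal (max (\<mu> * sqrt t) (\<alpha> * \<mu> * t))) \<and>
          exp_absD (\<lambda>t. \<mu> * sqrt t) v \<in> space_Y \<and>
          exp_absD (\<lambda>t. \<alpha> * \<mu> * t) v \<in> space_Y \<and>
          norm_Y (exp_absD (\<lambda>t. \<mu> * sqrt t) v) + norm_Y (exp_absD (\<lambda>t. \<alpha> * \<mu> * t) v)
            \<le> ennreal C * norm_X_minus1 v0)))"
proof (intro allI impI, elim conjE)
  fix \<alpha> :: real assume \<alpha>: "0 < \<alpha>" "\<alpha> < 1"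
  have K: "0 < K" and \<epsilon>1: "0 < \<epsilon>1" using assms(2) by (auto simp: small_data_wellposed_def)
  define D1 where "D1 = exp (3 / 2 * \<mu>) * (1 + 1 / (\<mu> / 2))"
  define D2 where "D2 = exp 0 * (1 + 1 / ((1 - \<alpha>) * \<mu>))"
  define c1 where "c1 = max (2 * D1) K"
  define c2 where "c2 = max (2 * D2) K"
  have pos: "0 < D1" "0 < D2" "0 < c1" "0 < c2"
    using assms(1) \<alpha> K by (auto simp: D1_def D2_def c1_def c2_def less_max_iff_disj intro!: add_pos_nonneg mult_pos_pos)
  define \<epsilon>0 where "\<epsilon>0 = min \<epsilon>1 (min (1 / (864 * D1 * c1)) (1 / (864 * D2 * c2)))"
  define C where "C = 3 * c1 + 3 * c2"
  have main: "(\<forall>t>0. analyticity_radius (v t) \<ge> ereal (max (\<mu> * sqrt t) (\<alpha> * \<mu> * t))) \<and>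
          exp_absD (\<lambda>t. \<mu> * sqrt t) v \<in> space_Y \<and>
          exp_absD (\<lambda>t. \<alpha> * \<mu> * t) v \<in> space_Y \<and>
          norm_Y (exp_absD (\<lambda>t. \<mu> * sqrt t) v) + norm_Y (exp_absD (\<lambda>t. \<alpha> * \<mu> * t) v)
            \<le> ennreal C * norm_X_minus1 v0"
    if small: "norm_X_minus1 v0 < ennreal \<epsilon>0" and v: "bounded_mild_solution \<mu> K v0 v" for v0 v
  proof -
    define n0 where "n0 = enn2real (norm_X_minus1 v0)"
    have n0: "norm_X_minus1 v0 = ennreal n0" "0 \<le> n0"
      using less_trans[OF small ennreal_less_top] by (auto simp: n0_def)
    have "n0 < \<epsilon>0" using small n0 by (simp add: ennreal_less_iff)
    then have le: "n0 \<le> 1 / (864 * D1 * c1)" "n0 \<le> 1 / (864 * D2 * c2)" by (auto simp: \<epsilon>0_def)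
    have small1: "864 * D1 * c1 * n0 \<le> 1" "864 * D2 * c2 * n0 \<le> 1"
      using le pos by (auto simp: field_simps)
    interpret mild \<mu> v0 v
      using assms(1) v by unfold_locales (auto simp: bounded_mild_solution_def)
    have bd: "norm_Y v \<le> ennreal K * norm_X_minus1 v0"
      using v by (simp add: bounded_mild_solution_def)
    interpret G1: gevrey_gain \<mu> "\<mu> / 2" "3 / 2 * \<mu>" "\<lambda>t. \<mu> * sqrt t"
      by (rule gevrey_gain_sqrt) fact
    interpret G2: gevrey_gain \<mu> "(1 - \<alpha>) * \<mu>" 0 "\<lambda>t. \<alpha> * \<mu> * t"
      by (rule gevrey_gain_linear) fact+
    interpret G1: mild_gevrey \<mu> v0 v "\<mu> / 2" "3 / 2 * \<mu>" "\<lambda>t. \<mu> * sqrt t" K n0 D1 c1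
      by unfold_locales (use bd n0 K small1 in \<open>auto simp: D1_def c1_def\<close>)
    interpret G2: mild_gevrey \<mu> v0 v "(1 - \<alpha>) * \<mu>" 0 "\<lambda>t. \<alpha> * \<mu> * t" K n0 D2 c2
      by unfold_locales (use bd n0 K small1 in \<open>auto simp: D2_def c2_def\<close>)
    have "analyticity_radius (v t) \<ge> ereal (max (\<mu> * sqrt t) (\<alpha> * \<mu> * t))" if "0 < t" for t
      using G1.analyticity_radius_ge[of t] G2.analyticity_radius_ge[of t] that \<alpha> assms(1)
      by (simp add: max_def)
    moreover have "norm_Y (exp_absD (\<lambda>t. \<mu> * sqrt t) v) + norm_Y (exp_absD (\<lambda>t. \<alpha> * \<mu> * t) v)
        \<le> ennreal C * norm_X_minus1 v0"
    proof -
      have "norm_Y (exp_absD (\<lambda>t. \<mu> * sqrt t) v) + norm_Y (exp_absD (\<lambda>t. \<alpha> * \<mu> * t) v)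
          \<le> ennreal (3 * c1 * n0) + ennreal (3 * c2 * n0)"
        by (intro add_mono G1.norm_exp_absD G2.norm_exp_absD)
      also have "\<dots> = ennreal C * ennreal n0"
        using pos n0 by (simp add: C_def ennreal_mult[symmetric] ennreal_plus[symmetric] distrib_right del: ennreal_plus)
      finally show ?thesis by (simp add: n0)
    qed
    ultimately show ?thesis using G1.exp_absD_space_Y G2.exp_absD_space_Y by blast
  qed
  have "0 < \<epsilon>0" "\<epsilon>0 \<le> \<epsilon>1" "0 < C" using pos \<epsilon>1 by (auto simp: \<epsilon>0_def C_def)
  with main show "\<exists>\<epsilon>0 C. 0 < \<epsilon>0 \<and> \<epsilon>0 \<le> \<epsilon>1 \<and> 0 < C \<and>
      (\<forall>v0\<in>space_X_minus1. norm_X_minus1 v0 < ennreal \<epsilon>0 \<longrightarrow>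
        (\<forall>v. bounded_mild_solution \<mu> K v0 v \<longrightarrow>
          (\<forall>t>0. analyticity_radius (v t) \<ge> ereal (max (\<mu> * sqrt t) (\<alpha> * \<mu> * t))) \<and>
          exp_absD (\<lambda>t. \<mu> * sqrt t) v \<in> space_Y \<and>
          exp_absD (\<lambda>t. \<alpha> * \<mu> * t) v \<in> space_Y \<and>
          norm_Y (exp_absD (\<lambda>t. \<mu> * sqrt t) v) + norm_Y (exp_absD (\<lambda>t. \<alpha> * \<mu> * t) v)
            \<le> ennreal C * norm_X_minus1 v0))"
    by blast
qed

end
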